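(* Let $k$ be a division ring. If $k$ is not a field (i.e. not commutative), then there is no additive closed symmetric monoidal structure on the category of $k$-modules. If $k$ is a field, there is a unique additive closed symmetric monoidal structure on the category of $k$-modules, up to symmetric monoidal equivalence.
   Context: Modules are left modules. A closed symmetric monoidal structure on a category of modules is additive if the monoidal product is an additive functor in each variable. Two such structures on the same category are symmetric monoidally equivalent if there is an additive (strong) symmetric monoidal functor from one to the other which is an equivalence of categories. *)

theory Defs
  imports "HOL-Algebra.Module"
begin

unbundle cardinal_syntax

section \<open>Preadditive categories, additive functors, adjoints, equivalences\<close>

record ('o, 'a) precat =
  Obj :: "'o set"
  Arr :: "'a set"
  Dom :: "'a \<Rightarrow> 'o"
  Cod :: "'a \<Rightarrow> 'o"
  Idt :: "'o \<Rightarrow> 'a"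
  Cmp :: "'a \<Rightarrow> 'a \<Rightarrow> 'a"  (infixr \<open>\<cdot>\<index>\<close> 65)
  Pls :: "'a \<Rightarrow> 'a \<Rightarrow> 'a"
  Zro :: "'o \<Rightarrow> 'o \<Rightarrow> 'a"

definition arrows :: "('o, 'a, 'z) precat_scheme \<Rightarrow> 'o \<Rightarrow> 'o \<Rightarrow> 'a set" where
  "arrows C x y = {f \<in> Arr C. Dom C f = x \<and> Cod C f = y}"

definition arrow_group :: "('o, 'a, 'z) precat_scheme \<Rightarrow> 'o \<Rightarrow> 'o \<Rightarrow> 'a monoid" where
  "arrow_group C x y = \<lparr>carrier = arrows C x y, mult = Pls C, one = Zro C x y\<rparr>"

locale preadditive_category =
  fixes C :: "('o, 'a, 'z) precat_scheme" (structure)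
  assumes Dom_Obj: "f \<in> Arr C \<Longrightarrow> Dom C f \<in> Obj C"
    and Cod_Obj: "f \<in> Arr C \<Longrightarrow> Cod C f \<in> Obj C"
    and Idt_arrow: "x \<in> Obj C \<Longrightarrow> Idt C x \<in> arrows C x x"
    and Cmp_arrow: "\<lbrakk>f \<in> arrows C x y; g \<in> arrows C y z\<rbrakk> \<Longrightarrow> g \<cdot> f \<in> arrows C x z"
    and Cmp_Idt: "f \<in> arrows C x y \<Longrightarrow> f \<cdot> Idt C x = f"
    and Idt_Cmp: "f \<in> arrows C x y \<Longrightarrow> Idt C y \<cdot> f = f"
    and Cmp_assoc: "\<lbrakk>f \<in> arrows C w x; g \<in> arrows C x y; h \<in> arrows C y z\<rbrakk>
      \<Longrightarrow> (h \<cdot> g) \<cdot> f = h \<cdot> (g \<cdot> f)"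
    and arrow_group: "\<lbrakk>x \<in> Obj C; y \<in> Obj C\<rbrakk> \<Longrightarrow> comm_group (arrow_group C x y)"
    and Cmp_Pls: "\<lbrakk>f \<in> arrows C x y; f' \<in> arrows C x y; g \<in> arrows C y z\<rbrakk>
      \<Longrightarrow> g \<cdot> Pls C f f' = Pls C (g \<cdot> f) (g \<cdot> f')"
    and Pls_Cmp: "\<lbrakk>f \<in> arrows C x y; g \<in> arrows C y z; g' \<in> arrows C y z\<rbrakk>
      \<Longrightarrow> Pls C g g' \<cdot> f = Pls C (g \<cdot> f) (g' \<cdot> f)"

definition is_iso :: "('o, 'a, 'z) precat_scheme \<Rightarrow> 'o \<Rightarrow> 'o \<Rightarrow> 'a \<Rightarrow> bool" where
  "is_iso C x y f \<longleftrightarrow> f \<in> arrows C x y \<and>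
     (\<exists>g \<in> arrows C y x. g \<cdot>\<^bsub>C\<^esub> f = Idt C x \<and> f \<cdot>\<^bsub>C\<^esub> g = Idt C y)"

record ('o, 'a, 'p, 'b) ftor =
  FO :: "'o \<Rightarrow> 'p"
  FA :: "'a \<Rightarrow> 'b"

definition is_functor ::
  "('o, 'a, 'z) precat_scheme \<Rightarrow> ('p, 'b, 'w) precat_scheme \<Rightarrow> ('o, 'a, 'p, 'b) ftor \<Rightarrow> bool" where
  "is_functor C D F \<longleftrightarrow>
     (\<forall>x \<in> Obj C. FO F x \<in> Obj D) \<and>
     (\<forall>x \<in> Obj C. \<forall>y \<in> Obj C. \<forall>f \<in> arrows C x y. FA F f \<in> arrows D (FO F x) (FO F y)) \<and>
     (\<forall>x \<in> Obj C. FA F (Idt C x) = Idt D (FO F x)) \<and>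
     (\<forall>x \<in> Obj C. \<forall>y \<in> Obj C. \<forall>z \<in> Obj C. \<forall>f \<in> arrows C x y. \<forall>g \<in> arrows C y z.
        FA F (g \<cdot>\<^bsub>C\<^esub> f) = FA F g \<cdot>\<^bsub>D\<^esub> FA F f)"

definition is_additive ::
  "('o, 'a, 'z) precat_scheme \<Rightarrow> ('p, 'b, 'w) precat_scheme \<Rightarrow> ('o, 'a, 'p, 'b) ftor \<Rightarrow> bool" where
  "is_additive C D F \<longleftrightarrow>
     (\<forall>x \<in> Obj C. \<forall>y \<in> Obj C. \<forall>f \<in> arrows C x y. \<forall>f' \<in> arrows C x y.
        FA F (Pls C f f') = Pls D (FA F f) (FA F f'))"

definition id_ftor :: "('o, 'a, 'o, 'a) ftor" where
  "id_ftor = \<lparr>FO = (\<lambda>x. x), FA = (\<lambda>f. f)\<rparr>"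

definition comp_ftor ::
  "('p, 'b, 'q, 'c) ftor \<Rightarrow> ('o, 'a, 'p, 'b) ftor \<Rightarrow> ('o, 'a, 'q, 'c) ftor" where
  "comp_ftor G F = \<lparr>FO = FO G \<circ> FO F, FA = FA G \<circ> FA F\<rparr>"

definition natural_iso ::
  "('o, 'a, 'z) precat_scheme \<Rightarrow> ('p, 'b, 'w) precat_scheme \<Rightarrow>
   ('o, 'a, 'p, 'b) ftor \<Rightarrow> ('o, 'a, 'p, 'b) ftor \<Rightarrow> ('o \<Rightarrow> 'b) \<Rightarrow> bool" where
  "natural_iso C D F G t \<longleftrightarrow>
     (\<forall>x \<in> Obj C. is_iso D (FO F x) (FO G x) (t x)) \<and>
     (\<forall>x \<in> Obj C. \<forall>y \<in> Obj C. \<forall>f \<in> arrows C x y.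
        t y \<cdot>\<^bsub>D\<^esub> FA F f = FA G f \<cdot>\<^bsub>D\<^esub> t x)"

definition is_equivalence ::
  "('o, 'a, 'z) precat_scheme \<Rightarrow> ('p, 'b, 'w) precat_scheme \<Rightarrow> ('o, 'a, 'p, 'b) ftor \<Rightarrow> bool" where
  "is_equivalence C D F \<longleftrightarrow> is_functor C D F \<and>
     (\<exists>G s t. is_functor D C G \<and>
        natural_iso C C (comp_ftor G F) id_ftor s \<and>
        natural_iso D D (comp_ftor F G) id_ftor t)"

definition adjunction ::
  "('o, 'a, 'z) precat_scheme \<Rightarrow> ('p, 'b, 'w) precat_scheme \<Rightarrow>
   ('o, 'a, 'p, 'b) ftor \<Rightarrow> ('p, 'b, 'o, 'a) ftor \<Rightarrow> ('o \<Rightarrow> 'p \<Rightarrow> 'b \<Rightarrow> 'a) \<Rightarrow> bool" where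
  "adjunction C D F G \<phi> \<longleftrightarrow> is_functor C D F \<and> is_functor D C G \<and>
     (\<forall>x \<in> Obj C. \<forall>z \<in> Obj D. bij_betw (\<phi> x z) (arrows D (FO F x) z) (arrows C x (FO G z))) \<and>
     (\<forall>x \<in> Obj C. \<forall>x' \<in> Obj C. \<forall>z \<in> Obj D. \<forall>z' \<in> Obj D.
        \<forall>h \<in> arrows C x' x. \<forall>f \<in> arrows D (FO F x) z. \<forall>g \<in> arrows D z z'.
        \<phi> x' z' (g \<cdot>\<^bsub>D\<^esub> f \<cdot>\<^bsub>D\<^esub> FA F h) = FA G g \<cdot>\<^bsub>C\<^esub> \<phi> x z f \<cdot>\<^bsub>C\<^esub> h)"


section \<open>Symmetric monoidal structures\<close>

record ('o, 'a) monstr =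
  tenO :: "'o \<Rightarrow> 'o \<Rightarrow> 'o"  (infixr \<open>\<otimes>o\<index>\<close> 70)
  tenA :: "'a \<Rightarrow> 'a \<Rightarrow> 'a"  (infixr \<open>\<otimes>a\<index>\<close> 70)
  unit :: "'o"
  ass :: "'o \<Rightarrow> 'o \<Rightarrow> 'o \<Rightarrow> 'a"
  lun :: "'o \<Rightarrow> 'a"
  run :: "'o \<Rightarrow> 'a"
  swp :: "'o \<Rightarrow> 'o \<Rightarrow> 'a"

locale symmetric_monoidal = preadditive_category C
  for C :: "('o, 'a, 'z) precat_scheme" (structure) +
  fixes M :: "('o, 'a) monstr" (structure)
  assumes tenO_Obj: "\<lbrakk>x \<in> Obj C; y \<in> Obj C\<rbrakk> \<Longrightarrow> x \<otimes>o\<^bsub>M\<^esub> y \<in> Obj C"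
    and tenA_arrow: "\<lbrakk>f \<in> arrows C x x'; g \<in> arrows C y y'\<rbrakk>
      \<Longrightarrow> f \<otimes>a\<^bsub>M\<^esub> g \<in> arrows C (x \<otimes>o\<^bsub>M\<^esub> y) (x' \<otimes>o\<^bsub>M\<^esub> y')"
    and tenA_Idt: "\<lbrakk>x \<in> Obj C; y \<in> Obj C\<rbrakk> \<Longrightarrow> Idt C x \<otimes>a\<^bsub>M\<^esub> Idt C y = Idt C (x \<otimes>o\<^bsub>M\<^esub> y)"
    and tenA_Cmp: "\<lbrakk>f \<in> arrows C x x'; f' \<in> arrows C x' x''; g \<in> arrows C y y'; g' \<in> arrows C y' y''\<rbrakk>
      \<Longrightarrow> (f' \<cdot>\<^bsub>C\<^esub> f) \<otimes>a\<^bsub>M\<^esub> (g' \<cdot>\<^bsub>C\<^esub> g) = (f' \<otimes>a\<^bsub>M\<^esub> g') \<cdot>\<^bsub>C\<^esub> (f \<otimes>a\<^bsub>M\<^esub> g)"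
    and unit_Obj: "unit M \<in> Obj C"
    and ass_iso: "\<lbrakk>x \<in> Obj C; y \<in> Obj C; z \<in> Obj C\<rbrakk>
      \<Longrightarrow> is_iso C ((x \<otimes>o\<^bsub>M\<^esub> y) \<otimes>o\<^bsub>M\<^esub> z) (x \<otimes>o\<^bsub>M\<^esub> (y \<otimes>o\<^bsub>M\<^esub> z)) (ass M x y z)"
    and ass_natural: "\<lbrakk>f \<in> arrows C x x'; g \<in> arrows C y y'; h \<in> arrows C z z'\<rbrakk>
      \<Longrightarrow> ass M x' y' z' \<cdot>\<^bsub>C\<^esub> ((f \<otimes>a\<^bsub>M\<^esub> g) \<otimes>a\<^bsub>M\<^esub> h) = (f \<otimes>a\<^bsub>M\<^esub> (g \<otimes>a\<^bsub>M\<^esub> h)) \<cdot>\<^bsub>C\<^esub> ass M x y z"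
    and lun_iso: "x \<in> Obj C \<Longrightarrow> is_iso C (unit M \<otimes>o\<^bsub>M\<^esub> x) x (lun M x)"
    and lun_natural: "f \<in> arrows C x y
      \<Longrightarrow> lun M y \<cdot>\<^bsub>C\<^esub> (Idt C (unit M) \<otimes>a\<^bsub>M\<^esub> f) = f \<cdot>\<^bsub>C\<^esub> lun M x"
    and run_iso: "x \<in> Obj C \<Longrightarrow> is_iso C (x \<otimes>o\<^bsub>M\<^esub> unit M) x (run M x)"
    and run_natural: "f \<in> arrows C x y
      \<Longrightarrow> run M y \<cdot>\<^bsub>C\<^esub> (f \<otimes>a\<^bsub>M\<^esub> Idt C (unit M)) = f \<cdot>\<^bsub>C\<^esub> run M x"
    and swp_iso: "\<lbrakk>x \<in> Obj C; y \<in> Obj C\<rbrakk> \<Longrightarrow> is_iso C (x \<otimes>o\<^bsub>M\<^esub> y) (y \<otimes>o\<^bsub>M\<^esub> x) (swp M x y)"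
    and swp_natural: "\<lbrakk>f \<in> arrows C x x'; g \<in> arrows C y y'\<rbrakk>
      \<Longrightarrow> swp M x' y' \<cdot>\<^bsub>C\<^esub> (f \<otimes>a\<^bsub>M\<^esub> g) = (g \<otimes>a\<^bsub>M\<^esub> f) \<cdot>\<^bsub>C\<^esub> swp M x y"
    and pentagon: "\<lbrakk>w \<in> Obj C; x \<in> Obj C; y \<in> Obj C; z \<in> Obj C\<rbrakk>
      \<Longrightarrow> (Idt C w \<otimes>a\<^bsub>M\<^esub> ass M x y z) \<cdot>\<^bsub>C\<^esub> ass M w (x \<otimes>o\<^bsub>M\<^esub> y) z \<cdot>\<^bsub>C\<^esub> (ass M w x y \<otimes>a\<^bsub>M\<^esub> Idt C z)
        = ass M w x (y \<otimes>o\<^bsub>M\<^esub> z) \<cdot>\<^bsub>C\<^esub> ass M (w \<otimes>o\<^bsub>M\<^esub> x) y z"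
    and triangle: "\<lbrakk>x \<in> Obj C; y \<in> Obj C\<rbrakk>
      \<Longrightarrow> (Idt C x \<otimes>a\<^bsub>M\<^esub> lun M y) \<cdot>\<^bsub>C\<^esub> ass M x (unit M) y = run M x \<otimes>a\<^bsub>M\<^esub> Idt C y"
    and hexagon: "\<lbrakk>x \<in> Obj C; y \<in> Obj C; z \<in> Obj C\<rbrakk>
      \<Longrightarrow> ass M y z x \<cdot>\<^bsub>C\<^esub> swp M x (y \<otimes>o\<^bsub>M\<^esub> z) \<cdot>\<^bsub>C\<^esub> ass M x y z
        = (Idt C y \<otimes>a\<^bsub>M\<^esub> swp M x z) \<cdot>\<^bsub>C\<^esub> ass M y x z \<cdot>\<^bsub>C\<^esub> (swp M x y \<otimes>a\<^bsub>M\<^esub> Idt C z)"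
    and symmetry: "\<lbrakk>x \<in> Obj C; y \<in> Obj C\<rbrakk>
      \<Longrightarrow> swp M y x \<cdot>\<^bsub>C\<^esub> swp M x y = Idt C (x \<otimes>o\<^bsub>M\<^esub> y)"

definition tensor_right ::
  "('o, 'a, 'z) precat_scheme \<Rightarrow> ('o, 'a) monstr \<Rightarrow> 'o \<Rightarrow> ('o, 'a, 'o, 'a) ftor" where
  "tensor_right C M y = \<lparr>FO = (\<lambda>x. x \<otimes>o\<^bsub>M\<^esub> y), FA = (\<lambda>f. f \<otimes>a\<^bsub>M\<^esub> Idt C y)\<rparr>"

definition tensor_left ::
  "('o, 'a, 'z) precat_scheme \<Rightarrow> ('o, 'a) monstr \<Rightarrow> 'o \<Rightarrow> ('o, 'a, 'o, 'a) ftor" where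
  "tensor_left C M x = \<lparr>FO = (\<lambda>y. x \<otimes>o\<^bsub>M\<^esub> y), FA = (\<lambda>f. Idt C x \<otimes>a\<^bsub>M\<^esub> f)\<rparr>"

locale closed_symmetric_monoidal = symmetric_monoidal +
  assumes closed: "y \<in> Obj C \<Longrightarrow> \<exists>H \<phi>. adjunction C C (tensor_right C M y) H \<phi>"

locale additive_closed_symmetric_monoidal = closed_symmetric_monoidal +
  assumes additive_left: "y \<in> Obj C \<Longrightarrow> is_additive C C (tensor_right C M y)"
    and additive_right: "x \<in> Obj C \<Longrightarrow> is_additive C C (tensor_left C M x)"

locale symmetric_monoidal_functor =
  source: symmetric_monoidal C M + target: symmetric_monoidal D N
  for C :: "('o, 'a, 'z) precat_scheme" and M :: "('o, 'a) monstr"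
    and D :: "('p, 'b, 'w) precat_scheme" and N :: "('p, 'b) monstr" +
  fixes F :: "('o, 'a, 'p, 'b) ftor" and \<epsilon> :: 'b and \<mu> :: "'o \<Rightarrow> 'o \<Rightarrow> 'b"
  assumes F_functor: "is_functor C D F"
    and \<epsilon>_iso: "is_iso D (unit N) (FO F (unit M)) \<epsilon>"
    and \<mu>_iso: "\<lbrakk>x \<in> Obj C; y \<in> Obj C\<rbrakk>
      \<Longrightarrow> is_iso D (FO F x \<otimes>o\<^bsub>N\<^esub> FO F y) (FO F (x \<otimes>o\<^bsub>M\<^esub> y)) (\<mu> x y)"
    and \<mu>_natural: "\<lbrakk>f \<in> arrows C x x'; g \<in> arrows C y y'\<rbrakk>
      \<Longrightarrow> \<mu> x' y' \<cdot>\<^bsub>D\<^esub> (FA F f \<otimes>a\<^bsub>N\<^esub> FA F g) = FA F (f \<otimes>a\<^bsub>M\<^esub> g) \<cdot>\<^bsub>D\<^esub> \<mu> x y"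
    and F_ass: "\<lbrakk>x \<in> Obj C; y \<in> Obj C; z \<in> Obj C\<rbrakk>
      \<Longrightarrow> \<mu> x (y \<otimes>o\<^bsub>M\<^esub> z) \<cdot>\<^bsub>D\<^esub> (Idt D (FO F x) \<otimes>a\<^bsub>N\<^esub> \<mu> y z) \<cdot>\<^bsub>D\<^esub> ass N (FO F x) (FO F y) (FO F z)
        = FA F (ass M x y z) \<cdot>\<^bsub>D\<^esub> \<mu> (x \<otimes>o\<^bsub>M\<^esub> y) z \<cdot>\<^bsub>D\<^esub> (\<mu> x y \<otimes>a\<^bsub>N\<^esub> Idt D (FO F z))"
    and F_lun: "x \<in> Obj C
      \<Longrightarrow> lun N (FO F x) = FA F (lun M x) \<cdot>\<^bsub>D\<^esub> \<mu> (unit M) x \<cdot>\<^bsub>D\<^esub> (\<epsilon> \<otimes>a\<^bsub>N\<^esub> Idt D (FO F x))"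
    and F_run: "x \<in> Obj C
      \<Longrightarrow> run N (FO F x) = FA F (run M x) \<cdot>\<^bsub>D\<^esub> \<mu> x (unit M) \<cdot>\<^bsub>D\<^esub> (Idt D (FO F x) \<otimes>a\<^bsub>N\<^esub> \<epsilon>)"
    and F_swp: "\<lbrakk>x \<in> Obj C; y \<in> Obj C\<rbrakk>
      \<Longrightarrow> FA F (swp M x y) \<cdot>\<^bsub>D\<^esub> \<mu> x y = \<mu> y x \<cdot>\<^bsub>D\<^esub> swp N (FO F x) (FO F y)"

definition symmetric_monoidally_equivalent ::
  "('o, 'a, 'z) precat_scheme \<Rightarrow> ('o, 'a) monstr \<Rightarrow> ('o, 'a) monstr \<Rightarrow> bool" where
  "symmetric_monoidally_equivalent C M N \<longleftrightarrow>
     (\<exists>F \<epsilon> \<mu>. symmetric_monoidal_functor C M C N F \<epsilon> \<mu> \<and> is_additive C C F \<and> is_equivalence C C F)"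


section \<open>The category of left modules\<close>

locale division_ring = ring R for R (structure) +
  assumes one_not_zero: "\<one> \<noteq> \<zero>"
    and Units_nonzero: "Units R = carrier R - {\<zero>}"

text \<open>The library locale \<^locale>\<open>module\<close> requires a commutative ring. As there, the fields
  \<^const>\<open>mult\<close> and \<^const>\<open>one\<close> of \<open>M\<close> play no role.\<close>

locale left_module = R?: ring R + M?: abelian_group M
  for R (structure) and M :: "('k, 'u) module" (structure) +
  assumes smult_closed: "\<lbrakk>a \<in> carrier R; x \<in> carrier M\<rbrakk> \<Longrightarrow> a \<odot>\<^bsub>M\<^esub> x \<in> carrier M"
    and smult_l_distr: "\<lbrakk>a \<in> carrier R; b \<in> carrier R; x \<in> carrier M\<rbrakk>
      \<Longrightarrow> (a \<oplus>\<^bsub>R\<^esub> b) \<odot>\<^bsub>M\<^esub> x = a \<odot>\<^bsub>M\<^esub> x \<oplus>\<^bsub>M\<^esub> b \<odot>\<^bsub>M\<^esub> x"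
    and smult_r_distr: "\<lbrakk>a \<in> carrier R; x \<in> carrier M; y \<in> carrier M\<rbrakk>
      \<Longrightarrow> a \<odot>\<^bsub>M\<^esub> (x \<oplus>\<^bsub>M\<^esub> y) = a \<odot>\<^bsub>M\<^esub> x \<oplus>\<^bsub>M\<^esub> a \<odot>\<^bsub>M\<^esub> y"
    and smult_assoc: "\<lbrakk>a \<in> carrier R; b \<in> carrier R; x \<in> carrier M\<rbrakk>
      \<Longrightarrow> (a \<otimes>\<^bsub>R\<^esub> b) \<odot>\<^bsub>M\<^esub> x = a \<odot>\<^bsub>M\<^esub> (b \<odot>\<^bsub>M\<^esub> x)"
    and smult_one: "x \<in> carrier M \<Longrightarrow> \<one>\<^bsub>R\<^esub> \<odot>\<^bsub>M\<^esub> x = x"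

text \<open>A type \<open>'u\<close> serves as the universe in which modules live: a set is small if it has fewer
  elements than \<open>'u\<close>, and the modules of the category are those with a small carrier inside
  \<open>'u\<close>. Up to isomorphism these are all modules of size less than the cardinality of \<open>'u\<close>.
  If that cardinality is strongly inaccessible, the small sets form a Grothendieck universe;
  only the closure under power sets is required here (regularity is not), so that every
  Grothendieck universe is covered.\<close>

definition small :: "'u itself \<Rightarrow> 'b set \<Rightarrow> bool" where
  "small U A \<longleftrightarrow> |A| <o |UNIV :: 'u set|"

definition universe :: "'u itself \<Rightarrow> bool" where
  "universe U \<longleftrightarrow> infinite (UNIV :: 'u set) \<and> (\<forall>A :: 'u set. small U A \<longrightarrow> small U (Pow A))"

definition linear_maps ::
  "('k, 'x) ring_scheme \<Rightarrow> ('k, 'u) module \<Rightarrow> ('k, 'u) module \<Rightarrow> ('u \<Rightarrow> 'u) set" where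
  "linear_maps R M N = {f \<in> carrier M \<rightarrow>\<^sub>E carrier N.
     (\<forall>x \<in> carrier M. \<forall>y \<in> carrier M. f (x \<oplus>\<^bsub>M\<^esub> y) = f x \<oplus>\<^bsub>N\<^esub> f y) \<and>
     (\<forall>a \<in> carrier R. \<forall>x \<in> carrier M. f (a \<odot>\<^bsub>M\<^esub> x) = a \<odot>\<^bsub>N\<^esub> f x)}"

type_synonym ('k, 'u) modarrow = "('k, 'u) module \<times> ('u \<Rightarrow> 'u) \<times> ('k, 'u) module"

definition Mod :: "('k, 'x) ring_scheme \<Rightarrow> 'u itself \<Rightarrow> (('k, 'u) module, ('k, 'u) modarrow) precat" where
  "Mod R U = \<lparr>
     Obj = {M. left_module R M \<and> small U (carrier M)},
     Arr = {(M, f, N). left_module R M \<and> small U (carrier M) \<and>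
              left_module R N \<and> small U (carrier N) \<and> f \<in> linear_maps R M N},
     Dom = (\<lambda>(M, f, N). M),
     Cod = (\<lambda>(M, f, N). N),
     Idt = (\<lambda>M. (M, \<lambda>x \<in> carrier M. x, M)),
     Cmp = (\<lambda>(M', g, N) (M, f, N'). (M, compose (carrier M) g f, N)),
     Pls = (\<lambda>(M, f, N) (M', g, N'). (M, \<lambda>x \<in> carrier M. f x \<oplus>\<^bsub>N\<^esub> g x, N)),
     Zro = (\<lambda>M N. (M, \<lambda>x \<in> carrier M. \<zero>\<^bsub>N\<^esub>, N))\<rparr>"

end

theory Submission
  imports Defs
begin

text \<open>Let \<open>S\<close> be the unit of an additive symmetric monoidal structure on \<open>k\<close>-modules. By the
  Eckmann--Hilton argument the endomorphisms of \<open>S\<close> commute; since \<open>S \<noteq> 0\<close> and functionals separate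
  points, \<open>S\<close> is a line \<open>k u\<close> and \<open>k\<close> is commutative. Elements \<open>a\<close> of \<open>x\<close> are then arrows \<open>S \<rightarrow> x\<close>, so
  that \<open>a\<close> and \<open>b\<close> have a product \<open>p a b\<close> in \<open>x \<otimes> y\<close>. If the structure is closed, then \<open>p\<close> is the universal
  bilinear map: arrows \<open>x \<otimes> y \<rightarrow> z\<close> are arrows from \<open>x\<close> to the internal hom, whose elements are, through
  \<open>S \<otimes> y \<cong> y\<close>, the linear maps \<open>y \<rightarrow> z\<close>. No colimits are used, hence no regularity of the universe. The
  structure maps act on products as the standard ones up to scalars, and the coherence axioms make
  these scalars \<open>1\<close>. So any two structures are identified by the comparison of their universal bilinear
  maps, with the identity functor. Conversely the usual tensor product gives a structure if \<open>k\<close> is a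
  field.\<close>

section \<open>Linear maps and functionals\<close>

text \<open>The monoidal product is only assumed additive, so compatibility with scalars has to be
  earned: naturality of the two unitors shows that a scalar acting on either factor of
  \<open>S \<otimes> S\<close> acts as that scalar on the whole. This makes \<open>p\<close>
  bilinear over \<open>k\<close>. The product is normalised by the right unitor, so that three
  unknown scalars remain: \<rho> for the left unitor, \<alpha> for the associator, \<sigma> for the
  symmetry. The triangle gives only \<alpha>\<rho> = 1; the pentagon gives \<alpha>^3 = \<alpha>^2;
  the hexagon gives \<sigma> = \<sigma>^2, which excludes the sign that the symmetry axiom alone
  would allow. The main obstacle is that nothing says at the outset that
  \<open>x \<otimes> y\<close> is generated by products. It is overcome by moving to the internal
  hom, where arrows can be tested on elements, and using that every element of
  \<open>S \<otimes> y\<close> is a product with \<open>u\<close>. For existence, modules must live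
  on the type of the universe, while bilinear forms, their dual and spaces of linear maps do not;
  each is shown to be small and then copied along an injection.\<close>

definition is_linear ::
  "('k, 'x) ring_scheme \<Rightarrow> ('k, 'v) module \<Rightarrow> ('k, 'w) module \<Rightarrow> ('v \<Rightarrow> 'w) \<Rightarrow> bool" where
  "is_linear R M N f \<longleftrightarrow> f \<in> carrier M \<rightarrow> carrier N \<and>
     (\<forall>x \<in> carrier M. \<forall>y \<in> carrier M. f (x \<oplus>\<^bsub>M\<^esub> y) = f x \<oplus>\<^bsub>N\<^esub> f y) \<and>
     (\<forall>a \<in> carrier R. \<forall>x \<in> carrier M. f (a \<odot>\<^bsub>M\<^esub> x) = a \<odot>\<^bsub>N\<^esub> f x)"

lemma is_linearI:
  assumes "\<And>x. x \<in> carrier M \<Longrightarrow> f x \<in> carrier N"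
    and "\<And>x y. \<lbrakk>x \<in> carrier M; y \<in> carrier M\<rbrakk> \<Longrightarrow> f (x \<oplus>\<^bsub>M\<^esub> y) = f x \<oplus>\<^bsub>N\<^esub> f y"
    and "\<And>a x. \<lbrakk>a \<in> carrier R; x \<in> carrier M\<rbrakk> \<Longrightarrow> f (a \<odot>\<^bsub>M\<^esub> x) = a \<odot>\<^bsub>N\<^esub> f x"
  shows "is_linear R M N f"
  using assms by (auto simp: is_linear_def)

lemma
  assumes "is_linear R M N f"
  shows linear_closed: "x \<in> carrier M \<Longrightarrow> f x \<in> carrier N"
    and linear_add: "\<lbrakk>x \<in> carrier M; y \<in> carrier M\<rbrakk> \<Longrightarrow> f (x \<oplus>\<^bsub>M\<^esub> y) = f x \<oplus>\<^bsub>N\<^esub> f y"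
    and linear_smult: "\<lbrakk>a \<in> carrier R; x \<in> carrier M\<rbrakk> \<Longrightarrow> f (a \<odot>\<^bsub>M\<^esub> x) = a \<odot>\<^bsub>N\<^esub> f x"
  using assms by (auto simp: is_linear_def)

lemma is_linear_cong:
  assumes "\<And>x. x \<in> carrier M \<Longrightarrow> f x = g x" and "left_module R M"
  shows "is_linear R M N f \<longleftrightarrow> is_linear R M N g"
proof -
  interpret left_module R M by fact
  show ?thesis
    by (simp add: is_linear_def Pi_iff assms(1) smult_closed)
qed

lemma is_linear_comp:
  assumes "is_linear R M N f" and "is_linear R N P g"
  shows "is_linear R M P (\<lambda>x. g (f x))"
  using assms by (auto simp: is_linear_def Pi_iff)

lemma (in left_module) smult_l_null:
  assumes "x \<in> carrier M" shows "\<zero>\<^bsub>R\<^esub> \<odot>\<^bsub>M\<^esub> x = \<zero>\<^bsub>M\<^esub>"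
proof -
  have "\<zero>\<^bsub>R\<^esub> \<odot>\<^bsub>M\<^esub> x = \<zero>\<^bsub>R\<^esub> \<odot>\<^bsub>M\<^esub> x \<oplus>\<^bsub>M\<^esub> \<zero>\<^bsub>R\<^esub> \<odot>\<^bsub>M\<^esub> x"
    using smult_l_distr[of "\<zero>\<^bsub>R\<^esub>" "\<zero>\<^bsub>R\<^esub>" x] assms by simp
  then show ?thesis
    using assms smult_closed by (metis M.add.r_cancel_one' R.zero_closed)
qed

lemma (in left_module) smult_r_null:
  assumes "a \<in> carrier R" shows "a \<odot>\<^bsub>M\<^esub> \<zero>\<^bsub>M\<^esub> = \<zero>\<^bsub>M\<^esub>"
proof -
  have "a \<odot>\<^bsub>M\<^esub> \<zero>\<^bsub>M\<^esub> = a \<odot>\<^bsub>M\<^esub> \<zero>\<^bsub>M\<^esub> \<oplus>\<^bsub>M\<^esub> a \<odot>\<^bsub>M\<^esub> \<zero>\<^bsub>M\<^esub>"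
    using smult_r_distr[of a "\<zero>\<^bsub>M\<^esub>" "\<zero>\<^bsub>M\<^esub>"] assms by simp
  then show ?thesis
    using assms smult_closed by (metis M.add.r_cancel_one' M.zero_closed)
qed

lemma (in left_module) smult_l_minus:
  assumes "a \<in> carrier R" "x \<in> carrier M"
  shows "(\<ominus>\<^bsub>R\<^esub> a) \<odot>\<^bsub>M\<^esub> x = \<ominus>\<^bsub>M\<^esub> (a \<odot>\<^bsub>M\<^esub> x)"
proof -
  have "(\<ominus>\<^bsub>R\<^esub> a) \<odot>\<^bsub>M\<^esub> x \<oplus>\<^bsub>M\<^esub> a \<odot>\<^bsub>M\<^esub> x = \<zero>\<^bsub>M\<^esub>"
    using smult_l_distr[of "\<ominus>\<^bsub>R\<^esub> a" a x] assms by (simp add: R.l_neg smult_l_null)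
  then show ?thesis
    using assms smult_closed by (metis M.minus_equality R.add.inv_closed)
qed

lemma (in left_module) smult_minus_one:
  "x \<in> carrier M \<Longrightarrow> (\<ominus>\<^bsub>R\<^esub> \<one>\<^bsub>R\<^esub>) \<odot>\<^bsub>M\<^esub> x = \<ominus>\<^bsub>M\<^esub> x"
  by (simp add: smult_l_minus smult_one)

lemma is_linear_zero:
  assumes "is_linear R M N f" "left_module R M" "left_module R N"
  shows "f \<zero>\<^bsub>M\<^esub> = \<zero>\<^bsub>N\<^esub>"
proof -
  interpret M: left_module R M by fact
  interpret N: left_module R N by fact
  have "f (\<zero>\<^bsub>R\<^esub> \<odot>\<^bsub>M\<^esub> \<zero>\<^bsub>M\<^esub>) = \<zero>\<^bsub>R\<^esub> \<odot>\<^bsub>N\<^esub> f \<zero>\<^bsub>M\<^esub>"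
    using linear_smult[OF assms(1)] by simp
  then show ?thesis
    using linear_closed[OF assms(1)] by (simp add: M.smult_l_null N.smult_l_null)
qed

text \<open>Additive inverses are demanded as an equation for (-1) x instead of an existential
  statement, so that concrete modules can be checked by rewriting.\<close>

lemma left_moduleI:
  assumes "ring R"
    and "\<And>x y. \<lbrakk>x \<in> carrier M; y \<in> carrier M\<rbrakk> \<Longrightarrow> x \<oplus>\<^bsub>M\<^esub> y \<in> carrier M"
    and "\<zero>\<^bsub>M\<^esub> \<in> carrier M"
    and "\<And>x y z. \<lbrakk>x \<in> carrier M; y \<in> carrier M; z \<in> carrier M\<rbrakk>
      \<Longrightarrow> (x \<oplus>\<^bsub>M\<^esub> y) \<oplus>\<^bsub>M\<^esub> z = x \<oplus>\<^bsub>M\<^esub> (y \<oplus>\<^bsub>M\<^esub> z)"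
    and "\<And>x y. \<lbrakk>x \<in> carrier M; y \<in> carrier M\<rbrakk> \<Longrightarrow> x \<oplus>\<^bsub>M\<^esub> y = y \<oplus>\<^bsub>M\<^esub> x"
    and "\<And>x. x \<in> carrier M \<Longrightarrow> \<zero>\<^bsub>M\<^esub> \<oplus>\<^bsub>M\<^esub> x = x"
    and "\<And>x. x \<in> carrier M \<Longrightarrow> (\<ominus>\<^bsub>R\<^esub> \<one>\<^bsub>R\<^esub>) \<odot>\<^bsub>M\<^esub> x \<oplus>\<^bsub>M\<^esub> x = \<zero>\<^bsub>M\<^esub>"
    and smult: "\<And>a x. \<lbrakk>a \<in> carrier R; x \<in> carrier M\<rbrakk> \<Longrightarrow> a \<odot>\<^bsub>M\<^esub> x \<in> carrier M"
    and "\<And>a b x. \<lbrakk>a \<in> carrier R; b \<in> carrier R; x \<in> carrier M\<rbrakk>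
      \<Longrightarrow> (a \<oplus>\<^bsub>R\<^esub> b) \<odot>\<^bsub>M\<^esub> x = a \<odot>\<^bsub>M\<^esub> x \<oplus>\<^bsub>M\<^esub> b \<odot>\<^bsub>M\<^esub> x"
    and "\<And>a x y. \<lbrakk>a \<in> carrier R; x \<in> carrier M; y \<in> carrier M\<rbrakk>
      \<Longrightarrow> a \<odot>\<^bsub>M\<^esub> (x \<oplus>\<^bsub>M\<^esub> y) = a \<odot>\<^bsub>M\<^esub> x \<oplus>\<^bsub>M\<^esub> a \<odot>\<^bsub>M\<^esub> y"
    and "\<And>a b x. \<lbrakk>a \<in> carrier R; b \<in> carrier R; x \<in> carrier M\<rbrakk>
      \<Longrightarrow> (a \<otimes>\<^bsub>R\<^esub> b) \<odot>\<^bsub>M\<^esub> x = a \<odot>\<^bsub>M\<^esub> (b \<odot>\<^bsub>M\<^esub> x)"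
    and "\<And>x. x \<in> carrier M \<Longrightarrow> \<one>\<^bsub>R\<^esub> \<odot>\<^bsub>M\<^esub> x = x"
  shows "left_module R M"
proof -
  interpret ring R by fact
  have "abelian_group M"
  proof (rule abelian_groupI)
    show "\<exists>y\<in>carrier M. y \<oplus>\<^bsub>M\<^esub> x = \<zero>\<^bsub>M\<^esub>" if "x \<in> carrier M" for x
      using assms(7)[OF that] smult[OF _ that] by blast
  qed (use assms in auto)
  then show ?thesis
    by (intro left_module.intro left_module_axioms.intro) (use assms in auto)
qed

definition regular_module :: "('k, 'x) ring_scheme \<Rightarrow> ('k, 'k) module" where
  "regular_module R = \<lparr>carrier = carrier R, monoid.mult = (\<otimes>\<^bsub>R\<^esub>), one = \<one>\<^bsub>R\<^esub>,
     zero = \<zero>\<^bsub>R\<^esub>, add = (\<oplus>\<^bsub>R\<^esub>), smult = (\<otimes>\<^bsub>R\<^esub>)\<rparr>"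

lemma regular_module_simps [simp]:
  "carrier (regular_module R) = carrier R" "add (regular_module R) = add R"
  "zero (regular_module R) = zero R" "smult (regular_module R) = mult R"
  by (simp_all add: regular_module_def)

lemma (in ring) left_module_regular: "left_module R (regular_module R)"
  by (rule left_moduleI)
    (auto simp: a_assoc l_distr r_distr m_assoc l_minus l_neg r_neg ring_axioms intro: a_comm)

text \<open>By Zorn there is a maximal submodule avoiding \<open>v\<close>; it is a complement of the line spanned
  by \<open>v\<close>.\<close>

lemma (in left_module) exists_functional:
  assumes "division_ring R" and v: "v \<in> carrier M" "v \<noteq> \<zero>\<^bsub>M\<^esub>"
  shows "\<exists>\<theta>. is_linear R M (regular_module R) \<theta> \<and> \<theta> v = \<one>\<^bsub>R\<^esub>"
proof -
  interpret D: division_ring R by fact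
  define sub where "sub W \<longleftrightarrow> W \<subseteq> carrier M \<and> \<zero>\<^bsub>M\<^esub> \<in> W \<and> (\<forall>x\<in>W. \<forall>y\<in>W. x \<oplus>\<^bsub>M\<^esub> y \<in> W) \<and>
    (\<forall>a\<in>carrier R. \<forall>x\<in>W. a \<odot>\<^bsub>M\<^esub> x \<in> W)" for W
  define \<A> where "\<A> = {W. sub W \<and> v \<notin> W}"
  have "{\<zero>\<^bsub>M\<^esub>} \<in> \<A>"
    using v by (auto simp: \<A>_def sub_def smult_r_null)
  moreover have "\<Union>\<C> \<in> \<A>" if "\<C> \<noteq> {}" "subset.chain \<A> \<C>" for \<C>
  proof -
    have sub: "sub W" "v \<notin> W" if "W \<in> \<C>" for W
      using \<open>subset.chain \<A> \<C>\<close> that by (auto simp: \<A>_def subset.chain_def)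
    have "x \<oplus>\<^bsub>M\<^esub> y \<in> \<Union>\<C>" if "x \<in> X" "X \<in> \<C>" "y \<in> Y" "Y \<in> \<C>" for x y X Y
    proof -
      from \<open>subset.chain \<A> \<C>\<close> that have "X \<subseteq> Y \<or> Y \<subseteq> X"
        by (auto simp: subset.chain_def)
      then show ?thesis using that sub(1) unfolding sub_def by blast
    qed
    moreover have "\<Union>\<C> \<subseteq> carrier M" "\<zero>\<^bsub>M\<^esub> \<in> \<Union>\<C>" "v \<notin> \<Union>\<C>"
      using sub \<open>\<C> \<noteq> {}\<close> unfolding sub_def by blast+
    moreover have "\<forall>a\<in>carrier R. \<forall>x\<in>\<Union>\<C>. a \<odot>\<^bsub>M\<^esub> x \<in> \<Union>\<C>"
      using sub unfolding sub_def by blast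
    ultimately show ?thesis by (auto simp: \<A>_def sub_def)
  qed
  ultimately obtain W where "W \<in> \<A>" and max: "\<And>X. \<lbrakk>X \<in> \<A>; W \<subseteq> X\<rbrakk> \<Longrightarrow> X = W"
    using subset_Zorn_nonempty[of \<A>] by blast
  then have W: "W \<subseteq> carrier M" "\<zero>\<^bsub>M\<^esub> \<in> W" "\<And>x y. \<lbrakk>x \<in> W; y \<in> W\<rbrakk> \<Longrightarrow> x \<oplus>\<^bsub>M\<^esub> y \<in> W"
      "\<And>a x. \<lbrakk>a \<in> carrier R; x \<in> W\<rbrakk> \<Longrightarrow> a \<odot>\<^bsub>M\<^esub> x \<in> W" and "v \<notin> W"
    unfolding \<A>_def sub_def by auto
  have Wminus: "\<ominus>\<^bsub>M\<^esub> x \<in> W" if "x \<in> W" for x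
    using W(4)[OF _ that, of "\<ominus>\<^bsub>R\<^esub> \<one>\<^bsub>R\<^esub>"] W(1) that by (simp add: smult_minus_one subset_iff)
  have inv: "\<exists>b\<in>carrier R. b \<otimes>\<^bsub>R\<^esub> a = \<one>\<^bsub>R\<^esub>" if "a \<in> carrier R" "a \<noteq> \<zero>\<^bsub>R\<^esub>" for a
    using D.Units_nonzero that unfolding Units_def by blast
  \<comment> \<open>A difference in coefficients could be inverted in the division ring, which would
    put \<open>v\<close> into \<open>W\<close>.\<close>
  have unique: "c = d" if h: "w \<in> W" "w' \<in> W" "c \<in> carrier R" "d \<in> carrier R"
    "w \<oplus>\<^bsub>M\<^esub> c \<odot>\<^bsub>M\<^esub> v = w' \<oplus>\<^bsub>M\<^esub> d \<odot>\<^bsub>M\<^esub> v" for w w' c d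
  proof (rule ccontr)
    assume "c \<noteq> d"
    moreover have "c = (c \<ominus>\<^bsub>R\<^esub> d) \<oplus>\<^bsub>R\<^esub> d"
      using h(3,4) by (simp add: a_minus_def R.a_assoc R.l_neg)
    ultimately have "c \<ominus>\<^bsub>R\<^esub> d \<noteq> \<zero>\<^bsub>R\<^esub>"
      using h(4) by auto
    then obtain b where b: "b \<in> carrier R" "b \<otimes>\<^bsub>R\<^esub> (c \<ominus>\<^bsub>R\<^esub> d) = \<one>\<^bsub>R\<^esub>"
      using inv[of "c \<ominus>\<^bsub>R\<^esub> d"] h(3,4) by auto
    have car: "w \<in> carrier M" "w' \<in> carrier M" "c \<odot>\<^bsub>M\<^esub> v \<in> carrier M" "d \<odot>\<^bsub>M\<^esub> v \<in> carrier M"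
      using h W(1) v smult_closed by auto
    have "(c \<ominus>\<^bsub>R\<^esub> d) \<odot>\<^bsub>M\<^esub> v = c \<odot>\<^bsub>M\<^esub> v \<ominus>\<^bsub>M\<^esub> d \<odot>\<^bsub>M\<^esub> v"
      using h v by (simp add: a_minus_def smult_l_distr smult_l_minus)
    also have "\<dots> = w' \<ominus>\<^bsub>M\<^esub> w"
    proof -
      have "c \<odot>\<^bsub>M\<^esub> v = \<ominus>\<^bsub>M\<^esub> w \<oplus>\<^bsub>M\<^esub> (w' \<oplus>\<^bsub>M\<^esub> d \<odot>\<^bsub>M\<^esub> v)"
        using h(5) car by (metis M.r_neg1)
      then show ?thesis using car by (simp add: a_minus_def M.a_ac M.r_neg)
    qed
    also have "\<dots> \<in> W" using h W Wminus by (simp add: a_minus_def)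
    finally have "b \<odot>\<^bsub>M\<^esub> ((c \<ominus>\<^bsub>R\<^esub> d) \<odot>\<^bsub>M\<^esub> v) \<in> W" using W b by blast
    then show False
      using b h v \<open>v \<notin> W\<close> by (simp add: smult_assoc[symmetric] smult_one)
  qed
  have decomp: "\<exists>w\<in>W. \<exists>c\<in>carrier R. x = w \<oplus>\<^bsub>M\<^esub> c \<odot>\<^bsub>M\<^esub> v" if x: "x \<in> carrier M" for x
  proof (cases "x \<in> W")
    case True
    then show ?thesis using v x by (intro bexI[of _ x] bexI[of _ "\<zero>\<^bsub>R\<^esub>"]) (auto simp: smult_l_null)
  next
    case False
    \<comment> \<open>The submodule \<open>W + k x\<close> is strictly larger than \<open>W\<close>,
      so by maximality it contains \<open>v\<close>. In \<open>v = w + c x\<close> the coefficient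
      \<open>c\<close> is nonzero because \<open>v\<close> is outside \<open>W\<close>, and the
      equation can be solved for \<open>x\<close>.\<close>
    define X where "X = {w \<oplus>\<^bsub>M\<^esub> c \<odot>\<^bsub>M\<^esub> x | w c. w \<in> W \<and> c \<in> carrier R}"
    have WX: "W \<subseteq> X"
    proof
      fix w assume "w \<in> W"
      then have "w = w \<oplus>\<^bsub>M\<^esub> \<zero>\<^bsub>R\<^esub> \<odot>\<^bsub>M\<^esub> x" using W(1) x by (auto simp: smult_l_null)
      then show "w \<in> X" using \<open>w \<in> W\<close> unfolding X_def by blast
    qed
    have "x = \<zero>\<^bsub>M\<^esub> \<oplus>\<^bsub>M\<^esub> \<one>\<^bsub>R\<^esub> \<odot>\<^bsub>M\<^esub> x" using x by (simp add: smult_one)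
    then have "x \<in> X" using W(2) unfolding X_def by blast
    have "sub X" unfolding sub_def
    proof (intro conjI ballI)
      show "X \<subseteq> carrier M" using W(1) x smult_closed by (auto simp: X_def)
      show "\<zero>\<^bsub>M\<^esub> \<in> X" using WX W(2) by auto
    next
      fix y z assume "y \<in> X" "z \<in> X"
      then obtain w c w' c' where *: "w \<in> W" "c \<in> carrier R" "y = w \<oplus>\<^bsub>M\<^esub> c \<odot>\<^bsub>M\<^esub> x"
        "w' \<in> W" "c' \<in> carrier R" "z = w' \<oplus>\<^bsub>M\<^esub> c' \<odot>\<^bsub>M\<^esub> x" by (auto simp: X_def)
      then have "y \<oplus>\<^bsub>M\<^esub> z = (w \<oplus>\<^bsub>M\<^esub> w') \<oplus>\<^bsub>M\<^esub> (c \<oplus>\<^bsub>R\<^esub> c') \<odot>\<^bsub>M\<^esub> x"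
        using x W(1) by (simp add: smult_l_distr M.a_ac smult_closed subset_iff)
      then show "y \<oplus>\<^bsub>M\<^esub> z \<in> X" using * W(3) unfolding X_def by blast
    next
      fix a y assume a: "a \<in> carrier R" and "y \<in> X"
      then obtain w c where *: "w \<in> W" "c \<in> carrier R" "y = w \<oplus>\<^bsub>M\<^esub> c \<odot>\<^bsub>M\<^esub> x"
        by (auto simp: X_def)
      then have "a \<odot>\<^bsub>M\<^esub> y = a \<odot>\<^bsub>M\<^esub> w \<oplus>\<^bsub>M\<^esub> (a \<otimes>\<^bsub>R\<^esub> c) \<odot>\<^bsub>M\<^esub> x"
        using a x W(1) by (simp add: smult_r_distr smult_closed smult_assoc subset_iff)
      then show "a \<odot>\<^bsub>M\<^esub> y \<in> X" using * a W(4) unfolding X_def by blast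
    qed
    then have "v \<in> X"
      using max[of X] WX \<open>x \<in> X\<close> False by (auto simp: \<A>_def)
    then obtain w c where wc: "w \<in> W" "c \<in> carrier R" "v = w \<oplus>\<^bsub>M\<^esub> c \<odot>\<^bsub>M\<^esub> x"
      by (auto simp: X_def)
    have w: "w \<in> carrier M" using wc W(1) by auto
    have "c \<noteq> \<zero>\<^bsub>R\<^esub>"
      using wc \<open>v \<notin> W\<close> x w by (auto simp: smult_l_null)
    then obtain b where b: "b \<in> carrier R" "b \<otimes>\<^bsub>R\<^esub> c = \<one>\<^bsub>R\<^esub>" using inv wc(2) by auto
    have "c \<odot>\<^bsub>M\<^esub> x = \<ominus>\<^bsub>M\<^esub> w \<oplus>\<^bsub>M\<^esub> v"
      using wc x w by (simp add: M.r_neg1 smult_closed)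
    then have "b \<odot>\<^bsub>M\<^esub> (c \<odot>\<^bsub>M\<^esub> x) = b \<odot>\<^bsub>M\<^esub> (\<ominus>\<^bsub>M\<^esub> w) \<oplus>\<^bsub>M\<^esub> b \<odot>\<^bsub>M\<^esub> v"
      using b w v by (simp add: smult_r_distr)
    then have "x = b \<odot>\<^bsub>M\<^esub> (\<ominus>\<^bsub>M\<^esub> w) \<oplus>\<^bsub>M\<^esub> b \<odot>\<^bsub>M\<^esub> v"
      using b wc x by (simp add: smult_assoc[symmetric] smult_one)
    then show ?thesis using W(4) Wminus wc b by blast
  qed
  \<comment> \<open>The functional reads off the coefficient of \<open>v\<close> in the
    decomposition of \<open>carrier M\<close> as \<open>W\<close> plus the line of \<open>v\<close>;
    it vanishes on \<open>W\<close>.\<close>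
  define \<theta> where "\<theta> x = (THE c. c \<in> carrier R \<and> (\<exists>w\<in>W. x = w \<oplus>\<^bsub>M\<^esub> c \<odot>\<^bsub>M\<^esub> v))" for x
  have \<theta>: "\<theta> (w \<oplus>\<^bsub>M\<^esub> c \<odot>\<^bsub>M\<^esub> v) = c" if "w \<in> W" "c \<in> carrier R" for w c
    unfolding \<theta>_def using that unique by (intro the_equality) blast+
  have "is_linear R M (regular_module R) \<theta>"
  proof (rule is_linearI)
    fix x assume "x \<in> carrier M"
    then show "\<theta> x \<in> carrier (regular_module R)"
      using decomp[of x] \<theta> by auto
  next
    fix x y assume "x \<in> carrier M" "y \<in> carrier M"
    then obtain w c w' c' where *: "w \<in> W" "c \<in> carrier R" "x = w \<oplus>\<^bsub>M\<^esub> c \<odot>\<^bsub>M\<^esub> v"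
      "w' \<in> W" "c' \<in> carrier R" "y = w' \<oplus>\<^bsub>M\<^esub> c' \<odot>\<^bsub>M\<^esub> v" using decomp by metis
    then have "x \<oplus>\<^bsub>M\<^esub> y = (w \<oplus>\<^bsub>M\<^esub> w') \<oplus>\<^bsub>M\<^esub> (c \<oplus>\<^bsub>R\<^esub> c') \<odot>\<^bsub>M\<^esub> v"
      using v W(1) by (simp add: smult_l_distr M.a_ac smult_closed subset_iff)
    then show "\<theta> (x \<oplus>\<^bsub>M\<^esub> y) = \<theta> x \<oplus>\<^bsub>regular_module R\<^esub> \<theta> y"
      using * \<theta> W(3) by simp
  next
    fix a x assume a: "a \<in> carrier R" and "x \<in> carrier M"
    then obtain w c where *: "w \<in> W" "c \<in> carrier R" "x = w \<oplus>\<^bsub>M\<^esub> c \<odot>\<^bsub>M\<^esub> v"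
      using decomp by metis
    then have "a \<odot>\<^bsub>M\<^esub> x = a \<odot>\<^bsub>M\<^esub> w \<oplus>\<^bsub>M\<^esub> (a \<otimes>\<^bsub>R\<^esub> c) \<odot>\<^bsub>M\<^esub> v"
      using a v W(1) by (simp add: smult_r_distr smult_closed smult_assoc subset_iff)
    then show "\<theta> (a \<odot>\<^bsub>M\<^esub> x) = a \<odot>\<^bsub>regular_module R\<^esub> \<theta> x"
      using * a \<theta> W(4) by simp
  qed
  moreover have "\<theta> v = \<one>\<^bsub>R\<^esub>"
    using \<theta>[OF W(2), of "\<one>\<^bsub>R\<^esub>"] v by (simp add: smult_one)
  ultimately show ?thesis by blast
qed

text \<open>If the points differed, some functional would take the value 1 on their difference. This
  separation is what later makes linear extensions single-valued.\<close>

lemma (in left_module) functional_eqI: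
  assumes "division_ring R" "v \<in> carrier M" "w \<in> carrier M"
    and eq: "\<And>\<theta>. is_linear R M (regular_module R) \<theta> \<Longrightarrow> \<theta> v = \<theta> w"
  shows "v = w"
proof (rule ccontr)
  assume "v \<noteq> w"
  moreover have "v = (v \<ominus>\<^bsub>M\<^esub> w) \<oplus>\<^bsub>M\<^esub> w"
    using assms by (simp add: a_minus_def M.a_assoc M.l_neg)
  ultimately have "v \<ominus>\<^bsub>M\<^esub> w \<noteq> \<zero>\<^bsub>M\<^esub>" using assms by auto
  then obtain \<theta> where \<theta>: "is_linear R M (regular_module R) \<theta>" "\<theta> (v \<ominus>\<^bsub>M\<^esub> w) = \<one>\<^bsub>R\<^esub>"
    using exists_functional assms by (metis M.minus_closed)
  have "\<theta> v = \<theta> (v \<ominus>\<^bsub>M\<^esub> w) \<oplus>\<^bsub>R\<^esub> \<theta> w"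
    using linear_add[OF \<theta>(1), of "v \<ominus>\<^bsub>M\<^esub> w" w] assms \<open>v = _\<close> by simp
  moreover have "\<theta> w \<in> carrier R" using linear_closed[OF \<theta>(1)] assms by simp
  ultimately have "\<one>\<^bsub>R\<^esub> = \<zero>\<^bsub>R\<^esub>"
    using eq[OF \<theta>(1)] \<theta>(2) R.add.r_cancel_one'[of "\<theta> w" "\<one>\<^bsub>R\<^esub>"] R.a_comm by simp
  then show False using assms(1) division_ring.one_not_zero by blast
qed

section \<open>Smallness\<close>

lemma small_inj:
  assumes "small U B" and "inj_on f A" and "f ` A \<subseteq> B"
  shows "small U A"
  using assms card_of_ordLeq ordLeq_ordLess_trans unfolding small_def by metis

lemma small_subset: "\<lbrakk>small U B; A \<subseteq> B\<rbrakk> \<Longrightarrow> small U A"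
  by (rule small_inj[of U B "\<lambda>x. x"]) auto

lemma small_embedding:
  fixes U :: "'u itself" and A :: "'b set"
  assumes "small U A"
  shows "\<exists>f :: 'b \<Rightarrow> 'u. inj_on f A"
  using assms card_of_ordLeq[of A "UNIV :: 'u set"] ordLess_imp_ordLeq
  unfolding small_def by blast

lemma small_image:
  assumes "small U A" shows "small U (f ` A)"
  using assms card_of_image ordLeq_ordLess_trans unfolding small_def by blast

text \<open>The closure in \<open>universe\<close> concerns subsets of the type \<open>'u\<close>
  only; a small set of any type is first embedded there.\<close>

lemma small_Pow:
  fixes U :: "'u itself" and A :: "'b set"
  assumes "universe U" "small U A"
  shows "small U (Pow A)"
proof -
  obtain f :: "'b \<Rightarrow> 'u" where f: "inj_on f A" using small_embedding assms by blast
  have "small U (Pow (f ` A))"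
    using assms small_image unfolding universe_def by blast
  moreover have "inj_on (image f) (Pow A)" using f by (rule inj_on_image_Pow)
  ultimately show ?thesis by (rule small_inj) auto
qed

text \<open>Power sets suffice: a pair is coded as the two-element subset
  \<open>{Inl a, Inr b}\<close> of the disjoint sum, and a sum of two small sets is small because
  \<open>'u\<close> is infinite.\<close>

lemma small_Times:
  fixes U :: "'u itself" and A :: "'b set" and B :: "'c set"
  assumes "universe U" "small U A" "small U B"
  shows "small U (A \<times> B)"
proof (rule small_inj)
  have "small U (A <+> B)"
    using assms card_of_Plus_ordLess_infinite[of "UNIV :: 'u set" A B]
    by (simp add: universe_def small_def)
  then show "small U (Pow (A <+> B))" by (rule small_Pow[OF assms(1)])
  show "inj_on (\<lambda>(a, b). {Inl a, Inr b}) (A \<times> B)"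
    by (auto simp: inj_on_def doubleton_eq_iff)
qed auto

text \<open>An extensional function is determined by its graph, a subset of the product.\<close>

lemma small_PiE:
  fixes U :: "'u itself" and A :: "'b set" and B :: "'c set"
  assumes "universe U" "small U A" "small U B"
  shows "small U (A \<rightarrow>\<^sub>E B)"
proof (rule small_inj)
  show "small U (Pow (A \<times> B))" using assms by (intro small_Pow small_Times)
  show "inj_on (\<lambda>f. (\<lambda>a. (a, f a)) ` A) (A \<rightarrow>\<^sub>E B)"
    by (rule inj_onI, rule ext) (auto simp: image_def set_eq_iff PiE_iff extensional_def, metis)
qed auto

section \<open>Transport of structure\<close>

text \<open>The copy of \<open>V\<close> along an injection \<open>e\<close>, with operations
  computed after decoding by \<open>d\<close>. It brings modules on function types, or on the type
  of scalars, into the universe.\<close>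

definition transported :: "('v \<Rightarrow> 'u) \<Rightarrow> ('k, 'v) module \<Rightarrow> ('k, 'u) module" where
  "transported e V = (let d = inv_into (carrier V) e in
     \<lparr>carrier = e ` carrier V, monoid.mult = (\<lambda>x y. x), one = e \<zero>\<^bsub>V\<^esub>,
      zero = e \<zero>\<^bsub>V\<^esub>, add = (\<lambda>x y. e (d x \<oplus>\<^bsub>V\<^esub> d y)), smult = (\<lambda>a x. e (a \<odot>\<^bsub>V\<^esub> d x))\<rparr>)"

lemma
  assumes "left_module R V" and e: "inj_on e (carrier V)"
  shows left_module_transported: "left_module R (transported e V)"
    and linear_transported: "is_linear R V (transported e V) e"
    and linear_inv_transported: "is_linear R (transported e V) V (inv_into (carrier V) e)"
proof -
  interpret left_module R V by fact
  note [simp] = transported_def Let_def inv_into_f_f[OF e] smult_closed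
  show "left_module R (transported e V)"
    by (rule left_moduleI)
      (auto simp: smult_l_distr smult_r_distr smult_assoc smult_one M.a_ac smult_minus_one M.l_neg M.r_neg R.ring_axioms)
  show "is_linear R V (transported e V) e" "is_linear R (transported e V) V (inv_into (carrier V) e)"
    by (auto intro!: is_linearI)
qed

lemma carrier_transported [simp]: "carrier (transported e V) = e ` carrier V"
  by (simp add: transported_def Let_def)

section \<open>The category of modules\<close>

definition app :: "('k, 'u) modarrow \<Rightarrow> 'u \<Rightarrow> 'u" where
  "app f = fst (snd f)"

text \<open>Arrows carry extensional functions, so restriction is needed for maps agreeing on the
  carrier to give the same arrow.\<close>

definition mk :: "('k, 'u) module \<Rightarrow> ('u \<Rightarrow> 'u) \<Rightarrow> ('k, 'u) module \<Rightarrow> ('k, 'u) modarrow" where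
  "mk x h y = (x, restrict h (carrier x), y)"

locale module_category = ring k for k :: "('k, 'x) ring_scheme" and U :: "'u itself"
begin

abbreviation C :: "(('k, 'u) module, ('k, 'u) modarrow) precat" where
  "C \<equiv> Mod k U"

abbreviation comp :: "('k, 'u) modarrow \<Rightarrow> ('k, 'u) modarrow \<Rightarrow> ('k, 'u) modarrow"  (infixr \<open>\<Zsemi>\<close> 65) where
  "g \<Zsemi> f \<equiv> g \<cdot>\<^bsub>C\<^esub> f"

lemma Obj_iff: "x \<in> Obj C \<longleftrightarrow> left_module k x \<and> small U (carrier x)"
  by (simp add: Mod_def)

lemma Obj_left_module: "x \<in> Obj C \<Longrightarrow> left_module k x"
  by (simp add: Obj_iff)

text \<open>\<open>linear_maps\<close> relates modules on one and the same type and includes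
  extensionality. \<open>is_linear\<close> separates off the algebraic part, so that it applies also
  to \<open>regular_module\<close> and to modules of functions.\<close>

lemma linear_maps_iff:
  "f \<in> linear_maps k x y \<longleftrightarrow> f \<in> extensional (carrier x) \<and> is_linear k x y f"
  by (auto simp: linear_maps_def is_linear_def PiE_iff)

lemma arrows_iff: "f \<in> arrows C x y \<longleftrightarrow> x \<in> Obj C \<and> y \<in> Obj C \<and>
   (\<exists>h. f = (x, h, y) \<and> h \<in> extensional (carrier x) \<and> is_linear k x y h)"
  by (auto simp: arrows_def Mod_def linear_maps_iff)

lemma arrow_Obj:
  assumes "f \<in> arrows C x y"
  shows arrow_dom: "x \<in> Obj C" and arrow_cod: "y \<in> Obj C"
  using assms by (auto simp: arrows_iff)

lemma app_linear: "f \<in> arrows C x y \<Longrightarrow> is_linear k x y (app f)"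
  by (auto simp: arrows_iff app_def)

lemma
  assumes "f \<in> arrows C x y"
  shows app_closed: "a \<in> carrier x \<Longrightarrow> app f a \<in> carrier y"
    and app_add: "\<lbrakk>a \<in> carrier x; b \<in> carrier x\<rbrakk> \<Longrightarrow> app f (a \<oplus>\<^bsub>x\<^esub> b) = app f a \<oplus>\<^bsub>y\<^esub> app f b"
    and app_smult: "\<lbrakk>c \<in> carrier k; a \<in> carrier x\<rbrakk> \<Longrightarrow> app f (c \<odot>\<^bsub>x\<^esub> a) = c \<odot>\<^bsub>y\<^esub> app f a"
  using app_linear[OF assms] by (auto simp: linear_closed linear_add linear_smult)

lemma app_zero: "f \<in> arrows C x y \<Longrightarrow> app f \<zero>\<^bsub>x\<^esub> = \<zero>\<^bsub>y\<^esub>"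
  by (metis app_linear is_linear_zero Obj_left_module arrow_dom arrow_cod)

lemma arrow_eqI:
  assumes "f \<in> arrows C x y" "g \<in> arrows C x y" "\<And>a. a \<in> carrier x \<Longrightarrow> app f a = app g a"
  shows "f = g"
  using assms by (auto simp: arrows_iff app_def intro: extensionalityI)

lemma mk_arrow:
  assumes "x \<in> Obj C" "y \<in> Obj C" "is_linear k x y h"
  shows "mk x h y \<in> arrows C x y"
proof -
  have "is_linear k x y (restrict h (carrier x))"
    using assms is_linear_cong[of x "restrict h (carrier x)" h k y] by (auto simp: Obj_iff)
  then show ?thesis using assms by (auto simp: arrows_iff mk_def)
qed

lemma app_mk [simp]: "a \<in> carrier x \<Longrightarrow> app (mk x h y) a = h a"
  by (simp add: app_def mk_def)

lemma app_Idt [simp]: "a \<in> carrier x \<Longrightarrow> app (Idt C x) a = a"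
  by (simp add: app_def Mod_def)

lemma app_comp:
  "\<lbrakk>f \<in> arrows C x y; a \<in> carrier x\<rbrakk> \<Longrightarrow> app (g \<Zsemi> f) a = app g (app f a)"
  unfolding arrows_iff by (cases g) (auto simp: app_def Mod_def compose_def)

lemma app_Pls:
  "\<lbrakk>f \<in> arrows C x y; g \<in> arrows C x y; a \<in> carrier x\<rbrakk> \<Longrightarrow> app (Pls C f g) a = app f a \<oplus>\<^bsub>y\<^esub> app g a"
  by (auto simp: app_def arrows_iff) (simp add: Mod_def)

lemma app_Zro: "a \<in> carrier x \<Longrightarrow> app (Zro C x y) a = \<zero>\<^bsub>y\<^esub>"
  by (simp add: app_def Mod_def)

lemma Idt_in: "x \<in> Obj C \<Longrightarrow> Idt C x \<in> arrows C x x"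
  using mk_arrow[of x x "\<lambda>a. a"] by (simp add: mk_def Mod_def is_linear_def)

lemma Cmp_in: "\<lbrakk>f \<in> arrows C x y; g \<in> arrows C y z\<rbrakk> \<Longrightarrow> g \<Zsemi> f \<in> arrows C x z"
proof -
  assume *: "f \<in> arrows C x y" "g \<in> arrows C y z"
  then have "mk x (\<lambda>a. app g (app f a)) z \<in> arrows C x z"
    by (intro mk_arrow is_linear_comp[OF app_linear app_linear]) (auto dest: arrow_Obj)
  moreover have "mk x (\<lambda>a. app g (app f a)) z = g \<Zsemi> f"
    using * unfolding arrows_iff by (auto simp: mk_def app_def Mod_def compose_def fun_eq_iff)
  ultimately show ?thesis by simp
qed

lemma is_linear_sum:
  assumes "left_module k x" "left_module k y" "is_linear k x y f" "is_linear k x y g"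
  shows "is_linear k x y (\<lambda>a. f a \<oplus>\<^bsub>y\<^esub> g a)"
proof -
  interpret y: left_module k y by fact
  show ?thesis
    by (rule is_linearI) (auto simp: linear_closed[OF assms(3)] linear_add[OF assms(3)] linear_smult[OF assms(3)]
      linear_closed[OF assms(4)] linear_add[OF assms(4)] linear_smult[OF assms(4)] y.M.a_ac y.smult_r_distr)
qed

lemma Pls_in: "\<lbrakk>f \<in> arrows C x y; g \<in> arrows C x y\<rbrakk> \<Longrightarrow> Pls C f g \<in> arrows C x y"
proof -
  assume *: "f \<in> arrows C x y" "g \<in> arrows C x y"
  then interpret y: left_module k y by (auto simp: arrows_iff Obj_iff)
  from * have "mk x (\<lambda>a. app f a \<oplus>\<^bsub>y\<^esub> app g a) y \<in> arrows C x y"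
    by (intro mk_arrow is_linear_sum app_linear Obj_left_module) (auto dest: arrow_Obj)
  moreover have "mk x (\<lambda>a. app f a \<oplus>\<^bsub>y\<^esub> app g a) y = Pls C f g"
    using * unfolding arrows_iff by (auto simp: mk_def app_def) (simp add: Mod_def)
  ultimately show ?thesis by simp
qed

lemma Zro_in: "\<lbrakk>x \<in> Obj C; y \<in> Obj C\<rbrakk> \<Longrightarrow> Zro C x y \<in> arrows C x y"
proof -
  assume *: "x \<in> Obj C" "y \<in> Obj C"
  then interpret y: left_module k y by (auto simp: arrows_iff Obj_iff)
  have "mk x (\<lambda>a. \<zero>\<^bsub>y\<^esub>) y \<in> arrows C x y"
    using * by (intro mk_arrow is_linearI) (auto simp: y.smult_r_null)
  then show ?thesis by (simp add: mk_def Mod_def)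
qed

lemma comm_group_arrows:
  assumes xy: "x \<in> Obj C" "y \<in> Obj C"
  shows "comm_group (arrow_group C x y)"
proof -
  interpret y: left_module k y using xy by (simp add: Obj_iff)
  note simps = app_Pls[of _ x y] app_Zro app_closed[of _ x y] Pls_in Zro_in xy
  show ?thesis
  proof (rule comm_groupI, simp_all add: arrow_group_def simps)
    show "Pls C (Pls C f g) h = Pls C f (Pls C g h)"
      if "f \<in> arrows C x y" "g \<in> arrows C x y" "h \<in> arrows C x y" for f g h
      using that by (intro arrow_eqI[of _ x y]) (auto simp: simps y.M.a_assoc)
    show "Pls C f g = Pls C g f"
      if "f \<in> arrows C x y" "g \<in> arrows C x y" for f g
      using that by (intro arrow_eqI[of _ x y]) (auto simp: simps y.M.a_comm)
    show "Pls C (Zro C x y) f = f" if "f \<in> arrows C x y" for f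
      using that by (intro arrow_eqI[of _ x y]) (auto simp: simps)
    show "\<exists>g\<in>arrows C x y. Pls C g f = Zro C x y" if f: "f \<in> arrows C x y" for f
    proof
      show g: "mk x (\<lambda>a. \<ominus>\<^bsub>y\<^esub> app f a) y \<in> arrows C x y"
        using f xy
        by (intro mk_arrow is_linearI)
          (auto simp: app_closed[OF f] app_add[OF f] app_smult[OF f] y.M.minus_add
            y.smult_minus_one[symmetric] y.smult_assoc[symmetric] y.smult_closed y.smult_r_distr l_minus r_minus)
      show "Pls C (mk x (\<lambda>a. \<ominus>\<^bsub>y\<^esub> app f a) y) f = Zro C x y"
        using f g by (intro arrow_eqI[of _ x y]) (auto simp: simps y.M.l_neg)
    qed
  qed
qed

lemma preadditive: "preadditive_category C"
proof (rule preadditive_category.intro)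
  show "Dom C f \<in> Obj C" "Cod C f \<in> Obj C" if "f \<in> Arr C" for f
    using that arrow_Obj[of f "Dom C f" "Cod C f"] by (auto simp: arrows_def)
  show "Idt C x \<in> arrows C x x" if "x \<in> Obj C" for x using that by (rule Idt_in)
  show "g \<Zsemi> f \<in> arrows C x z" if "f \<in> arrows C x y" "g \<in> arrows C y z" for f g x y z
    using that by (rule Cmp_in)
  show "f \<Zsemi> Idt C x = f" "Idt C y \<Zsemi> f = f" if "f \<in> arrows C x y" for f x y
    using that arrow_Obj[OF that]
    by (auto intro!: arrow_eqI[of _ x y] intro: Cmp_in Idt_in simp: app_comp[OF Idt_in] app_comp[OF that] app_closed)
  show "(h \<Zsemi> g) \<Zsemi> f = h \<Zsemi> (g \<Zsemi> f)"
    if "f \<in> arrows C w x" "g \<in> arrows C x y" "h \<in> arrows C y z" for f g h w x y z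
    using that by (intro arrow_eqI[of _ w z] Cmp_in)
      (auto intro: Cmp_in simp: app_comp[OF that(1)] app_comp[OF that(2)] app_comp[OF Cmp_in[OF that(1,2)]] app_closed)
  show "g \<Zsemi> Pls C f f' = Pls C (g \<Zsemi> f) (g \<Zsemi> f')"
    if "f \<in> arrows C x y" "f' \<in> arrows C x y" "g \<in> arrows C y z" for f f' g x y z
    using that by (intro arrow_eqI[of _ x z] Cmp_in Pls_in)
      (auto intro: Cmp_in simp: app_comp[of _ x y] app_closed Pls_in app_Pls[of _ x y] app_Pls[of _ x z] Cmp_in app_add)
  show "Pls C g g' \<Zsemi> f = Pls C (g \<Zsemi> f) (g' \<Zsemi> f)"
    if "f \<in> arrows C x y" "g \<in> arrows C y z" "g' \<in> arrows C y z" for f g g' x y z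
    using that by (intro arrow_eqI[of _ x z] Cmp_in Pls_in)
      (auto intro: Cmp_in simp: app_comp[of _ x y] app_closed Pls_in app_Pls[of _ y z] app_Pls[of _ x z] Cmp_in)
  show "comm_group (arrow_group C x y)" if "x \<in> Obj C" "y \<in> Obj C" for x y
    using that by (rule comm_group_arrows)
qed

lemma iso_arrow: "is_iso C x y f \<Longrightarrow> f \<in> arrows C x y"
  by (simp add: is_iso_def)

lemma iso_of_inverse:
  assumes "f \<in> arrows C x y" "g \<in> arrows C y x"
    and "\<And>a. a \<in> carrier x \<Longrightarrow> app g (app f a) = a" "\<And>b. b \<in> carrier y \<Longrightarrow> app f (app g b) = b"
  shows "is_iso C x y f"
proof -
  have "g \<Zsemi> f = Idt C x"
    using assms arrow_Obj[OF assms(1)] by (intro arrow_eqI[of _ x x]) (auto intro: Cmp_in Idt_in simp: app_comp)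
  moreover have "f \<Zsemi> g = Idt C y"
    using assms arrow_Obj[OF assms(1)] by (intro arrow_eqI[of _ y y]) (auto intro: Cmp_in Idt_in simp: app_comp)
  ultimately show ?thesis using assms by (auto simp: is_iso_def)
qed

lemma iso_inverse:
  assumes "is_iso C x y f"
  obtains g where "f \<in> arrows C x y" "g \<in> arrows C y x"
    "\<And>a. a \<in> carrier x \<Longrightarrow> app g (app f a) = a" "\<And>b. b \<in> carrier y \<Longrightarrow> app f (app g b) = b"
proof -
  obtain g where g: "f \<in> arrows C x y" "g \<in> arrows C y x" "g \<Zsemi> f = Idt C x" "f \<Zsemi> g = Idt C y"
    using assms by (auto simp: is_iso_def)
  then show ?thesis
    by (intro that[of g]) (auto simp: app_comp[symmetric] simp del: app_comp)
qed

lemma iso_inj: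
  assumes "is_iso C x y f" "a \<in> carrier x" "b \<in> carrier x" "app f a = app f b"
  shows "a = b"
  using assms by (metis iso_inverse)

end

section \<open>Bilinear maps and universal tensor products\<close>

definition is_bilinear ::
  "('k, 'x) ring_scheme \<Rightarrow> ('k, 'v) module \<Rightarrow> ('k, 'w) module \<Rightarrow> ('k, 'z) module \<Rightarrow> ('v \<Rightarrow> 'w \<Rightarrow> 'z) \<Rightarrow> bool"
  where "is_bilinear R M N P \<beta> \<longleftrightarrow>
    (\<forall>a \<in> carrier M. is_linear R N P (\<beta> a)) \<and> (\<forall>b \<in> carrier N. is_linear R M P (\<lambda>a. \<beta> a b))"

lemma is_bilinearI:
  assumes "\<And>a b. \<lbrakk>a \<in> carrier M; b \<in> carrier N\<rbrakk> \<Longrightarrow> \<beta> a b \<in> carrier P"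
    and "\<And>a a' b. \<lbrakk>a \<in> carrier M; a' \<in> carrier M; b \<in> carrier N\<rbrakk> \<Longrightarrow> \<beta> (a \<oplus>\<^bsub>M\<^esub> a') b = \<beta> a b \<oplus>\<^bsub>P\<^esub> \<beta> a' b"
    and "\<And>a b b'. \<lbrakk>a \<in> carrier M; b \<in> carrier N; b' \<in> carrier N\<rbrakk> \<Longrightarrow> \<beta> a (b \<oplus>\<^bsub>N\<^esub> b') = \<beta> a b \<oplus>\<^bsub>P\<^esub> \<beta> a b'"
    and "\<And>c a b. \<lbrakk>c \<in> carrier R; a \<in> carrier M; b \<in> carrier N\<rbrakk> \<Longrightarrow> \<beta> (c \<odot>\<^bsub>M\<^esub> a) b = c \<odot>\<^bsub>P\<^esub> \<beta> a b"
    and "\<And>c a b. \<lbrakk>c \<in> carrier R; a \<in> carrier M; b \<in> carrier N\<rbrakk> \<Longrightarrow> \<beta> a (c \<odot>\<^bsub>N\<^esub> b) = c \<odot>\<^bsub>P\<^esub> \<beta> a b"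
  shows "is_bilinear R M N P \<beta>"
  using assms by (auto simp: is_bilinear_def intro!: is_linearI)

lemma
  assumes "is_bilinear R M N P \<beta>"
  shows bilinear_closed: "\<lbrakk>a \<in> carrier M; b \<in> carrier N\<rbrakk> \<Longrightarrow> \<beta> a b \<in> carrier P"
    and bilinear_add_left: "\<lbrakk>a \<in> carrier M; a' \<in> carrier M; b \<in> carrier N\<rbrakk> \<Longrightarrow> \<beta> (a \<oplus>\<^bsub>M\<^esub> a') b = \<beta> a b \<oplus>\<^bsub>P\<^esub> \<beta> a' b"
    and bilinear_add_right: "\<lbrakk>a \<in> carrier M; b \<in> carrier N; b' \<in> carrier N\<rbrakk> \<Longrightarrow> \<beta> a (b \<oplus>\<^bsub>N\<^esub> b') = \<beta> a b \<oplus>\<^bsub>P\<^esub> \<beta> a b'"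
    and bilinear_smult_left: "\<lbrakk>c \<in> carrier R; a \<in> carrier M; b \<in> carrier N\<rbrakk> \<Longrightarrow> \<beta> (c \<odot>\<^bsub>M\<^esub> a) b = c \<odot>\<^bsub>P\<^esub> \<beta> a b"
    and bilinear_smult_right: "\<lbrakk>c \<in> carrier R; a \<in> carrier M; b \<in> carrier N\<rbrakk> \<Longrightarrow> \<beta> a (c \<odot>\<^bsub>N\<^esub> b) = c \<odot>\<^bsub>P\<^esub> \<beta> a b"
  using assms by (auto simp: is_bilinear_def is_linear_def)

text \<open>The interface between the two halves of the theorem: \<open>p x y\<close> is a universal
  bilinear map, with targets ranging over the category, and \<open>S\<close> is free on
  \<open>u\<close>. Every closed structure yields such a system, and over a field one is constructed
  directly.\<close>

locale tensor_system = module_category k U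
  for k :: "('k, 'x) ring_scheme" and U :: "'u itself" +
  fixes T :: "('k, 'u) module \<Rightarrow> ('k, 'u) module \<Rightarrow> ('k, 'u) module"
    and p :: "('k, 'u) module \<Rightarrow> ('k, 'u) module \<Rightarrow> 'u \<Rightarrow> 'u \<Rightarrow> 'u"
    and S :: "('k, 'u) module" and u :: 'u
  assumes T_Obj: "\<lbrakk>x \<in> Obj C; y \<in> Obj C\<rbrakk> \<Longrightarrow> T x y \<in> Obj C"
    and S_Obj: "S \<in> Obj C"
    and u_closed: "u \<in> carrier S"
    and p_bilinear: "\<lbrakk>x \<in> Obj C; y \<in> Obj C\<rbrakk> \<Longrightarrow> is_bilinear k x y (T x y) (p x y)"
    and p_ext: "\<lbrakk>x \<in> Obj C; y \<in> Obj C; f \<in> arrows C (T x y) z; g \<in> arrows C (T x y) z;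
       \<And>a b. \<lbrakk>a \<in> carrier x; b \<in> carrier y\<rbrakk> \<Longrightarrow> app f (p x y a b) = app g (p x y a b)\<rbrakk> \<Longrightarrow> f = g"
    and p_lift: "\<lbrakk>x \<in> Obj C; y \<in> Obj C; z \<in> Obj C; is_bilinear k x y z \<beta>\<rbrakk> \<Longrightarrow>
       \<exists>f \<in> arrows C (T x y) z. \<forall>a \<in> carrier x. \<forall>b \<in> carrier y. app f (p x y a b) = \<beta> a b"
    and unit_ext: "\<lbrakk>f \<in> arrows C S z; g \<in> arrows C S z; app f u = app g u\<rbrakk> \<Longrightarrow> f = g"
    and unit_lift: "\<lbrakk>z \<in> Obj C; c \<in> carrier z\<rbrakk> \<Longrightarrow> \<exists>f \<in> arrows C S z. app f u = c"

section \<open>The unit of a monoidal structure is a line\<close>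

locale monoidal_modules = module_category k U + division_ring k +
  additive_closed_symmetric_monoidal "Mod k U" M
  for k :: "('k, 'x) ring_scheme" and U :: "'u itself" and M :: "(('k, 'u) module, ('k, 'u) modarrow) monstr" +
  assumes k_small: "small U (carrier k)"
begin

abbreviation T :: "('k, 'u) module \<Rightarrow> ('k, 'u) module \<Rightarrow> ('k, 'u) module" where
  "T x y \<equiv> x \<otimes>o\<^bsub>M\<^esub> y"

abbreviation ten :: "('k, 'u) modarrow \<Rightarrow> ('k, 'u) modarrow \<Rightarrow> ('k, 'u) modarrow" (infixr \<open>\<boxtimes>\<close> 70) where
  "f \<boxtimes> g \<equiv> f \<otimes>a\<^bsub>M\<^esub> g"

abbreviation S :: "('k, 'u) module" where "S \<equiv> unit M"

lemma
  assumes "x \<in> Obj C"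
  shows lun_arrow: "lun M x \<in> arrows C (T S x) x" and run_arrow: "run M x \<in> arrows C (T x S) x"
  using lun_iso[OF assms] run_iso[OF assms] by (auto simp: is_iso_def)

lemma
  assumes "x \<in> Obj C" "y \<in> Obj C"
  shows swp_arrow: "swp M x y \<in> arrows C (T x y) (T y x)"
    and ass_arrow: "z \<in> Obj C \<Longrightarrow> ass M x y z \<in> arrows C (T (T x y) z) (T x (T y z))"
  using swp_iso[OF assms] ass_iso[OF assms] by (auto simp: is_iso_def)

text \<open>Both factorisations come from the interchange law. That they agree is the Eckmann-Hilton
  step: \<open>f\<close> on the left factor commutes with \<open>g\<close> on the right one.\<close>

lemma tenA_split:
  assumes "f \<in> arrows C x x'" "g \<in> arrows C y y'"
  shows "f \<boxtimes> g = (f \<boxtimes> Idt C y') \<Zsemi> (Idt C x \<boxtimes> g)"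
    and "f \<boxtimes> g = (Idt C x' \<boxtimes> g) \<Zsemi> (f \<boxtimes> Idt C y)"
  using assms tenA_Cmp[of "Idt C x" x x f x' g y y' "Idt C y'" y'] tenA_Cmp[of f x x' "Idt C x'" x' "Idt C y" y y g y']
  by (auto simp: Idt_in arrow_Obj Cmp_Idt Idt_Cmp)

text \<open>On a zero module the identity equals its own double. By additivity the same holds for
  the identity of \<open>S \<otimes> K\<close>, which is then zero although it is isomorphic to
  \<open>K\<close>. Smallness of \<open>k\<close> supplies a nonzero \<open>K\<close>, namely a copy
  of \<open>k\<close>.\<close>

lemma unit_nontrivial: "\<exists>v\<in>carrier S. v \<noteq> \<zero>\<^bsub>S\<^esub>"
proof (rule ccontr)
  assume "\<not> ?thesis"
  then have S0: "\<And>v. v \<in> carrier S \<Longrightarrow> v = \<zero>\<^bsub>S\<^esub>" by auto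
  obtain j :: "'k \<Rightarrow> 'u" where j: "inj_on j (carrier k)"
    using small_embedding[OF k_small] by blast
  define K where "K = transported j (regular_module k)"
  have K: "K \<in> Obj C"
    using left_module_transported[OF left_module_regular] j small_image[OF k_small] by (auto simp: Obj_iff K_def)
  interpret S: left_module k S using unit_Obj by (simp add: Obj_iff)
  interpret TK: left_module k "T S K" using tenO_Obj[OF unit_Obj K] by (simp add: Obj_iff)
  have I: "Idt C S \<in> arrows C S S" by (rule Idt_in[OF unit_Obj])
  have "Pls C (Idt C S) (Idt C S) = Idt C S"
    using S0 app_closed Pls_in I by (intro arrow_eqI[of _ S S]) metis+
  moreover have "Pls C (Idt C S) (Idt C S) \<boxtimes> Idt C K = Pls C (Idt C S \<boxtimes> Idt C K) (Idt C S \<boxtimes> Idt C K)"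
    using additive_left[OF K] unit_Obj I by (auto simp: is_additive_def tensor_right_def)
  ultimately have eq: "Idt C (T S K) = Pls C (Idt C (T S K)) (Idt C (T S K))"
    by (simp add: tenA_Idt unit_Obj K)
  have T0: "t = \<zero>\<^bsub>T S K\<^esub>" if t: "t \<in> carrier (T S K)" for t
  proof -
    have "t = t \<oplus>\<^bsub>T S K\<^esub> t"
      using arg_cong[OF eq, of "\<lambda>f. app f t"] t app_Pls[OF Idt_in Idt_in t] tenO_Obj[OF unit_Obj K] by simp
    then show ?thesis using t TK.M.add.r_cancel_one' by blast
  qed
  have one: "j \<one>\<^bsub>k\<^esub> \<in> carrier K" "j \<zero>\<^bsub>k\<^esub> \<in> carrier K" by (auto simp: K_def)
  obtain g where "g \<in> arrows C K (T S K)"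
    "\<And>b. b \<in> carrier K \<Longrightarrow> app (lun M K) (app g b) = b"
    using iso_inverse[OF lun_iso[OF K]] by metis
  then have "j \<one>\<^bsub>k\<^esub> = j \<zero>\<^bsub>k\<^esub>" using T0 one app_closed by metis
  then show False using j one_not_zero by (auto simp: inj_on_def)
qed

text \<open>The commuting actions \<open>f \<boxtimes> 1\<close> and \<open>1 \<boxtimes> g\<close> of the unit on its tensor square are
  conjugate to \<open>f\<close> and \<open>g\<close>, though a priori by different isomorphisms; since \<open>f\<close> is arbitrary
  this does not matter.\<close>

lemma unit_endomorphisms_commute:
  assumes h: "h \<in> arrows C S S" and g: "g \<in> arrows C S S" and a: "a \<in> carrier S"
  shows "app h (app g a) = app g (app h a)"
proof -
  note SO = unit_Obj
  obtain r where r: "r \<in> arrows C S (T S S)" "\<And>a. a \<in> carrier (T S S) \<Longrightarrow> app r (app (run M S) a) = a"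
    "\<And>b. b \<in> carrier S \<Longrightarrow> app (run M S) (app r b) = b"
    using iso_inverse[OF run_iso[OF SO]] by metis
  obtain l where l: "l \<in> arrows C S (T S S)" "\<And>a. a \<in> carrier (T S S) \<Longrightarrow> app l (app (lun M S) a) = a"
    "\<And>b. b \<in> carrier S \<Longrightarrow> app (lun M S) (app l b) = b"
    using iso_inverse[OF lun_iso[OF SO]] by metis
  \<comment> \<open>\<open>f\<close> is \<open>h\<close> conjugated by the automorphism
    \<open>run\<close> after the inverse of \<open>lun\<close>. Its action on the left factor, which
    \<open>run\<close> relates to \<open>f\<close>, thus becomes \<open>h\<close> when read through
    \<open>lun\<close>, the same isomorphism that reads the action of \<open>g\<close>.\<close>
  define f where "f = run M S \<Zsemi> l \<Zsemi> h \<Zsemi> lun M S \<Zsemi> r"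
  have f: "f \<in> arrows C S S"
    unfolding f_def by (intro Cmp_in) (use r l h SO lun_arrow run_arrow in auto)
  have f_app: "app f b = app (run M S) (app l (app h (app (lun M S) (app r b))))" if "b \<in> carrier S" for b
  proof -
    have 1: "lun M S \<Zsemi> r \<in> arrows C S S" using r lun_arrow SO Cmp_in by blast
    have 2: "h \<Zsemi> lun M S \<Zsemi> r \<in> arrows C S S" using 1 h Cmp_in by blast
    have 3: "l \<Zsemi> h \<Zsemi> lun M S \<Zsemi> r \<in> arrows C S (T S S)" using 2 l Cmp_in by blast
    show ?thesis unfolding f_def
      using that by (simp add: app_comp[OF 3] app_comp[OF 2] app_comp[OF 1] app_comp[OF r(1)])
  qed
  have f1: "f \<boxtimes> Idt C S \<in> arrows C (T S S) (T S S)" "Idt C S \<boxtimes> g \<in> arrows C (T S S) (T S S)"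
    using f g SO Idt_in tenA_arrow by auto
  have A: "app (f \<boxtimes> Idt C S) t = app l (app h (app (lun M S) t))" if t: "t \<in> carrier (T S S)" for t
  proof -
    have "app (run M S) (app (f \<boxtimes> Idt C S) t) = app f (app (run M S) t)"
      using arg_cong[OF run_natural[OF f], of "\<lambda>f. app f t"] t
      by (simp add: app_comp[OF f1(1)] app_comp[OF run_arrow[OF SO]])
    then have "app (f \<boxtimes> Idt C S) t = app r (app f (app (run M S) t))"
      using r(2) t app_closed[OF f1(1)] by metis
    also have "\<dots> = app l (app h (app (lun M S) t))"
      using t r f_app app_closed[OF run_arrow[OF SO]] app_closed[OF lun_arrow[OF SO]] h l app_closed by metis
    finally show ?thesis .
  qed
  have B: "app (Idt C S \<boxtimes> g) t = app l (app g (app (lun M S) t))" if t: "t \<in> carrier (T S S)" for t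
  proof -
    have "app (lun M S) (app (Idt C S \<boxtimes> g) t) = app g (app (lun M S) t)"
      using arg_cong[OF lun_natural[OF g], of "\<lambda>f. app f t"] t
      by (simp add: app_comp[OF f1(2)] app_comp[OF lun_arrow[OF SO]])
    then show ?thesis using l(2) t app_closed[OF f1(2)] by metis
  qed
  define t where "t = app l a"
  have t: "t \<in> carrier (T S S)" "app (lun M S) t = a" using a l app_closed by (auto simp: t_def)
  have "app (f \<boxtimes> Idt C S) (app (Idt C S \<boxtimes> g) t) = app (Idt C S \<boxtimes> g) (app (f \<boxtimes> Idt C S) t)"
    using tenA_split[OF f g] app_comp[OF f1(1) t(1)] app_comp[OF f1(2) t(1)] by metis
  moreover have "app g a \<in> carrier S" "app h a \<in> carrier S" using a g h app_closed by auto
  moreover have "app l (app g a) \<in> carrier (T S S)" "app l (app h a) \<in> carrier (T S S)"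
    using calculation l app_closed by auto
  ultimately have "app l (app h (app g a)) = app l (app g (app h a))"
    using A B t l by simp
  then show ?thesis
    using l(3) a g h app_closed by metis
qed

text \<open>The rank one endomorphisms \<open>x \<mapsto> \<theta> x s\<close> commute, which forces the unit to be a line and the
  scalars to commute.\<close>

lemma unit_line:
  "(\<exists>u \<theta>. u \<in> carrier S \<and> is_linear k S (regular_module k) \<theta> \<and> \<theta> u = \<one>\<^bsub>k\<^esub> \<and>
     (\<forall>s \<in> carrier S. \<theta> s \<odot>\<^bsub>S\<^esub> u = s)) \<and>
   (\<forall>c \<in> carrier k. \<forall>d \<in> carrier k. c \<otimes>\<^bsub>k\<^esub> d = d \<otimes>\<^bsub>k\<^esub> c)"
proof -
  interpret S: left_module k S using unit_Obj by (simp add: Obj_iff)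
  obtain v where v: "v \<in> carrier S" "v \<noteq> \<zero>\<^bsub>S\<^esub>" using unit_nontrivial by auto
  obtain \<theta> where \<theta>: "is_linear k S (regular_module k) \<theta>" "\<theta> v = \<one>\<^bsub>k\<^esub>"
    using S.exists_functional[OF _ v] division_ring_axioms by auto
  have \<theta>_closed: "\<theta> s \<in> carrier k" if "s \<in> carrier S" for s
    using linear_closed[OF \<theta>(1) that] by simp
  define E where "E s = mk S (\<lambda>x. \<theta> x \<odot>\<^bsub>S\<^esub> s) S" for s
  have E: "E s \<in> arrows C S S" if "s \<in> carrier S" for s
    unfolding E_def using that unit_Obj
    by (intro mk_arrow is_linearI)
      (auto simp: linear_add[OF \<theta>(1)] linear_smult[OF \<theta>(1)] \<theta>_closed S.smult_closed S.smult_l_distr S.smult_assoc)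
  \<comment> \<open>The two composites of \<open>E s\<close> and \<open>E t\<close> are compared at
    \<open>v\<close>, where \<theta> is 1.\<close>
  have *: "\<theta> t \<odot>\<^bsub>S\<^esub> s = \<theta> s \<odot>\<^bsub>S\<^esub> t" if "s \<in> carrier S" "t \<in> carrier S" for s t
    using unit_endomorphisms_commute[OF E[OF that(1)] E[OF that(2)] v(1)] that v
    by (simp add: E_def \<theta>(2) S.smult_one)
  have "\<theta> s \<odot>\<^bsub>S\<^esub> v = s" if "s \<in> carrier S" for s
    using *[OF that v(1)] that by (simp add: \<theta> S.smult_one)
  moreover have "c \<otimes>\<^bsub>k\<^esub> d = d \<otimes>\<^bsub>k\<^esub> c" if "c \<in> carrier k" "d \<in> carrier k" for c d
  proof -
    have \<theta>v: "\<theta> (a \<odot>\<^bsub>S\<^esub> v) = a" if "a \<in> carrier k" for a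
      using that v \<theta> by (simp add: linear_smult[OF \<theta>(1)])
    \<comment> \<open>The symmetric identity for two multiples of \<open>v\<close> exchanges the
      scalars; applying \<theta> compares the coefficients.\<close>
    have "d \<odot>\<^bsub>S\<^esub> (c \<odot>\<^bsub>S\<^esub> v) = c \<odot>\<^bsub>S\<^esub> (d \<odot>\<^bsub>S\<^esub> v)"
      using *[of "c \<odot>\<^bsub>S\<^esub> v" "d \<odot>\<^bsub>S\<^esub> v"] that v by (simp add: \<theta>v S.smult_closed)
    then have "\<theta> ((d \<otimes>\<^bsub>k\<^esub> c) \<odot>\<^bsub>S\<^esub> v) = \<theta> ((c \<otimes>\<^bsub>k\<^esub> d) \<odot>\<^bsub>S\<^esub> v)"
      using that v by (simp add: S.smult_assoc)
    then show ?thesis using that by (simp add: \<theta>v)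
  qed
  ultimately show ?thesis using v \<theta> by blast
qed

lemma field: "field k"
proof -
  have "cring k"
    using unit_line ring_axioms by (intro cring.intro comm_monoid.intro comm_monoid_axioms.intro monoid_axioms) auto
  then show ?thesis
    using Units_nonzero by (intro cring.cring_fieldI)
qed

end

text \<open>A generator of the unit line and its coordinate function are fixed. The choice is
  arbitrary: comparisons between structures match generators.\<close>

locale monoidal_modules_basis = monoidal_modules k U M
  for k :: "('k, 'x) ring_scheme" and U :: "'u itself" and M :: "(('k, 'u) module, ('k, 'u) modarrow) monstr" +
  fixes u :: 'u and \<theta> :: "'u \<Rightarrow> 'k"
  assumes u_closed: "u \<in> carrier (unit M)"
    and \<theta>_linear: "is_linear k (unit M) (regular_module k) \<theta>"
    and \<theta>_u: "\<theta> u = \<one>\<^bsub>k\<^esub>"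
    and \<theta>_coord: "s \<in> carrier (unit M) \<Longrightarrow> \<theta> s \<odot>\<^bsub>unit M\<^esub> u = s"
begin

sublocale field k by (rule field)

section \<open>Elements as arrows from the unit, and their products\<close>

lemma \<theta>_closed [simp]: "s \<in> carrier S \<Longrightarrow> \<theta> s \<in> carrier k"
  using linear_closed[OF \<theta>_linear] by simp

lemma \<theta>_smult_u: "c \<in> carrier k \<Longrightarrow> \<theta> (c \<odot>\<^bsub>S\<^esub> u) = c"
  using linear_smult[OF \<theta>_linear _ u_closed] by (simp add: \<theta>_u)

lemma unit_ext:
  assumes "f \<in> arrows C S z" "g \<in> arrows C S z" "app f u = app g u"
  shows "f = g"
proof (rule arrow_eqI[OF assms(1,2)])
  fix s assume "s \<in> carrier S"
  then show "app f s = app g s"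
    using \<theta>_coord[of s] app_smult[OF assms(1), of "\<theta> s" u] app_smult[OF assms(2), of "\<theta> s" u] assms(3) u_closed
    by simp
qed

definition hat :: "('k, 'u) module \<Rightarrow> 'u \<Rightarrow> ('k, 'u) modarrow" where
  "hat x a = mk S (\<lambda>s. \<theta> s \<odot>\<^bsub>x\<^esub> a) x"

lemma hat_arrow:
  assumes "x \<in> Obj C" "a \<in> carrier x"
  shows "hat x a \<in> arrows C S x"
proof -
  interpret x: left_module k x using assms by (simp add: Obj_iff)
  show ?thesis
    unfolding hat_def using assms unit_Obj
    by (intro mk_arrow is_linearI)
      (auto simp: linear_add[OF \<theta>_linear] linear_smult[OF \<theta>_linear] x.smult_closed x.smult_l_distr x.smult_assoc)
qed

lemma hat_u: "\<lbrakk>x \<in> Obj C; a \<in> carrier x\<rbrakk> \<Longrightarrow> app (hat x a) u = a"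
  by (simp add: hat_def u_closed \<theta>_u left_module.smult_one Obj_iff)

lemma hat_smult_u: "\<lbrakk>x \<in> Obj C; a \<in> carrier x; c \<in> carrier k\<rbrakk> \<Longrightarrow> app (hat x a) (c \<odot>\<^bsub>S\<^esub> u) = c \<odot>\<^bsub>x\<^esub> a"
  by (simp add: app_smult[OF hat_arrow] hat_u u_closed)

lemma comp_hat:
  assumes "f \<in> arrows C x y" "a \<in> carrier x"
  shows "f \<Zsemi> hat x a = hat y (app f a)"
  using assms arrow_Obj[OF assms(1)]
  by (intro unit_ext[of _ y] Cmp_in[of _ S x])
    (auto simp: hat_arrow app_closed app_comp[OF hat_arrow] u_closed hat_u)

lemma hat_unit: "hat S u = Idt C S"
  by (intro unit_ext[of _ S]) (auto simp: hat_arrow u_closed Idt_in unit_Obj hat_u)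

text \<open>The generator of \<open>S \<otimes> S\<close> that is going to be
  \<open>u \<otimes> u\<close>. Choosing it through \<open>run\<close> fixes the scalar of the right
  unitor to be 1; no other normalisation remains free.\<close>

definition e :: 'u where "e = inv_into (carrier (T S S)) (app (run M S)) u"

lemma e_closed: "e \<in> carrier (T S S)" and run_e: "app (run M S) e = u"
proof -
  have "u \<in> app (run M S) ` carrier (T S S)"
    using iso_inverse[OF run_iso[OF unit_Obj]] u_closed app_closed by (metis image_eqI)
  then show "e \<in> carrier (T S S)" "app (run M S) e = u"
    unfolding e_def by (auto simp: inv_into_into f_inv_into_f)
qed

definition p :: "('k, 'u) module \<Rightarrow> ('k, 'u) module \<Rightarrow> 'u \<Rightarrow> 'u \<Rightarrow> 'u" where
  "p x y a b = app (hat x a \<boxtimes> hat y b) e"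

lemma p_closed:
  assumes "x \<in> Obj C" "y \<in> Obj C" "a \<in> carrier x" "b \<in> carrier y"
  shows "p x y a b \<in> carrier (T x y)"
  unfolding p_def using app_closed[OF tenA_arrow[OF hat_arrow hat_arrow] e_closed] assms by blast

text \<open>Functoriality of the product together with \<open>comp_hat\<close>: applying an arrow to
  an element is composing with the arrow that names the element.\<close>

lemma tenA_p:
  assumes "f \<in> arrows C x x'" "g \<in> arrows C y y'" "a \<in> carrier x" "b \<in> carrier y"
  shows "app (f \<boxtimes> g) (p x y a b) = p x' y' (app f a) (app g b)"
proof -
  note h = hat_arrow[OF arrow_dom[OF assms(1)] assms(3)] hat_arrow[OF arrow_dom[OF assms(2)] assms(4)]
  have "app (f \<boxtimes> g) (p x y a b) = app ((f \<Zsemi> hat x a) \<boxtimes> (g \<Zsemi> hat y b)) e"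
    unfolding p_def using e_closed h assms
    by (simp add: tenA_Cmp[OF h(1) assms(1) h(2) assms(2)] app_comp[OF tenA_arrow[OF h]])
  then show ?thesis using assms by (simp add: p_def comp_hat)
qed

lemma p_unit: "p S S u u = e"
  by (simp add: p_def hat_unit tenA_Idt unit_Obj e_closed)

text \<open>Additivity is assumed only against identities; a general second factor is split off
  first.\<close>

lemma tenA_Pls_left:
  assumes "f \<in> arrows C x x'" "f' \<in> arrows C x x'" "g \<in> arrows C y y'"
  shows "Pls C f f' \<boxtimes> g = Pls C (f \<boxtimes> g) (f' \<boxtimes> g)"
proof -
  note O = arrow_Obj[OF assms(1)] arrow_Obj[OF assms(3)]
  have "Pls C f f' \<boxtimes> Idt C y' = Pls C (f \<boxtimes> Idt C y') (f' \<boxtimes> Idt C y')"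
    using additive_left[OF O(4)] O assms by (auto simp: is_additive_def tensor_right_def)
  then show ?thesis
    using tenA_split(1)[OF assms(1,3)] tenA_split(1)[OF assms(2,3)] tenA_split(1)[OF Pls_in[OF assms(1,2)] assms(3)]
      Pls_Cmp[OF tenA_arrow[OF Idt_in[OF O(1)] assms(3)] tenA_arrow[OF assms(1) Idt_in[OF O(4)]]
        tenA_arrow[OF assms(2) Idt_in[OF O(4)]]] by simp
qed

lemma tenA_Pls_right:
  assumes "f \<in> arrows C x x'" "g \<in> arrows C y y'" "g' \<in> arrows C y y'"
  shows "f \<boxtimes> Pls C g g' = Pls C (f \<boxtimes> g) (f \<boxtimes> g')"
proof -
  note O = arrow_Obj[OF assms(1)] arrow_Obj[OF assms(2)]
  have "Idt C x' \<boxtimes> Pls C g g' = Pls C (Idt C x' \<boxtimes> g) (Idt C x' \<boxtimes> g')"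
    using additive_right[OF O(2)] O assms by (auto simp: is_additive_def tensor_left_def)
  then show ?thesis
    using tenA_split(2)[OF assms(1,2)] tenA_split(2)[OF assms(1,3)] tenA_split(2)[OF assms(1) Pls_in[OF assms(2,3)]]
      Pls_Cmp[OF tenA_arrow[OF assms(1) Idt_in[OF O(3)]] tenA_arrow[OF Idt_in[OF O(2)] assms(2)]
        tenA_arrow[OF Idt_in[OF O(2)] assms(3)]] by simp
qed

text \<open>Multiplication by a scalar is an arrow thanks to the commutativity of \<open>k\<close>
  already established.\<close>

definition sc :: "('k, 'u) module \<Rightarrow> 'k \<Rightarrow> ('k, 'u) modarrow" where
  "sc x c = mk x (\<lambda>a. c \<odot>\<^bsub>x\<^esub> a) x"

lemma sc_arrow:
  assumes "x \<in> Obj C" "c \<in> carrier k"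
  shows "sc x c \<in> arrows C x x"
proof -
  interpret x: left_module k x using assms by (simp add: Obj_iff)
  show ?thesis
    unfolding sc_def using assms
    by (intro mk_arrow is_linearI)
      (auto simp: x.smult_closed x.smult_r_distr x.smult_assoc[symmetric] m_comm)
qed

lemma app_sc: "a \<in> carrier x \<Longrightarrow> app (sc x c) a = c \<odot>\<^bsub>x\<^esub> a"
  by (simp add: sc_def)

text \<open>The source of homogeneity. Naturality of \<open>run\<close> carries the action on the
  left factor to multiplication by \<open>c\<close> on \<open>S\<close>, and linearity and
  injectivity of \<open>run\<close> carry it back; \<open>lun\<close> does the same for the right
  factor.\<close>

lemma sc_tensor_unit:
  assumes c: "c \<in> carrier k" and t: "t \<in> carrier (T S S)"
  shows "app (sc S c \<boxtimes> Idt C S) t = c \<odot>\<^bsub>T S S\<^esub> t" and "app (Idt C S \<boxtimes> sc S c) t = c \<odot>\<^bsub>T S S\<^esub> t"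
proof -
  note SO = unit_Obj and s = sc_arrow[OF unit_Obj c]
  note f1 = tenA_arrow[OF s Idt_in[OF SO]] tenA_arrow[OF Idt_in[OF SO] s]
  interpret TS: left_module k "T S S" using tenO_Obj[OF SO SO] by (simp add: Obj_iff)
  have "app (run M S) (app (sc S c \<boxtimes> Idt C S) t) = app (sc S c) (app (run M S) t)"
    using arg_cong[OF run_natural[OF s], of "\<lambda>f. app f t"] t
    by (simp add: app_comp[OF f1(1)] app_comp[OF run_arrow[OF SO]])
  also have "\<dots> = app (run M S) (c \<odot>\<^bsub>T S S\<^esub> t)"
    using app_closed[OF run_arrow[OF SO] t] app_smult[OF run_arrow[OF SO] c t] by (simp add: sc_def)
  finally show "app (sc S c \<boxtimes> Idt C S) t = c \<odot>\<^bsub>T S S\<^esub> t"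
    using iso_inj[OF run_iso[OF SO]] app_closed[OF f1(1) t] t c TS.smult_closed by blast
  have "app (lun M S) (app (Idt C S \<boxtimes> sc S c) t) = app (sc S c) (app (lun M S) t)"
    using arg_cong[OF lun_natural[OF s], of "\<lambda>f. app f t"] t
    by (simp add: app_comp[OF f1(2)] app_comp[OF lun_arrow[OF SO]])
  also have "\<dots> = app (lun M S) (c \<odot>\<^bsub>T S S\<^esub> t)"
    using app_closed[OF lun_arrow[OF SO] t] app_smult[OF lun_arrow[OF SO] c t] by (simp add: sc_def)
  finally show "app (Idt C S \<boxtimes> sc S c) t = c \<odot>\<^bsub>T S S\<^esub> t"
    using iso_inj[OF lun_iso[OF SO]] app_closed[OF f1(2) t] t c TS.smult_closed by blast
qed

lemma hat_smult:
  assumes "x \<in> Obj C" "a \<in> carrier x" "c \<in> carrier k"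
  shows "hat x (c \<odot>\<^bsub>x\<^esub> a) = hat x a \<Zsemi> sc S c"
proof -
  interpret x: left_module k x using assms by (simp add: Obj_iff)
  show ?thesis
    using assms unit_Obj u_closed
    by (intro unit_ext[of _ x] Cmp_in[of _ S S])
      (auto simp: hat_arrow sc_arrow x.smult_closed app_comp[OF sc_arrow] hat_u app_sc hat_smult_u)
qed

lemma hat_add:
  assumes "x \<in> Obj C" "a \<in> carrier x" "a' \<in> carrier x"
  shows "hat x (a \<oplus>\<^bsub>x\<^esub> a') = Pls C (hat x a) (hat x a')"
proof -
  interpret x: left_module k x using assms by (simp add: Obj_iff)
  show ?thesis
    using assms unit_Obj u_closed
    by (intro unit_ext[of _ x] Pls_in[of _ S x])
      (auto simp: hat_arrow hat_u app_Pls[OF hat_arrow hat_arrow])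
qed

lemma p_bilinear:
  assumes x: "x \<in> Obj C" and y: "y \<in> Obj C"
  shows "is_bilinear k x y (T x y) (p x y)"
proof (rule is_bilinearI)
  interpret x: left_module k x using assms by (simp add: Obj_iff)
  interpret y: left_module k y using assms by (simp add: Obj_iff)
  note h = hat_arrow[OF x] hat_arrow[OF y]
  show "p x y a b \<in> carrier (T x y)" if "a \<in> carrier x" "b \<in> carrier y" for a b
    using that assms by (rule p_closed[rotated 2])
  show "p x y (a \<oplus>\<^bsub>x\<^esub> a') b = p x y a b \<oplus>\<^bsub>T x y\<^esub> p x y a' b"
    if "a \<in> carrier x" "a' \<in> carrier x" "b \<in> carrier y" for a a' b
    using that x y e_closed
    by (simp add: p_def hat_add tenA_Pls_left[OF h(1) h(1) h(2)] app_Pls[OF tenA_arrow[OF h] tenA_arrow[OF h]])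
  show "p x y a (b \<oplus>\<^bsub>y\<^esub> b') = p x y a b \<oplus>\<^bsub>T x y\<^esub> p x y a b'"
    if "a \<in> carrier x" "b \<in> carrier y" "b' \<in> carrier y" for a b b'
    using that x y e_closed
    by (simp add: p_def hat_add tenA_Pls_right[OF h(1) h(2) h(2)] app_Pls[OF tenA_arrow[OF h] tenA_arrow[OF h]])
next
  fix c a b assume *: "c \<in> carrier k" "a \<in> carrier x" "b \<in> carrier y"
  note h = hat_arrow[OF x *(2)] hat_arrow[OF y *(3)] and s = sc_arrow[OF unit_Obj *(1)] and I = Idt_in[OF unit_Obj]
  \<comment> \<open>The scalar is moved from the element to the unit, where
    \<open>sc_tensor_unit\<close> evaluates it on \<open>e\<close>.\<close>
  have "hat x (c \<odot>\<^bsub>x\<^esub> a) \<boxtimes> hat y b = (hat x a \<boxtimes> hat y b) \<Zsemi> (sc S c \<boxtimes> Idt C S)"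
    using tenA_Cmp[OF s h(1) I h(2)] x * h by (simp add: hat_smult Cmp_Idt)
  then show "p x y (c \<odot>\<^bsub>x\<^esub> a) b = c \<odot>\<^bsub>T x y\<^esub> p x y a b"
    using e_closed *
    by (simp add: p_def app_comp[OF tenA_arrow[OF s I]] sc_tensor_unit app_smult[OF tenA_arrow[OF h]])
  have "hat x a \<boxtimes> hat y (c \<odot>\<^bsub>y\<^esub> b) = (hat x a \<boxtimes> hat y b) \<Zsemi> (Idt C S \<boxtimes> sc S c)"
    using tenA_Cmp[OF I h(1) s h(2)] y * h by (simp add: hat_smult Cmp_Idt)
  then show "p x y a (c \<odot>\<^bsub>y\<^esub> b) = c \<odot>\<^bsub>T x y\<^esub> p x y a b"
    using e_closed *
    by (simp add: p_def app_comp[OF tenA_arrow[OF I s]] sc_tensor_unit app_smult[OF tenA_arrow[OF h]])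
qed

section \<open>The structure maps on products, up to scalars\<close>

lemma unit_nonzero: "u \<noteq> \<zero>\<^bsub>S\<^esub>"
proof -
  interpret S: left_module k S using unit_Obj by (simp add: Obj_iff)
  show ?thesis
    using \<theta>_smult_u[of "\<zero>\<^bsub>k\<^esub>"] \<theta>_u one_not_zero S.smult_l_null[OF u_closed] by auto
qed

lemma run_p:
  assumes "x \<in> Obj C" "a \<in> carrier x"
  shows "app (run M x) (p x S a u) = a"
proof -
  note h = hat_arrow[OF assms] and I = Idt_in[OF unit_Obj]
  have "app (run M x) (p x S a u) = app (run M x \<Zsemi> (hat x a \<boxtimes> Idt C S)) e"
    by (simp add: p_def hat_unit e_closed app_comp[OF tenA_arrow[OF h I]])
  also have "\<dots> = app (hat x a) (app (run M S) e)"
    using run_natural[OF h] e_closed by (simp add: app_comp[OF run_arrow[OF unit_Obj]])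
  finally show ?thesis using assms by (simp add: run_e hat_u)
qed

text \<open>The factor by which the left unitor could differ from the standard one, given that
  \<open>e\<close> was normalised by the right unitor.\<close>

definition \<rho> :: 'k where "\<rho> = \<theta> (app (lun M S) e)"

lemma \<rho>_closed: "\<rho> \<in> carrier k"
  using app_closed[OF lun_arrow[OF unit_Obj] e_closed] by (simp add: \<rho>_def)

lemma lun_p_scalar:
  assumes "y \<in> Obj C" "b \<in> carrier y"
  shows "app (lun M y) (p S y u b) = \<rho> \<odot>\<^bsub>y\<^esub> b"
proof -
  note h = hat_arrow[OF assms] and I = Idt_in[OF unit_Obj]
  have l: "app (lun M S) e \<in> carrier S" using app_closed[OF lun_arrow[OF unit_Obj] e_closed] .
  have "app (lun M y) (p S y u b) = app (lun M y \<Zsemi> (Idt C S \<boxtimes> hat y b)) e"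
    by (simp add: p_def hat_unit e_closed app_comp[OF tenA_arrow[OF I h]])
  also have "\<dots> = app (hat y b) (app (lun M S) e)"
    using lun_natural[OF h] e_closed by (simp add: app_comp[OF lun_arrow[OF unit_Obj]])
  also have "\<dots> = \<rho> \<odot>\<^bsub>y\<^esub> b"
    using hat_smult_u[OF assms \<rho>_closed] \<theta>_coord[OF l] by (simp add: \<rho>_def)
  finally show ?thesis .
qed

text \<open>Otherwise the isomorphism \<open>lun M S\<close> would kill \<open>e\<close>, whose
  image under \<open>run M S\<close> is the nonzero \<open>u\<close>.\<close>

lemma \<rho>_nonzero: "\<rho> \<noteq> \<zero>\<^bsub>k\<^esub>"
proof
  interpret S: left_module k S using unit_Obj by (simp add: Obj_iff)
  interpret TS: left_module k "T S S" using tenO_Obj unit_Obj by (simp add: Obj_iff)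
  assume "\<rho> = \<zero>\<^bsub>k\<^esub>"
  then have "app (lun M S) e = \<zero>\<^bsub>S\<^esub>"
    using \<theta>_coord[OF app_closed[OF lun_arrow[OF unit_Obj] e_closed]] S.smult_l_null[OF u_closed]
    by (simp add: \<rho>_def)
  then have "app (lun M S) e = app (lun M S) \<zero>\<^bsub>T S S\<^esub>"
    using app_zero[OF lun_arrow[OF unit_Obj]] by simp
  then have "e = \<zero>\<^bsub>T S S\<^esub>"
    using iso_inj[OF lun_iso[OF unit_Obj]] e_closed by blast
  then show False using run_e app_zero[OF run_arrow[OF unit_Obj]] unit_nonzero by simp
qed

text \<open>The left unitor sends \<open>p S y u b\<close> to a nonzero multiple of
  \<open>b\<close>, and it is injective; so \<open>b\<close> is its value at \<open>t\<close>
  divided by \<rho>. This is the one kind of tensor product whose elements are known to be products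
  from the start.\<close>

lemma unit_tensor_surj:
  assumes y: "y \<in> Obj C" and t: "t \<in> carrier (T S y)"
  shows "\<exists>b \<in> carrier y. t = p S y u b"
proof -
  interpret y: left_module k y using y by (simp add: Obj_iff)
  define b where "b = inv\<^bsub>k\<^esub> \<rho> \<odot>\<^bsub>y\<^esub> app (lun M y) t"
  have U: "\<rho> \<in> Units k" using \<rho>_closed \<rho>_nonzero by (simp add: field_Units)
  have l: "app (lun M y) t \<in> carrier y" using app_closed[OF lun_arrow[OF y] t] .
  have b: "b \<in> carrier y" using U l by (simp add: b_def y.smult_closed)
  have "app (lun M y) (p S y u b) = app (lun M y) t"
    using U l \<rho>_closed unfolding lun_p_scalar[OF y b] by (simp add: b_def y.smult_assoc[symmetric] y.smult_one)
  then show ?thesis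
    using iso_inj[OF lun_iso[OF y]] t p_closed[OF unit_Obj y u_closed b] b by metis
qed

lemma p_unit_inj:
  assumes y: "y \<in> Obj C" "b \<in> carrier y" "b' \<in> carrier y" "p S y u b = p S y u b'"
  shows "b = b'"
proof -
  interpret y: left_module k y using y by (simp add: Obj_iff)
  have U: "\<rho> \<in> Units k" using \<rho>_closed \<rho>_nonzero by (simp add: field_Units)
  have "\<rho> \<odot>\<^bsub>y\<^esub> b = \<rho> \<odot>\<^bsub>y\<^esub> b'" using lun_p_scalar y by metis
  then have "inv\<^bsub>k\<^esub> \<rho> \<odot>\<^bsub>y\<^esub> (\<rho> \<odot>\<^bsub>y\<^esub> b) = inv\<^bsub>k\<^esub> \<rho> \<odot>\<^bsub>y\<^esub> (\<rho> \<odot>\<^bsub>y\<^esub> b')" by simp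
  then show ?thesis using y U \<rho>_closed by (simp add: y.smult_assoc[symmetric] y.smult_one)
qed

text \<open>With \<open>unit_tensor_unit_surj\<close> this makes \<open>e\<close> a basis of
  \<open>S \<otimes> S\<close>, so that scalars can be read off from equations there.\<close>

lemma scalar_unit_inj:
  assumes "c \<in> carrier k" "d \<in> carrier k" "c \<odot>\<^bsub>T S S\<^esub> e = d \<odot>\<^bsub>T S S\<^esub> e"
  shows "c = d"
proof -
  have "c \<odot>\<^bsub>S\<^esub> u = d \<odot>\<^bsub>S\<^esub> u"
    using app_smult[OF run_arrow[OF unit_Obj] assms(1) e_closed] app_smult[OF run_arrow[OF unit_Obj] assms(2) e_closed]
      assms(3) run_e by simp
  then show ?thesis using \<theta>_smult_u assms by metis
qed

lemma unit_tensor_unit_surj: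
  assumes "t \<in> carrier (T S S)"
  shows "\<exists>c \<in> carrier k. t = c \<odot>\<^bsub>T S S\<^esub> e"
proof -
  obtain s where s: "s \<in> carrier S" "t = p S S u s" using unit_tensor_surj[OF unit_Obj assms] by auto
  then have "t = \<theta> s \<odot>\<^bsub>T S S\<^esub> e"
    using bilinear_smult_right[OF p_bilinear[OF unit_Obj unit_Obj], of "\<theta> s" u u] \<theta>_coord[OF s(1)] u_closed
    by (simp add: p_unit)
  then show ?thesis using s by auto
qed

text \<open>Naturality along the arrows naming \<open>a\<close> and \<open>b\<close> reduces every
  case to the value of the symmetry at \<open>e\<close>. Hence one scalar serves all objects and
  elements.\<close>

lemma swp_p_scalar:
  "\<exists>\<sigma> \<in> carrier k. \<forall>x \<in> Obj C. \<forall>y \<in> Obj C. \<forall>a \<in> carrier x. \<forall>b \<in> carrier y.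
     app (swp M x y) (p x y a b) = \<sigma> \<odot>\<^bsub>T y x\<^esub> p y x b a"
proof -
  obtain \<sigma> where \<sigma>: "\<sigma> \<in> carrier k" "app (swp M S S) e = \<sigma> \<odot>\<^bsub>T S S\<^esub> e"
    using unit_tensor_unit_surj app_closed[OF swp_arrow e_closed] unit_Obj by blast
  have "app (swp M x y) (p x y a b) = \<sigma> \<odot>\<^bsub>T y x\<^esub> p y x b a"
    if xy: "x \<in> Obj C" "y \<in> Obj C" "a \<in> carrier x" "b \<in> carrier y" for x y a b
  proof -
    note h = hat_arrow[OF xy(1,3)] hat_arrow[OF xy(2,4)]
    have "app (swp M x y) (p x y a b) = app (swp M x y \<Zsemi> (hat x a \<boxtimes> hat y b)) e"
      by (simp add: p_def e_closed app_comp[OF tenA_arrow[OF h]])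
    also have "\<dots> = app (hat y b \<boxtimes> hat x a) (app (swp M S S) e)"
      using swp_natural[OF h] e_closed by (simp add: app_comp[OF swp_arrow[OF unit_Obj unit_Obj]])
    also have "\<dots> = \<sigma> \<odot>\<^bsub>T y x\<^esub> p y x b a"
      using \<sigma> e_closed by (simp add: p_def app_smult[OF tenA_arrow[OF h(2,1)]])
    finally show ?thesis .
  qed
  then show ?thesis using \<sigma> by blast
qed

text \<open>As for the symmetry, the test element now being (u \<otimes> u) \<otimes> u. Its image
  lies in \<open>S \<otimes> (S \<otimes> S)\<close>, which is again a line.\<close>

lemma ass_p_scalar:
  "\<exists>\<alpha> \<in> carrier k. \<forall>x \<in> Obj C. \<forall>y \<in> Obj C. \<forall>z \<in> Obj C. \<forall>a \<in> carrier x. \<forall>b \<in> carrier y. \<forall>c \<in> carrier z.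
     app (ass M x y z) (p (T x y) z (p x y a b) c) = \<alpha> \<odot>\<^bsub>T x (T y z)\<^esub> p x (T y z) a (p y z b c)"
proof -
  note SO = unit_Obj and SSO = tenO_Obj[OF unit_Obj unit_Obj]
  interpret TS: left_module k "T S S" using SSO by (simp add: Obj_iff)
  have e3: "p (T S S) S e u \<in> carrier (T (T S S) S)" by (intro p_closed SSO SO e_closed u_closed)
  have "app (ass M S S S) (p (T S S) S e u) \<in> carrier (T S (T S S))"
    by (rule app_closed[OF ass_arrow e3]) (rule SO)+
  then obtain t where t: "t \<in> carrier (T S S)" "app (ass M S S S) (p (T S S) S e u) = p S (T S S) u t"
    using unit_tensor_surj[OF SSO] by auto
  obtain \<alpha> where \<alpha>: "\<alpha> \<in> carrier k" "t = \<alpha> \<odot>\<^bsub>T S S\<^esub> e" using unit_tensor_unit_surj t by blast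
  have *: "app (ass M S S S) (p (T S S) S e u) = \<alpha> \<odot>\<^bsub>T S (T S S)\<^esub> p S (T S S) u e"
    using bilinear_smult_right[OF p_bilinear[OF SO SSO] \<alpha>(1) u_closed e_closed] t \<alpha> by simp
  have "app (ass M x y z) (p (T x y) z (p x y a b) c) = \<alpha> \<odot>\<^bsub>T x (T y z)\<^esub> p x (T y z) a (p y z b c)"
    if xyz: "x \<in> Obj C" "y \<in> Obj C" "z \<in> Obj C" "a \<in> carrier x" "b \<in> carrier y" "c \<in> carrier z" for x y z a b c
  proof -
    note h = hat_arrow[OF xyz(1,4)] hat_arrow[OF xyz(2,5)] hat_arrow[OF xyz(3,6)]
    note hu = hat_u[OF xyz(1,4)] hat_u[OF xyz(2,5)] hat_u[OF xyz(3,6)]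
    have pe: "app (hat x a \<boxtimes> hat y b) e = p x y a b" "app (hat y b \<boxtimes> hat z c) e = p y z b c"
      by (simp_all add: p_def)
    have 1: "p (T x y) z (p x y a b) c = app ((hat x a \<boxtimes> hat y b) \<boxtimes> hat z c) (p (T S S) S e u)"
      using tenA_p[OF tenA_arrow[OF h(1,2)] h(3) e_closed u_closed] by (simp add: pe hu)
    have 2: "app (hat x a \<boxtimes> (hat y b \<boxtimes> hat z c)) (p S (T S S) u e) = p x (T y z) a (p y z b c)"
      using tenA_p[OF h(1) tenA_arrow[OF h(2,3)] u_closed e_closed] by (simp add: pe hu)
    have "app (ass M x y z) (p (T x y) z (p x y a b) c) =
        app (ass M x y z \<Zsemi> ((hat x a \<boxtimes> hat y b) \<boxtimes> hat z c)) (p (T S S) S e u)"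
      using e3 by (simp add: 1 app_comp[OF tenA_arrow[OF tenA_arrow[OF h(1,2)] h(3)]])
    also have "\<dots> = app (hat x a \<boxtimes> (hat y b \<boxtimes> hat z c)) (app (ass M S S S) (p (T S S) S e u))"
      using ass_natural[OF h] e3 by (simp add: app_comp[OF ass_arrow[OF SO SO SO]])
    also have "\<dots> = \<alpha> \<odot>\<^bsub>T x (T y z)\<^esub> p x (T y z) a (p y z b c)"
      using app_smult[OF tenA_arrow[OF h(1) tenA_arrow[OF h(2,3)]] \<alpha>(1) p_closed[OF SO SSO u_closed e_closed]]
      by (simp add: * 2)
    finally show ?thesis .
  qed
  then show ?thesis using \<alpha>(1) by blast
qed

text \<open>The structure maps act on pure tensors as the standard ones up to scalars. Evaluating the
  triangle, the pentagon and the hexagon at the unit forces the scalars to be \<open>1\<close>.\<close>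

lemma coherence_scalars:
  shows \<rho>_one: "\<rho> = \<one>\<^bsub>k\<^esub>"
    and ass_p: "\<lbrakk>x \<in> Obj C; y \<in> Obj C; z \<in> Obj C; a \<in> carrier x; b \<in> carrier y; c \<in> carrier z\<rbrakk> \<Longrightarrow>
      app (ass M x y z) (p (T x y) z (p x y a b) c) = p x (T y z) a (p y z b c)"
    and swp_p: "\<lbrakk>x \<in> Obj C; y \<in> Obj C; a \<in> carrier x; b \<in> carrier y\<rbrakk> \<Longrightarrow>
      app (swp M x y) (p x y a b) = p y x b a"
proof -
  note SO = unit_Obj and SSO = tenO_Obj[OF unit_Obj unit_Obj]
  note I = Idt_in[OF SO]
  note O3 = tenO_Obj[OF SO SSO] tenO_Obj[OF SSO SO]
  note O4 = tenO_Obj[OF SO O3(1)] tenO_Obj[OF SO O3(2)] tenO_Obj[OF O3(1) SO] tenO_Obj[OF O3(2) SO] tenO_Obj[OF SSO SSO]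
  interpret S: left_module k S using SO by (simp add: Obj_iff)
  interpret TS: left_module k "T S S" using SSO by (simp add: Obj_iff)
  interpret T3: left_module k "T S (T S S)" using O3 by (simp add: Obj_iff)
  interpret T3': left_module k "T (T S S) S" using O3 by (simp add: Obj_iff)
  interpret T4: left_module k "T S (T S (T S S))" using O4 by (simp add: Obj_iff)
  obtain \<alpha> where \<alpha>: "\<alpha> \<in> carrier k" and ass: "\<And>x y z a b c. \<lbrakk>x \<in> Obj C; y \<in> Obj C; z \<in> Obj C;
      a \<in> carrier x; b \<in> carrier y; c \<in> carrier z\<rbrakk> \<Longrightarrow>
     app (ass M x y z) (p (T x y) z (p x y a b) c) = \<alpha> \<odot>\<^bsub>T x (T y z)\<^esub> p x (T y z) a (p y z b c)"
    using ass_p_scalar by blast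
  obtain \<sigma> where \<sigma>: "\<sigma> \<in> carrier k" and swp: "\<And>x y a b. \<lbrakk>x \<in> Obj C; y \<in> Obj C;
      a \<in> carrier x; b \<in> carrier y\<rbrakk> \<Longrightarrow>
     app (swp M x y) (p x y a b) = \<sigma> \<odot>\<^bsub>T y x\<^esub> p y x b a"
    using swp_p_scalar by blast
  \<comment> \<open>The products of three and four copies of \<open>u\<close>, in the bracketings
    that occur in the coherence axioms.\<close>
  define e3 where "e3 = p S (T S S) u e"
  define e3' where "e3' = p (T S S) S e u"
  define e4 where "e4 = p S (T S (T S S)) u e3"
  define e4' where "e4' = p (T S (T S S)) S e3 u"
  define e4'' where "e4'' = p (T (T S S) S) S e3' u"
  have e3: "e3 \<in> carrier (T S (T S S))" and e3': "e3' \<in> carrier (T (T S S) S)"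
    by (auto simp: e3_def e3'_def intro!: p_closed SO SSO u_closed e_closed)
  have e4: "e4 \<in> carrier (T S (T S (T S S)))" and e4': "e4' \<in> carrier (T (T S (T S S)) S)"
    and e4'': "e4'' \<in> carrier (T (T (T S S) S) S)"
    by (auto simp: e4_def e4'_def e4''_def intro!: p_closed SO SSO O3 u_closed e3 e3')
  note A = ass_arrow[OF SO SO SO] and sw = swp_arrow[OF SO SO]
  have ass3: "app (ass M S S S) e3' = \<alpha> \<odot>\<^bsub>T S (T S S)\<^esub> e3"
    using ass[OF SO SO SO u_closed u_closed u_closed] by (simp add: p_unit e3_def e3'_def)
  \<comment> \<open>The triangle at (u \<otimes> u) \<otimes> u: one associator and one left unitor
    against a right unitor, whose scalar is 1.\<close>
  have alam: "\<alpha> \<otimes>\<^bsub>k\<^esub> \<rho> = \<one>\<^bsub>k\<^esub>"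
  proof (rule scalar_unit_inj)
    have "app ((Idt C S \<boxtimes> lun M S) \<Zsemi> ass M S S S) e3' = app (run M S \<boxtimes> Idt C S) e3'"
      using triangle[OF SO SO] by simp
    moreover have "app (run M S \<boxtimes> Idt C S) e3' = e"
      using tenA_p[OF run_arrow[OF SO] I e_closed u_closed] u_closed by (simp add: e3'_def run_e p_unit)
    moreover have "app (Idt C S \<boxtimes> lun M S) e3 = \<rho> \<odot>\<^bsub>T S S\<^esub> e"
      using tenA_p[OF I lun_arrow[OF SO] u_closed e_closed] u_closed lun_p_scalar[OF SO u_closed]
        bilinear_smult_right[OF p_bilinear[OF SO SO] \<rho>_closed u_closed u_closed]
      by (simp add: e3_def p_unit)
    ultimately show "(\<alpha> \<otimes>\<^bsub>k\<^esub> \<rho>) \<odot>\<^bsub>T S S\<^esub> e = \<one>\<^bsub>k\<^esub> \<odot>\<^bsub>T S S\<^esub> e"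
      using \<alpha> \<rho>_closed e_closed
      by (simp add: app_comp[OF A e3'] ass3 app_smult[OF tenA_arrow[OF I lun_arrow[OF SO]] \<alpha> e3]
        TS.smult_assoc TS.smult_one)
  qed (use \<alpha> \<rho>_closed in auto)
  \<comment> \<open>Left factors \<open>u\<close> are cancelled one after the other until the
    equation lies in \<open>S \<otimes> S\<close>.\<close>
  have e4_inj: "c = d" if "c \<in> carrier k" "d \<in> carrier k"
    "c \<odot>\<^bsub>T S (T S (T S S))\<^esub> e4 = d \<odot>\<^bsub>T S (T S (T S S))\<^esub> e4" for c d
  proof (rule scalar_unit_inj[OF that(1,2)])
    have "c \<odot>\<^bsub>T S (T S S)\<^esub> e3 = d \<odot>\<^bsub>T S (T S S)\<^esub> e3"
      using p_unit_inj[OF O3(1)] bilinear_smult_right[OF p_bilinear[OF SO O3(1)] _ u_closed e3] that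
        T3.smult_closed[OF _ e3] by (metis e4_def)
    then show "c \<odot>\<^bsub>T S S\<^esub> e = d \<odot>\<^bsub>T S S\<^esub> e"
      using p_unit_inj[OF SSO] bilinear_smult_right[OF p_bilinear[OF SO SSO] _ u_closed e_closed] that
        TS.smult_closed[OF _ e_closed] by (metis e3_def)
  qed
  have e3_inj: "c = d" if "c \<in> carrier k" "d \<in> carrier k"
    "c \<odot>\<^bsub>T S (T S S)\<^esub> e3 = d \<odot>\<^bsub>T S (T S S)\<^esub> e3" for c d
  proof (rule scalar_unit_inj[OF that(1,2)])
    show "c \<odot>\<^bsub>T S S\<^esub> e = d \<odot>\<^bsub>T S S\<^esub> e"
      using p_unit_inj[OF SSO] bilinear_smult_right[OF p_bilinear[OF SO SSO] _ u_closed e_closed] that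
        TS.smult_closed[OF _ e_closed] by (metis e3_def)
  qed
  \<comment> \<open>The pentagon has three associators on one side and two on the other, so
    \<alpha>^3 = \<alpha>^2; by the triangle \<alpha> can be cancelled.\<close>
  have "\<alpha> = \<one>\<^bsub>k\<^esub>"
  proof -
    note A1 = tenA_arrow[OF A I] and A2 = ass_arrow[OF SO SSO SO] and A3 = tenA_arrow[OF I A]
      and A4 = ass_arrow[OF SSO SO SO] and A5 = ass_arrow[OF SO SO SSO]
    have p1: "p (T S (T S S)) S (\<alpha> \<odot>\<^bsub>T S (T S S)\<^esub> e3) u = \<alpha> \<odot>\<^bsub>T (T S (T S S)) S\<^esub> e4'"
      using bilinear_smult_left[OF p_bilinear[OF O3(1) SO] \<alpha> e3 u_closed] by (simp add: e4'_def)
    have a1: "app (ass M S S S \<boxtimes> Idt C S) e4'' = \<alpha> \<odot>\<^bsub>T (T S (T S S)) S\<^esub> e4'"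
      using tenA_p[OF A I e3' u_closed] u_closed by (simp add: e4''_def ass3 p1)
    have a2: "app (ass M S (T S S) S) e4' = \<alpha> \<odot>\<^bsub>T S (T (T S S) S)\<^esub> p S (T (T S S) S) u e3'"
      using ass[OF SO SSO SO u_closed e_closed u_closed] by (simp add: e4'_def e3_def e3'_def)
    have a3: "app (Idt C S \<boxtimes> ass M S S S) (p S (T (T S S) S) u e3') = \<alpha> \<odot>\<^bsub>T S (T S (T S S))\<^esub> e4"
      using tenA_p[OF I A u_closed e3'] u_closed bilinear_smult_right[OF p_bilinear[OF SO O3(1)] \<alpha> u_closed e3]
      by (simp add: ass3 e4_def)
    have a4: "app (ass M (T S S) S S) e4'' = \<alpha> \<odot>\<^bsub>T (T S S) (T S S)\<^esub> p (T S S) (T S S) e e"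
      using ass[OF SSO SO SO e_closed u_closed u_closed] by (simp add: e4''_def e3'_def p_unit)
    have a5: "app (ass M S S (T S S)) (p (T S S) (T S S) e e) = \<alpha> \<odot>\<^bsub>T S (T S (T S S))\<^esub> e4"
      using ass[OF SO SO SSO u_closed u_closed e_closed] by (simp add: e4_def e3_def p_unit)
    have q: "p S (T (T S S) S) u e3' \<in> carrier (T S (T (T S S) S))"
      "p (T S S) (T S S) e e \<in> carrier (T (T S S) (T S S))"
      by (intro p_closed SO SSO O3 u_closed e_closed e3')+
    interpret Q: left_module k "T S (T (T S S) S)" using O4 by (simp add: Obj_iff)
    have "app ((Idt C S \<boxtimes> ass M S S S) \<Zsemi> ass M S (T S S) S \<Zsemi> (ass M S S S \<boxtimes> Idt C S)) e4''
      = \<alpha> \<odot>\<^bsub>T S (T S (T S S))\<^esub> (\<alpha> \<odot>\<^bsub>T S (T S (T S S))\<^esub> (\<alpha> \<odot>\<^bsub>T S (T S (T S S))\<^esub> e4))"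
      using app_comp[OF Cmp_in[OF A1 A2] e4''] app_comp[OF A1 e4''] app_smult[OF A2 \<alpha> e4'] app_smult[OF A3 \<alpha> q(1)]
        app_smult[OF A3 \<alpha> Q.smult_closed[OF \<alpha> q(1)]]
      by (simp add: a1 a2 a3)
    moreover have "app (ass M S S (T S S) \<Zsemi> ass M (T S S) S S) e4''
      = \<alpha> \<odot>\<^bsub>T S (T S (T S S))\<^esub> (\<alpha> \<odot>\<^bsub>T S (T S (T S S))\<^esub> e4)"
      using app_comp[OF A4 e4''] app_smult[OF A5 \<alpha> q(2)] by (simp add: a4 a5)
    ultimately have "\<alpha> \<otimes>\<^bsub>k\<^esub> (\<alpha> \<otimes>\<^bsub>k\<^esub> \<alpha>) = \<alpha> \<otimes>\<^bsub>k\<^esub> \<alpha>"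
      using pentagon[OF SO SO SO SO] \<alpha> e4 by (intro e4_inj) (simp_all add: T4.smult_assoc)
    moreover have "\<alpha> \<noteq> \<zero>\<^bsub>k\<^esub>" using alam \<rho>_closed one_not_zero by auto
    ultimately show ?thesis using \<alpha> by (metis m_lcancel m_closed one_closed r_one)
  qed
  then show "\<rho> = \<one>\<^bsub>k\<^esub>" using alam \<rho>_closed by simp
  show "app (ass M x y z) (p (T x y) z (p x y a b) c) = p x (T y z) a (p y z b c)"
    if "x \<in> Obj C" "y \<in> Obj C" "z \<in> Obj C" "a \<in> carrier x" "b \<in> carrier y" "c \<in> carrier z"
    using ass[OF that] that p_closed tenO_Obj \<open>\<alpha> = \<one>\<^bsub>k\<^esub>\<close> left_module.smult_one[OF Obj_left_module] by simp
  have ass3: "app (ass M S S S) e3' = e3" using ass3 e3 \<open>\<alpha> = \<one>\<^bsub>k\<^esub>\<close> T3.smult_one by simp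
  \<comment> \<open>With trivial associators the hexagon has one symmetry on one side and two on the
    other, so \<sigma> = \<sigma>^2. The symmetry axiom would give only \<sigma>^2 = 1.\<close>
  have "\<sigma> = \<one>\<^bsub>k\<^esub>"
  proof -
    note B1 = tenA_arrow[OF sw I] and B2 = tenA_arrow[OF I sw] and B3 = swp_arrow[OF SO SSO]
    have sw1: "app (swp M S S) e = \<sigma> \<odot>\<^bsub>T S S\<^esub> e" using swp[OF SO SO u_closed u_closed] by (simp add: p_unit)
    have b1: "app (swp M S S \<boxtimes> Idt C S) e3' = \<sigma> \<odot>\<^bsub>T (T S S) S\<^esub> e3'"
      using tenA_p[OF sw I e_closed u_closed] u_closed bilinear_smult_left[OF p_bilinear[OF SSO SO] \<sigma> e_closed u_closed]
      by (simp add: e3'_def sw1)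
    have b2: "app (Idt C S \<boxtimes> swp M S S) e3 = \<sigma> \<odot>\<^bsub>T S (T S S)\<^esub> e3"
      using tenA_p[OF I sw u_closed e_closed] u_closed bilinear_smult_right[OF p_bilinear[OF SO SSO] \<sigma> u_closed e_closed]
      by (simp add: e3_def sw1)
    have b3: "app (swp M S (T S S)) e3 = \<sigma> \<odot>\<^bsub>T (T S S) S\<^esub> e3'"
      using swp[OF SO SSO u_closed e_closed] by (simp add: e3_def e3'_def)
    have "app (ass M S S S \<Zsemi> swp M S (T S S) \<Zsemi> ass M S S S) e3' = \<sigma> \<odot>\<^bsub>T S (T S S)\<^esub> e3"
      using app_comp[OF Cmp_in[OF A B3] e3'] app_comp[OF A e3'] app_smult[OF A \<sigma> e3'] by (simp add: ass3 b3)
    moreover have "app ((Idt C S \<boxtimes> swp M S S) \<Zsemi> ass M S S S \<Zsemi> (swp M S S \<boxtimes> Idt C S)) e3'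
       = \<sigma> \<odot>\<^bsub>T S (T S S)\<^esub> (\<sigma> \<odot>\<^bsub>T S (T S S)\<^esub> e3)"
      using app_comp[OF Cmp_in[OF B1 A] e3'] app_comp[OF B1 e3'] app_smult[OF A \<sigma> e3'] app_smult[OF B2 \<sigma> e3]
      by (simp add: ass3 b1 b2)
    ultimately have "\<sigma> \<otimes>\<^bsub>k\<^esub> \<sigma> = \<sigma>"
      using hexagon[OF SO SO SO] \<sigma> e3 by (intro e3_inj) (simp_all add: T3.smult_assoc)
    moreover have "\<sigma> \<noteq> \<zero>\<^bsub>k\<^esub>"
    proof
      assume "\<sigma> = \<zero>\<^bsub>k\<^esub>"
      then have "app (swp M S S) e = app (swp M S S) \<zero>\<^bsub>T S S\<^esub>"
        using sw1 TS.smult_l_null[OF e_closed] app_zero[OF sw] by simp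
      then have "e = \<zero>\<^bsub>T S S\<^esub>" using iso_inj[OF swp_iso[OF SO SO]] e_closed by blast
      then show False using run_e app_zero[OF run_arrow[OF SO]] unit_nonzero by simp
    qed
    ultimately show ?thesis using \<sigma> by (metis m_lcancel one_closed r_one)
  qed
  then show "app (swp M x y) (p x y a b) = p y x b a"
    if "x \<in> Obj C" "y \<in> Obj C" "a \<in> carrier x" "b \<in> carrier y"
    using swp[OF that] that p_closed tenO_Obj left_module.smult_one[OF Obj_left_module] by simp
qed

section \<open>Closedness makes the product universal\<close>

lemma lun_p:
  assumes "y \<in> Obj C" "b \<in> carrier y"
  shows "app (lun M y) (p S y u b) = b"
  using lun_p_scalar[OF assms] assms left_module.smult_one[OF Obj_left_module] by (simp add: \<rho>_one)

text \<open>The adjunction in the form of a universal arrow: \<open>h\<close> is the internal hom,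
  and \<open>ev\<close> corresponds to the identity of \<open>h\<close>. By naturality,
  \<open>ev\<close> after \<open>g \<boxtimes> 1\<close> corresponds to \<open>g\<close>.\<close>

lemma evaluation:
  assumes y: "y \<in> Obj C" and z: "z \<in> Obj C"
  shows "\<exists>h \<in> Obj C. \<exists>ev \<in> arrows C (T h y) z. \<forall>x \<in> Obj C. \<forall>f \<in> arrows C (T x y) z.
    \<exists>!g. g \<in> arrows C x h \<and> f = ev \<Zsemi> (g \<boxtimes> Idt C y)"
proof -
  obtain H \<phi> where adj: "adjunction C C (tensor_right C M y) H \<phi>"
    using closed[OF y] by blast
  have F: "is_functor C C H" and bij: "\<And>x. x \<in> Obj C \<Longrightarrow> bij_betw (\<phi> x z) (arrows C (T x y) z) (arrows C x (FO H z))"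
    and nat: "\<And>x x' h f. \<lbrakk>x \<in> Obj C; x' \<in> Obj C; h \<in> arrows C x' x; f \<in> arrows C (T x y) z\<rbrakk> \<Longrightarrow>
      \<phi> x' z (Idt C z \<Zsemi> f \<Zsemi> (h \<boxtimes> Idt C y)) = FA H (Idt C z) \<Zsemi> \<phi> x z f \<Zsemi> h"
    using adj z Idt_in[OF z] unfolding adjunction_def by (auto simp: tensor_right_def)
  define h where "h = FO H z"
  have h: "h \<in> Obj C" and FI: "FA H (Idt C z) = Idt C h"
    using F z by (auto simp: is_functor_def h_def)
  obtain ev where ev: "ev \<in> arrows C (T h y) z" "\<phi> h z ev = Idt C h"
    using bij[OF h] Idt_in[OF h] by (auto simp: bij_betw_def h_def[symmetric] elim!: equalityE)
  have key: "\<phi> x z (ev \<Zsemi> (g \<boxtimes> Idt C y)) = g" if g: "g \<in> arrows C x h" for x g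
  proof -
    have x: "x \<in> Obj C" using g by (rule arrow_dom)
    have "ev \<Zsemi> (g \<boxtimes> Idt C y) \<in> arrows C (T x y) z"
      using Cmp_in[OF tenA_arrow[OF g Idt_in[OF y]] ev(1)] .
    then show ?thesis
      using nat[OF h x g ev(1)] g by (simp add: Idt_Cmp FI ev(2))
  qed
  have "\<exists>!g. g \<in> arrows C x h \<and> f = ev \<Zsemi> (g \<boxtimes> Idt C y)"
    if x: "x \<in> Obj C" and f: "f \<in> arrows C (T x y) z" for x f
  proof (rule ex1I[of _ "\<phi> x z f"])
    have g: "\<phi> x z f \<in> arrows C x h" using bij[OF x] f by (auto simp: bij_betw_def h_def)
    have "f = ev \<Zsemi> (\<phi> x z f \<boxtimes> Idt C y)"
      by (rule inj_onD[OF bij_betw_imp_inj_on[OF bij[OF x]]])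
        (auto simp: key[OF g] f intro: Cmp_in[OF tenA_arrow[OF g Idt_in[OF y]] ev(1)])
    then show "\<phi> x z f \<in> arrows C x h \<and> f = ev \<Zsemi> (\<phi> x z f \<boxtimes> Idt C y)" using g by simp
  qed (use key in auto)
  then show ?thesis using h ev by blast
qed

lemma unit_tensor_ext:
  assumes y: "y \<in> Obj C" and fg: "f \<in> arrows C (T S y) z" "g \<in> arrows C (T S y) z"
    and eq: "\<And>b. b \<in> carrier y \<Longrightarrow> app f (p S y u b) = app g (p S y u b)"
  shows "f = g"
  using unit_tensor_surj[OF y] eq by (intro arrow_eqI[OF fg]) auto

text \<open>Both arrows are written as \<open>ev\<close> after \<open>g \<boxtimes> 1\<close> and
  \<open>g' \<boxtimes> 1\<close>, and it is \<open>g\<close> and \<open>g'\<close> that are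
  compared on elements. For an element \<open>a\<close>, precomposing with its name leads to
  \<open>S \<otimes> y\<close>, where all elements are products with \<open>u\<close>; uniqueness of
  the factorisation then gives equality at \<open>a\<close>.\<close>

lemma p_ext:
  assumes x: "x \<in> Obj C" and y: "y \<in> Obj C"
    and fg: "f \<in> arrows C (T x y) z" "f' \<in> arrows C (T x y) z"
    and eq: "\<And>a b. \<lbrakk>a \<in> carrier x; b \<in> carrier y\<rbrakk> \<Longrightarrow> app f (p x y a b) = app f' (p x y a b)"
  shows "f = f'"
proof -
  note I = Idt_in[OF y] and z = arrow_cod[OF fg(1)]
  obtain h ev where h: "h \<in> Obj C" "ev \<in> arrows C (T h y) z" and
    univ: "\<And>x f. \<lbrakk>x \<in> Obj C; f \<in> arrows C (T x y) z\<rbrakk> \<Longrightarrow> \<exists>!g. g \<in> arrows C x h \<and> f = ev \<Zsemi> (g \<boxtimes> Idt C y)"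
    using evaluation[OF y z] by metis
  obtain g where g: "g \<in> arrows C x h" "f = ev \<Zsemi> (g \<boxtimes> Idt C y)" using univ[OF x fg(1)] by auto
  obtain g' where g': "g' \<in> arrows C x h" "f' = ev \<Zsemi> (g' \<boxtimes> Idt C y)" using univ[OF x fg(2)] by auto
  have "g = g'"
  proof (rule arrow_eqI[OF g(1) g'(1)])
    fix a assume a: "a \<in> carrier x"
    note ha = hat_arrow[OF x a]
    have restr: "app (ev \<Zsemi> ((q \<Zsemi> hat x a) \<boxtimes> Idt C y)) t = app (ev \<Zsemi> (q \<boxtimes> Idt C y)) (app (hat x a \<boxtimes> Idt C y) t)"
      if q: "q \<in> arrows C x h" and t: "t \<in> carrier (T S y)" for q t
      using app_comp[OF Cmp_in[OF tenA_arrow[OF ha I] tenA_arrow[OF q I]] t] app_comp[OF tenA_arrow[OF ha I] t]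
        app_comp[OF tenA_arrow[OF q I] app_closed[OF tenA_arrow[OF ha I] t]] tenA_Cmp[OF ha q I I] Cmp_Idt[OF I]
      by simp
    have c: "ev \<Zsemi> ((q \<Zsemi> hat x a) \<boxtimes> Idt C y) \<in> arrows C (T S y) z" if q: "q \<in> arrows C x h" for q
      using Cmp_in[OF tenA_arrow[OF Cmp_in[OF ha q] I] h(2)] .
    have "ev \<Zsemi> ((g \<Zsemi> hat x a) \<boxtimes> Idt C y) = ev \<Zsemi> ((g' \<Zsemi> hat x a) \<boxtimes> Idt C y)"
    proof (rule unit_tensor_ext[OF y c[OF g(1)] c[OF g'(1)]])
      fix b assume b: "b \<in> carrier y"
      have t: "p S y u b \<in> carrier (T S y)" by (rule p_closed[OF unit_Obj y u_closed b])
      have "app (hat x a \<boxtimes> Idt C y) (p S y u b) = p x y a b"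
        using tenA_p[OF ha I u_closed b] b by (simp add: hat_u[OF x a])
      then show "app (ev \<Zsemi> ((g \<Zsemi> hat x a) \<boxtimes> Idt C y)) (p S y u b) =
          app (ev \<Zsemi> ((g' \<Zsemi> hat x a) \<boxtimes> Idt C y)) (p S y u b)"
        using eq[OF a b] by (simp add: restr[OF g(1) t] restr[OF g'(1) t] g(2)[symmetric] g'(2)[symmetric])
    qed
    then have "g \<Zsemi> hat x a = g' \<Zsemi> hat x a"
      using univ[OF unit_Obj c[OF g(1)]] Cmp_in[OF ha g(1)] Cmp_in[OF ha g'(1)] by metis
    then show "app g a = app g' a"
      using app_comp[OF ha u_closed] by (metis hat_u[OF x a])
  qed
  then show ?thesis using g g' by simp
qed

text \<open>A bilinear map is curried by hand: each \<open>\<beta> a\<close> is represented by one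
  element of the internal hom, and the resulting linear map from \<open>x\<close> is uncurried by
  \<open>ev\<close>.\<close>

lemma p_lift:
  assumes x: "x \<in> Obj C" and y: "y \<in> Obj C" and z: "z \<in> Obj C" and \<beta>: "is_bilinear k x y z \<beta>"
  shows "\<exists>f \<in> arrows C (T x y) z. \<forall>a \<in> carrier x. \<forall>b \<in> carrier y. app f (p x y a b) = \<beta> a b"
proof -
  note I = Idt_in[OF y] and SO = unit_Obj
  interpret x: left_module k x using x by (simp add: Obj_iff)
  interpret z: left_module k z using z by (simp add: Obj_iff)
  obtain h ev where h: "h \<in> Obj C" "ev \<in> arrows C (T h y) z" and
    univ: "\<And>x f. \<lbrakk>x \<in> Obj C; f \<in> arrows C (T x y) z\<rbrakk> \<Longrightarrow> \<exists>!g. g \<in> arrows C x h \<and> f = ev \<Zsemi> (g \<boxtimes> Idt C y)"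
    using evaluation[OF y z] by metis
  have pc: "p S y u b \<in> carrier (T S y)" if "b \<in> carrier y" for b by (rule p_closed[OF SO y u_closed that])
  have ev_arrow: "ev \<Zsemi> (g \<boxtimes> Idt C y) \<in> arrows C (T s y) z" if "g \<in> arrows C s h" for g s
    using Cmp_in[OF tenA_arrow[OF that I] h(2)] .
  have ev_app: "app (ev \<Zsemi> (g \<boxtimes> Idt C y)) (p s y a b) = app ev (p h y (app g a) b)"
    if "g \<in> arrows C s h" "a \<in> carrier s" "b \<in> carrier y" for g s a b
    using app_comp[OF tenA_arrow[OF that(1) I] p_closed[OF arrow_dom[OF that(1)] y that(2,3)]]
      tenA_p[OF that(1) I that(2,3)] that by simp
  \<comment> \<open>Elements of \<open>h\<close> are the linear maps from \<open>y\<close> to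
    \<open>z\<close>. Existence factors \<gamma> after \<open>lun M y\<close> through
    \<open>ev\<close> and evaluates at \<open>u\<close>; the left unitor returns exactly
    \<open>b\<close> because \<rho> = 1. Uniqueness compares the arrows naming two
    candidates.\<close>
  have point: "\<exists>!t. t \<in> carrier h \<and> (\<forall>b \<in> carrier y. app ev (p h y t b) = \<gamma> b)"
    if \<gamma>: "is_linear k y z \<gamma>" for \<gamma>
  proof (rule ex_ex1I)
    have "mk y \<gamma> z \<Zsemi> lun M y \<in> arrows C (T S y) z"
      using Cmp_in[OF lun_arrow[OF y] mk_arrow[OF y z \<gamma>]] .
    then obtain g where g: "g \<in> arrows C S h" "mk y \<gamma> z \<Zsemi> lun M y = ev \<Zsemi> (g \<boxtimes> Idt C y)"
      using univ[OF SO] by metis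
    have "app ev (p h y (app g u) b) = \<gamma> b" if "b \<in> carrier y" for b
      using ev_app[OF g(1) u_closed that] app_comp[OF lun_arrow[OF y] pc[OF that], of "mk y \<gamma> z"] that
      by (simp add: g(2)[symmetric] lun_p[OF y that])
    then show "\<exists>t. t \<in> carrier h \<and> (\<forall>b \<in> carrier y. app ev (p h y t b) = \<gamma> b)"
      using app_closed[OF g(1) u_closed] by blast
  next
    fix t t' assume "t \<in> carrier h \<and> (\<forall>b \<in> carrier y. app ev (p h y t b) = \<gamma> b)"
      "t' \<in> carrier h \<and> (\<forall>b \<in> carrier y. app ev (p h y t' b) = \<gamma> b)"
    then have t: "t \<in> carrier h" "t' \<in> carrier h" "\<And>b. b \<in> carrier y \<Longrightarrow> app ev (p h y t b) = app ev (p h y t' b)"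
      by auto
    note ht = hat_arrow[OF h(1) t(1)] hat_arrow[OF h(1) t(2)]
    have "ev \<Zsemi> (hat h t \<boxtimes> Idt C y) = ev \<Zsemi> (hat h t' \<boxtimes> Idt C y)"
      using t by (intro unit_tensor_ext[OF y ev_arrow[OF ht(1)] ev_arrow[OF ht(2)]])
        (simp add: ev_app[OF ht(1) u_closed] ev_app[OF ht(2) u_closed] hat_u[OF h(1)])
    then have "hat h t = hat h t'"
      using univ[OF SO ev_arrow[OF ht(1)]] ht by metis
    then show "t = t'" using hat_u[OF h(1)] t by metis
  qed
  interpret h: left_module k h using h by (simp add: Obj_iff)
  define \<tau> where "\<tau> a = (THE t. t \<in> carrier h \<and> (\<forall>b \<in> carrier y. app ev (p h y t b) = \<beta> a b))" for a
  have lin: "is_linear k y z (\<beta> a)" if "a \<in> carrier x" for a using \<beta> that by (simp add: is_bilinear_def)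
  have \<tau>: "\<tau> a \<in> carrier h" "\<And>b. b \<in> carrier y \<Longrightarrow> app ev (p h y (\<tau> a) b) = \<beta> a b" if "a \<in> carrier x" for a
    using theI'[OF point[OF lin[OF that]]] unfolding \<tau>_def by auto
  have \<tau>_eq: "\<tau> a = t" if "a \<in> carrier x" "t \<in> carrier h" "\<And>b. b \<in> carrier y \<Longrightarrow> app ev (p h y t b) = \<beta> a b" for a t
    using the1_equality[OF point[OF lin[OF that(1)]]] that unfolding \<tau>_def by blast
  note ph = p_bilinear[OF h(1) y] p_closed[OF h(1) y]
  \<comment> \<open>Linearity is a consequence of uniqueness: the sum or multiple of the
    representing elements represents the sum or multiple of the maps.\<close>
  have \<tau>_arrow: "mk x \<tau> h \<in> arrows C x h"
  proof (intro mk_arrow x h is_linearI)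
    show "\<tau> a \<in> carrier h" if "a \<in> carrier x" for a using \<tau> that by blast
    show "\<tau> (a \<oplus>\<^bsub>x\<^esub> a') = \<tau> a \<oplus>\<^bsub>h\<^esub> \<tau> a'" if "a \<in> carrier x" "a' \<in> carrier x" for a a'
      using that \<tau> by (intro \<tau>_eq)
        (auto simp: bilinear_add_left[OF ph(1)] app_add[OF h(2)] ph(2) bilinear_add_left[OF \<beta>])
    show "\<tau> (c \<odot>\<^bsub>x\<^esub> a) = c \<odot>\<^bsub>h\<^esub> \<tau> a" if "c \<in> carrier k" "a \<in> carrier x" for c a
      using that \<tau> by (intro \<tau>_eq)
        (auto simp: bilinear_smult_left[OF ph(1)] app_smult[OF h(2)] ph(2) bilinear_smult_left[OF \<beta>]
          x.smult_closed h.smult_closed)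
  qed
  then show ?thesis
    using ev_arrow ev_app[OF \<tau>_arrow] \<tau> by (intro bexI[of _ "ev \<Zsemi> (mk x \<tau> h \<boxtimes> Idt C y)"]) auto
qed

lemma tensor_system: "tensor_system k U (tenO M) p S u"
proof
  show "\<exists>f\<in>arrows C S z. app f u = c" if "z \<in> Obj C" "c \<in> carrier z" for z c
    using hat_arrow[OF that] hat_u[OF that] by blast
qed (use tenO_Obj unit_Obj u_closed p_bilinear p_ext p_lift unit_ext in blast)+

end

section \<open>Uniqueness\<close>

context tensor_system
begin

section \<open>Arrows out of iterated tensor products are determined by pure tensors\<close>

lemma p_closed:
  "\<lbrakk>x \<in> Obj C; y \<in> Obj C; a \<in> carrier x; b \<in> carrier y\<rbrakk> \<Longrightarrow> p x y a b \<in> carrier (T x y)"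
  by (rule bilinear_closed[OF p_bilinear])

text \<open>Freezing one argument of the outer product leaves an arrow, to which extensionality for
  the inner product applies. The lemmas on three and four factors iterate this.\<close>

lemma partial_tensor_linear:
  assumes "x \<in> Obj C" "y \<in> Obj C" "f \<in> arrows C (T x y) z"
  shows partial_tensor_left: "b \<in> carrier y \<Longrightarrow> mk x (\<lambda>a. app f (p x y a b)) z \<in> arrows C x z"
    and partial_tensor_right: "a \<in> carrier x \<Longrightarrow> mk y (\<lambda>b. app f (p x y a b)) z \<in> arrows C y z"
  using assms p_bilinear[OF assms(1,2)] arrow_cod[OF assms(3)]
  by (auto intro!: mk_arrow is_linear_comp[of k x "T x y" "\<lambda>a. p x y a b" z "app f"]
      is_linear_comp[of k y "T x y" "\<lambda>b. p x y a b" z "app f"] app_linear simp: is_bilinear_def)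

lemma p_ext3:
  assumes x: "x \<in> Obj C" and y: "y \<in> Obj C" and z: "z \<in> Obj C"
    and fg: "f \<in> arrows C (T (T x y) z) w" "g \<in> arrows C (T (T x y) z) w"
    and eq: "\<And>a b c. \<lbrakk>a \<in> carrier x; b \<in> carrier y; c \<in> carrier z\<rbrakk> \<Longrightarrow>
      app f (p (T x y) z (p x y a b) c) = app g (p (T x y) z (p x y a b) c)"
  shows "f = g"
proof (rule p_ext[OF T_Obj[OF x y] z fg])
  fix t c assume t: "t \<in> carrier (T x y)" and c: "c \<in> carrier z"
  note lin = partial_tensor_left[OF T_Obj[OF x y] z _ c]
  have "mk (T x y) (\<lambda>t. app f (p (T x y) z t c)) w = mk (T x y) (\<lambda>t. app g (p (T x y) z t c)) w"
    using eq c by (intro p_ext[OF x y lin[OF fg(1)] lin[OF fg(2)]]) (simp add: p_closed[OF x y])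
  then show "app f (p (T x y) z t c) = app g (p (T x y) z t c)"
    using t by (metis app_mk)
qed

lemma p_ext3':
  assumes x: "x \<in> Obj C" and y: "y \<in> Obj C" and z: "z \<in> Obj C"
    and fg: "f \<in> arrows C (T x (T y z)) w" "g \<in> arrows C (T x (T y z)) w"
    and eq: "\<And>a b c. \<lbrakk>a \<in> carrier x; b \<in> carrier y; c \<in> carrier z\<rbrakk> \<Longrightarrow>
      app f (p x (T y z) a (p y z b c)) = app g (p x (T y z) a (p y z b c))"
  shows "f = g"
proof (rule p_ext[OF x T_Obj[OF y z] fg])
  fix a t assume a: "a \<in> carrier x" and t: "t \<in> carrier (T y z)"
  note lin = partial_tensor_right[OF x T_Obj[OF y z] _ a]
  have "mk (T y z) (\<lambda>t. app f (p x (T y z) a t)) w = mk (T y z) (\<lambda>t. app g (p x (T y z) a t)) w"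
    using eq a by (intro p_ext[OF y z lin[OF fg(1)] lin[OF fg(2)]]) (simp add: p_closed[OF y z])
  then show "app f (p x (T y z) a t) = app g (p x (T y z) a t)"
    using t by (metis app_mk)
qed

text \<open>In a factor \<open>S\<close> it suffices to test at \<open>u\<close>, since an arrow
  from \<open>S\<close> is determined there.\<close>

lemma unit_tensor_ext:
  assumes x: "x \<in> Obj C" and fg: "f \<in> arrows C (T S x) z" "g \<in> arrows C (T S x) z"
    and eq: "\<And>a. a \<in> carrier x \<Longrightarrow> app f (p S x u a) = app g (p S x u a)"
  shows "f = g"
proof (rule p_ext[OF S_Obj x fg])
  fix s a assume s: "s \<in> carrier S" and a: "a \<in> carrier x"
  note lin = partial_tensor_left[OF S_Obj x _ a]
  have "mk S (\<lambda>s. app f (p S x s a)) z = mk S (\<lambda>s. app g (p S x s a)) z"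
    using eq[OF a] u_closed by (intro unit_ext[OF lin[OF fg(1)] lin[OF fg(2)]]) simp
  then show "app f (p S x s a) = app g (p S x s a)" using s by (metis app_mk)
qed

lemma tensor_unit_ext:
  assumes x: "x \<in> Obj C" and fg: "f \<in> arrows C (T x S) z" "g \<in> arrows C (T x S) z"
    and eq: "\<And>a. a \<in> carrier x \<Longrightarrow> app f (p x S a u) = app g (p x S a u)"
  shows "f = g"
proof (rule p_ext[OF x S_Obj fg])
  fix a s assume s: "s \<in> carrier S" and a: "a \<in> carrier x"
  note lin = partial_tensor_right[OF x S_Obj _ a]
  have "mk S (\<lambda>s. app f (p x S a s)) z = mk S (\<lambda>s. app g (p x S a s)) z"
    using eq[OF a] u_closed by (intro unit_ext[OF lin[OF fg(1)] lin[OF fg(2)]]) simp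
  then show "app f (p x S a s) = app g (p x S a s)" using s by (metis app_mk)
qed

lemma tensor_unit_tensor_ext:
  assumes x: "x \<in> Obj C" and y: "y \<in> Obj C"
    and fg: "f \<in> arrows C (T (T x S) y) z" "g \<in> arrows C (T (T x S) y) z"
    and eq: "\<And>a b. \<lbrakk>a \<in> carrier x; b \<in> carrier y\<rbrakk> \<Longrightarrow>
      app f (p (T x S) y (p x S a u) b) = app g (p (T x S) y (p x S a u) b)"
  shows "f = g"
proof (rule p_ext[OF T_Obj[OF x S_Obj] y fg])
  fix t b assume t: "t \<in> carrier (T x S)" and b: "b \<in> carrier y"
  note lin = partial_tensor_left[OF T_Obj[OF x S_Obj] y _ b]
  have "mk (T x S) (\<lambda>t. app f (p (T x S) y t b)) z = mk (T x S) (\<lambda>t. app g (p (T x S) y t b)) z"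
    using eq b by (intro tensor_unit_ext[OF x lin[OF fg(1)] lin[OF fg(2)]]) (simp add: p_closed[OF x S_Obj] u_closed)
  then show "app f (p (T x S) y t b) = app g (p (T x S) y t b)" using t by (metis app_mk)
qed

lemma p_ext4:
  assumes w: "w \<in> Obj C" and x: "x \<in> Obj C" and y: "y \<in> Obj C" and z: "z \<in> Obj C"
    and fg: "f \<in> arrows C (T (T (T w x) y) z) v" "g \<in> arrows C (T (T (T w x) y) z) v"
    and eq: "\<And>d a b c. \<lbrakk>d \<in> carrier w; a \<in> carrier x; b \<in> carrier y; c \<in> carrier z\<rbrakk> \<Longrightarrow>
      app f (p (T (T w x) y) z (p (T w x) y (p w x d a) b) c) = app g (p (T (T w x) y) z (p (T w x) y (p w x d a) b) c)"
  shows "f = g"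
proof (rule p_ext[OF T_Obj[OF T_Obj[OF w x] y] z fg])
  fix t c assume t: "t \<in> carrier (T (T w x) y)" and c: "c \<in> carrier z"
  let ?X = "T (T w x) y"
  note lin = partial_tensor_left[OF T_Obj[OF T_Obj[OF w x] y] z _ c]
  have "mk ?X (\<lambda>t. app f (p ?X z t c)) v = mk ?X (\<lambda>t. app g (p ?X z t c)) v"
    using eq c by (intro p_ext3[OF w x y lin[OF fg(1)] lin[OF fg(2)]]) (simp add: p_closed w x y T_Obj)
  then show "app f (p ?X z t c) = app g (p ?X z t c)"
    using t by (metis app_mk)
qed

end

text \<open>All that uniqueness requires: a universal product on which the structure maps act by the
  usual formulas. Any equation between composites of them can then be evaluated on pure
  tensors.\<close>

locale standard_monoidal = tensor_system k U "tenO M" p "unit M" u + symmetric_monoidal "Mod k U" M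
  for k :: "('k, 'x) ring_scheme" and U :: "'u itself" and M :: "(('k, 'u) module, ('k, 'u) modarrow) monstr"
    and p u +
  assumes tenA_p: "\<lbrakk>f \<in> arrows C x x'; g \<in> arrows C y y'; a \<in> carrier x; b \<in> carrier y\<rbrakk> \<Longrightarrow>
      app (f \<otimes>a\<^bsub>M\<^esub> g) (p x y a b) = p x' y' (app f a) (app g b)"
    and lun_p: "\<lbrakk>x \<in> Obj C; a \<in> carrier x\<rbrakk> \<Longrightarrow> app (lun M x) (p (unit M) x u a) = a"
    and run_p: "\<lbrakk>x \<in> Obj C; a \<in> carrier x\<rbrakk> \<Longrightarrow> app (run M x) (p x (unit M) a u) = a"
    and ass_p: "\<lbrakk>x \<in> Obj C; y \<in> Obj C; z \<in> Obj C; a \<in> carrier x; b \<in> carrier y; c \<in> carrier z\<rbrakk> \<Longrightarrow>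
      app (ass M x y z) (p (tenO M x y) z (p x y a b) c) = p x (tenO M y z) a (p y z b c)"
    and swp_p: "\<lbrakk>x \<in> Obj C; y \<in> Obj C; a \<in> carrier x; b \<in> carrier y\<rbrakk> \<Longrightarrow>
      app (swp M x y) (p x y a b) = p y x b a"

lemma (in monoidal_modules_basis) standard_monoidal: "standard_monoidal k U M p u"
  using tensor_system symmetric_monoidal_axioms tenA_p lun_p run_p ass_p swp_p
  by (intro standard_monoidal.intro standard_monoidal_axioms.intro)

lemma standard_monoidal_comparison:
  assumes "standard_monoidal k U M p u" "standard_monoidal k U N q v" "x \<in> Obj (Mod k U)" "y \<in> Obj (Mod k U)"
  shows "\<exists>f \<in> arrows (Mod k U) (tenO M x y) (tenO N x y).
    \<forall>a \<in> carrier x. \<forall>b \<in> carrier y. app f (p x y a b) = q x y a b"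
proof -
  interpret M: standard_monoidal k U M p u by fact
  interpret N: standard_monoidal k U N q v by fact
  show ?thesis by (rule M.p_lift[OF assms(3,4) N.T_Obj[OF assms(3,4)] N.p_bilinear[OF assms(3,4)]])
qed

text \<open>The identity functor is made monoidal by the unique comparison matching the two
  products. Each coherence equation starts at a tensor product of \<open>N\<close> and holds since
  both sides agree on pure tensors.\<close>

lemma standard_monoidal_equivalent:
  fixes k :: "('k, 'x) ring_scheme" and U :: "'u itself"
  assumes "standard_monoidal k U M p u" "standard_monoidal k U N q v"
  shows "symmetric_monoidally_equivalent (Mod k U) M N"
proof -
  interpret M: standard_monoidal k U M p u by fact
  interpret N: standard_monoidal k U N q v by fact
  let ?C = "Mod k U"
  \<comment> \<open>The comparison runs from the product of \<open>N\<close> to that of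
    \<open>M\<close>, as required for the identity regarded as a functor from \<open>M\<close> to
    \<open>N\<close>.\<close>
  obtain \<mu> where \<mu>: "\<And>x y. \<lbrakk>x \<in> Obj ?C; y \<in> Obj ?C\<rbrakk> \<Longrightarrow> \<mu> x y \<in> arrows ?C (tenO N x y) (tenO M x y)"
    and \<mu>_q: "\<And>x y a b. \<lbrakk>x \<in> Obj ?C; y \<in> Obj ?C; a \<in> carrier x; b \<in> carrier y\<rbrakk> \<Longrightarrow> app (\<mu> x y) (q x y a b) = p x y a b"
    using standard_monoidal_comparison[OF assms(2,1)] by metis
  have \<mu>_iso: "is_iso ?C (tenO N x y) (tenO M x y) (\<mu> x y)" if xy: "x \<in> Obj ?C" "y \<in> Obj ?C" for x y
  proof -
    obtain \<nu> where \<nu>: "\<nu> \<in> arrows ?C (tenO M x y) (tenO N x y)"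
      "\<And>a b. \<lbrakk>a \<in> carrier x; b \<in> carrier y\<rbrakk> \<Longrightarrow> app \<nu> (p x y a b) = q x y a b"
      using standard_monoidal_comparison[OF assms xy] by metis
    have "\<nu> \<cdot>\<^bsub>?C\<^esub> \<mu> x y = Idt ?C (tenO N x y)"
      using xy \<nu> \<mu> \<mu>_q
      by (intro N.p_ext[OF xy M.Cmp_in M.Idt_in]) (auto simp: N.T_Obj N.p_closed M.app_comp[OF \<mu>[OF xy]])
    moreover have "\<mu> x y \<cdot>\<^bsub>?C\<^esub> \<nu> = Idt ?C (tenO M x y)"
      using xy \<nu> \<mu> \<mu>_q
      by (intro M.p_ext[OF xy M.Cmp_in M.Idt_in]) (auto simp: M.T_Obj M.p_closed M.app_comp[OF \<nu>(1)])
    ultimately show ?thesis using \<mu>[OF xy] \<nu>(1) by (auto simp: is_iso_def)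
  qed
  \<comment> \<open>Generators must match: the formulas for the unitors refer to \<open>v\<close> in
    \<open>N\<close> and to \<open>u\<close> in \<open>M\<close>.\<close>
  obtain \<epsilon> where \<epsilon>: "\<epsilon> \<in> arrows ?C (unit N) (unit M)" "app \<epsilon> v = u"
    using N.unit_lift[OF M.S_Obj M.u_closed] by auto
  have \<epsilon>_iso: "is_iso ?C (unit N) (unit M) \<epsilon>"
  proof -
    obtain \<delta> where \<delta>: "\<delta> \<in> arrows ?C (unit M) (unit N)" "app \<delta> u = v"
      using M.unit_lift[OF N.S_Obj N.u_closed] by auto
    have "\<delta> \<cdot>\<^bsub>?C\<^esub> \<epsilon> = Idt ?C (unit N)"
      using \<epsilon> \<delta> N.u_closed by (intro N.unit_ext[OF M.Cmp_in M.Idt_in]) (auto simp: N.S_Obj M.app_comp[OF \<epsilon>(1)])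
    moreover have "\<epsilon> \<cdot>\<^bsub>?C\<^esub> \<delta> = Idt ?C (unit M)"
      using \<epsilon> \<delta> M.u_closed by (intro M.unit_ext[OF M.Cmp_in M.Idt_in]) (auto simp: M.S_Obj M.app_comp[OF \<delta>(1)])
    ultimately show ?thesis using \<epsilon> \<delta> by (auto simp: is_iso_def)
  qed
  have isos: "swp M x y \<in> arrows ?C (tenO M x y) (tenO M y x)" "swp N x y \<in> arrows ?C (tenO N x y) (tenO N y x)"
    "lun M x \<in> arrows ?C (tenO M (unit M) x) x" "lun N x \<in> arrows ?C (tenO N (unit N) x) x"
    "run M x \<in> arrows ?C (tenO M x (unit M)) x" "run N x \<in> arrows ?C (tenO N x (unit N)) x"
    "z \<in> Obj ?C \<Longrightarrow> ass M x y z \<in> arrows ?C (tenO M (tenO M x y) z) (tenO M x (tenO M y z))"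
    "z \<in> Obj ?C \<Longrightarrow> ass N x y z \<in> arrows ?C (tenO N (tenO N x y) z) (tenO N x (tenO N y z))"
    if "x \<in> Obj ?C" "y \<in> Obj ?C" for x y z
    using M.swp_iso N.swp_iso M.lun_iso N.lun_iso M.run_iso N.run_iso M.ass_iso N.ass_iso that M.iso_arrow
    by metis+
  have "symmetric_monoidal_functor ?C M ?C N id_ftor \<epsilon> \<mu>"
  proof (intro symmetric_monoidal_functor.intro symmetric_monoidal_functor_axioms.intro,
      unfold id_ftor_def ftor.select_convs)
    show "symmetric_monoidal ?C M" "symmetric_monoidal ?C N"
      by (rule M.symmetric_monoidal_axioms N.symmetric_monoidal_axioms)+
    show "is_functor ?C ?C \<lparr>FO = \<lambda>x. x, FA = \<lambda>f. f\<rparr>" by (simp add: is_functor_def)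
    show "\<mu> x' y' \<cdot>\<^bsub>?C\<^esub> (f \<otimes>a\<^bsub>N\<^esub> g) = (f \<otimes>a\<^bsub>M\<^esub> g) \<cdot>\<^bsub>?C\<^esub> \<mu> x y"
      if f: "f \<in> arrows ?C x x'" and g: "g \<in> arrows ?C y y'" for f g x x' y y'
    proof -
      note O = M.arrow_Obj[OF f] M.arrow_Obj[OF g]
      show ?thesis
        by (rule N.p_ext[OF O(1,3) M.Cmp_in[OF N.tenA_arrow[OF f g] \<mu>[OF O(2,4)]] M.Cmp_in[OF \<mu>[OF O(1,3)] M.tenA_arrow[OF f g]]])
          (simp add: O N.p_closed M.app_comp[OF \<mu>[OF O(1,3)]] M.app_comp[OF N.tenA_arrow[OF f g]]
            \<mu>_q M.tenA_p[OF f g] N.tenA_p[OF f g] M.app_closed[OF f] M.app_closed[OF g])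
    qed
    show "\<mu> x (tenO M y z) \<cdot>\<^bsub>?C\<^esub> (Idt ?C x \<otimes>a\<^bsub>N\<^esub> \<mu> y z) \<cdot>\<^bsub>?C\<^esub> ass N x y z
        = ass M x y z \<cdot>\<^bsub>?C\<^esub> \<mu> (tenO M x y) z \<cdot>\<^bsub>?C\<^esub> (\<mu> x y \<otimes>a\<^bsub>N\<^esub> Idt ?C z)"
      if O: "x \<in> Obj ?C" "y \<in> Obj ?C" "z \<in> Obj ?C" for x y z
    proof -
      note a1 = isos(8)[OF O] and a2 = N.tenA_arrow[OF M.Idt_in[OF O(1)] \<mu>[OF O(2,3)]]
        and a3 = \<mu>[OF O(1) M.T_Obj[OF O(2,3)]]
        and b1 = N.tenA_arrow[OF \<mu>[OF O(1,2)] M.Idt_in[OF O(3)]] and b2 = \<mu>[OF M.T_Obj[OF O(1,2)] O(3)]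
        and b3 = isos(7)[OF O]
      show ?thesis
        by (rule N.p_ext3[OF O M.Cmp_in[OF M.Cmp_in[OF a1 a2] a3] M.Cmp_in[OF M.Cmp_in[OF b1 b2] b3]])
          (simp add: O N.T_Obj M.T_Obj N.p_closed M.p_closed M.app_comp[OF M.Cmp_in[OF a1 a2]] M.app_comp[OF a1]
            M.app_comp[OF M.Cmp_in[OF b1 b2]] M.app_comp[OF b1] N.ass_p M.ass_p \<mu>_q
            N.tenA_p[OF M.Idt_in \<mu>] N.tenA_p[OF \<mu> M.Idt_in])
    qed
    show "lun N x = lun M x \<cdot>\<^bsub>?C\<^esub> \<mu> (unit M) x \<cdot>\<^bsub>?C\<^esub> (\<epsilon> \<otimes>a\<^bsub>N\<^esub> Idt ?C x)" if x: "x \<in> Obj ?C" for x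
    proof -
      note b1 = N.tenA_arrow[OF \<epsilon>(1) M.Idt_in[OF x]] and b2 = \<mu>[OF M.S_Obj x] and b3 = isos(3)[OF x x]
      show ?thesis
        by (rule N.unit_tensor_ext[OF x isos(4)[OF x x] M.Cmp_in[OF M.Cmp_in[OF b1 b2] b3]])
          (simp add: x N.S_Obj M.S_Obj N.u_closed M.u_closed N.p_closed M.app_comp[OF M.Cmp_in[OF b1 b2]] M.app_comp[OF b1]
            N.lun_p M.lun_p \<mu>_q N.tenA_p[OF \<epsilon>(1) M.Idt_in] \<epsilon>(2))
    qed
    show "run N x = run M x \<cdot>\<^bsub>?C\<^esub> \<mu> x (unit M) \<cdot>\<^bsub>?C\<^esub> (Idt ?C x \<otimes>a\<^bsub>N\<^esub> \<epsilon>)" if x: "x \<in> Obj ?C" for x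
    proof -
      note b1 = N.tenA_arrow[OF M.Idt_in[OF x] \<epsilon>(1)] and b2 = \<mu>[OF x M.S_Obj] and b3 = isos(5)[OF x x]
      show ?thesis
        by (rule N.tensor_unit_ext[OF x isos(6)[OF x x] M.Cmp_in[OF M.Cmp_in[OF b1 b2] b3]])
          (simp add: x N.S_Obj M.S_Obj N.u_closed M.u_closed N.p_closed M.app_comp[OF M.Cmp_in[OF b1 b2]] M.app_comp[OF b1]
            N.run_p M.run_p \<mu>_q N.tenA_p[OF M.Idt_in \<epsilon>(1)] \<epsilon>(2))
    qed
    show "swp M x y \<cdot>\<^bsub>?C\<^esub> \<mu> x y = \<mu> y x \<cdot>\<^bsub>?C\<^esub> swp N x y" if O: "x \<in> Obj ?C" "y \<in> Obj ?C" for x y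
      by (rule N.p_ext[OF O M.Cmp_in[OF \<mu>[OF O] isos(1)[OF O]] M.Cmp_in[OF isos(2)[OF O] \<mu>[OF O(2,1)]]])
        (simp add: O N.p_closed M.app_comp[OF \<mu>[OF O]] M.app_comp[OF isos(2)[OF O]] \<mu>_q M.swp_p N.swp_p)
  qed (use \<mu>_iso \<epsilon>_iso in auto)
  moreover have "is_additive ?C ?C id_ftor" by (simp add: is_additive_def id_ftor_def)
  moreover have "is_equivalence ?C ?C id_ftor"
  proof -
    have "is_functor ?C ?C id_ftor" by (simp add: is_functor_def id_ftor_def)
    moreover have "natural_iso ?C ?C (comp_ftor id_ftor id_ftor) id_ftor (Idt ?C)"
      using M.Idt_in
      by (auto simp: natural_iso_def comp_ftor_def id_ftor_def M.Cmp_Idt M.Idt_Cmp intro!: M.iso_of_inverse[OF M.Idt_in M.Idt_in])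
    ultimately show ?thesis unfolding is_equivalence_def by blast
  qed
  ultimately show ?thesis unfolding symmetric_monoidally_equivalent_def by blast
qed

section \<open>The closed structure given by a universal tensor product\<close>

lemma is_bilinear_comp:
  assumes "is_bilinear R M' N' P \<beta>" "is_linear R M M' f" "is_linear R N N' g"
  shows "is_bilinear R M N P (\<lambda>a b. \<beta> (f a) (g b))"
  using assms unfolding is_bilinear_def
  by (auto intro!: is_linear_comp[of R N N' g P] is_linear_comp[of R M M' f P "\<lambda>a. \<beta> a _"]
      simp: linear_closed[OF assms(2)] linear_closed[OF assms(3)])

lemma is_bilinear_post:
  assumes "is_bilinear R M N P \<beta>" "is_linear R P Q h"
  shows "is_bilinear R M N Q (\<lambda>a b. h (\<beta> a b))"
  using assms unfolding is_bilinear_def by (auto intro: is_linear_comp)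

lemma is_linear_id: "is_linear R M M (\<lambda>x. x)"
  by (auto intro: is_linearI)

text \<open>Commutativity makes multiples of linear maps linear, and closure under power sets makes
  the set of linear maps between two modules small. Both are used for the internal hom.\<close>

locale commutative_tensor_system = tensor_system k U T p S u + cring k
  for k :: "('k, 'x) ring_scheme" and U :: "'u itself" and T p S u +
  assumes universe: "universe U"
begin

section \<open>Structure maps obtained from the universal property\<close>

definition lift :: "('k, 'u) module \<Rightarrow> ('k, 'u) module \<Rightarrow> ('k, 'u) module \<Rightarrow> ('u \<Rightarrow> 'u \<Rightarrow> 'u) \<Rightarrow> ('k, 'u) modarrow" where
  "lift x y z \<beta> = (SOME f. f \<in> arrows C (T x y) z \<and> (\<forall>a \<in> carrier x. \<forall>b \<in> carrier y. app f (p x y a b) = \<beta> a b))"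

lemma
  assumes "is_bilinear k x y z \<beta>" "x \<in> Obj C" "y \<in> Obj C" "z \<in> Obj C"
  shows lift_arrow: "lift x y z \<beta> \<in> arrows C (T x y) z"
    and lift_p: "\<lbrakk>a \<in> carrier x; b \<in> carrier y\<rbrakk> \<Longrightarrow> app (lift x y z \<beta>) (p x y a b) = \<beta> a b"
  using someI_ex[of "\<lambda>f. f \<in> arrows C (T x y) z \<and> (\<forall>a \<in> carrier x. \<forall>b \<in> carrier y. app f (p x y a b) = \<beta> a b)"]
    p_lift[OF assms(2,3,4,1)] unfolding lift_def by blast+

definition unit_map :: "('k, 'u) module \<Rightarrow> 'u \<Rightarrow> ('k, 'u) modarrow" where
  "unit_map z c = (SOME f. f \<in> arrows C S z \<and> app f u = c)"

lemma
  assumes "z \<in> Obj C" "c \<in> carrier z"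
  shows unit_map_arrow: "unit_map z c \<in> arrows C S z" and unit_map_u: "app (unit_map z c) u = c"
  using someI_ex[of "\<lambda>f. f \<in> arrows C S z \<and> app f u = c"] unit_lift[OF assms]
  unfolding unit_map_def by blast+

lemma scaled_arrow:
  assumes f: "f \<in> arrows C x y" and c: "c \<in> carrier k"
  shows "mk x (\<lambda>a. c \<odot>\<^bsub>y\<^esub> app f a) y \<in> arrows C x y"
proof -
  interpret y: left_module k y using f arrow_cod by (auto simp: Obj_iff)
  show ?thesis
    using f c arrow_Obj[OF f]
    by (intro mk_arrow is_linearI)
      (auto simp: app_closed[OF f] app_add[OF f] app_smult[OF f] y.smult_closed y.smult_r_distr y.smult_assoc[symmetric] m_comm)
qed

text \<open>This is the pairing (c u, a) -> c a, from which the left unitor is built. Linearity in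
  \<open>a\<close> follows by testing arrows from \<open>S\<close> at \<open>u\<close>.\<close>

lemma unit_map_bilinear:
  assumes x: "x \<in> Obj C"
  shows "is_bilinear k S x x (\<lambda>s a. app (unit_map x a) s)"
proof (rule is_bilinearI)
  interpret x: left_module k x using x by (simp add: Obj_iff)
  note U = unit_map_arrow[OF x] unit_map_u[OF x]
  show "app (unit_map x a) s \<in> carrier x" if "s \<in> carrier S" "a \<in> carrier x" for s a
    using app_closed[OF U(1)] that by blast
  show "app (unit_map x a) (s \<oplus>\<^bsub>S\<^esub> s') = app (unit_map x a) s \<oplus>\<^bsub>x\<^esub> app (unit_map x a) s'"
    if "s \<in> carrier S" "s' \<in> carrier S" "a \<in> carrier x" for s s' a
    using app_add[OF U(1)] that by blast
  show "app (unit_map x a) (c \<odot>\<^bsub>S\<^esub> s) = c \<odot>\<^bsub>x\<^esub> app (unit_map x a) s"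
    if "c \<in> carrier k" "s \<in> carrier S" "a \<in> carrier x" for c s a
    using app_smult[OF U(1)] that by blast
  show "app (unit_map x (a \<oplus>\<^bsub>x\<^esub> a')) s = app (unit_map x a) s \<oplus>\<^bsub>x\<^esub> app (unit_map x a') s"
    if "s \<in> carrier S" "a \<in> carrier x" "a' \<in> carrier x" for s a a'
  proof -
    have "unit_map x (a \<oplus>\<^bsub>x\<^esub> a') = Pls C (unit_map x a) (unit_map x a')"
      using that U u_closed by (intro unit_ext[of _ x] Pls_in) (auto simp: app_Pls[of _ S x])
    then show ?thesis using that U by (simp add: app_Pls[of _ S x])
  qed
  show "app (unit_map x (c \<odot>\<^bsub>x\<^esub> a)) s = c \<odot>\<^bsub>x\<^esub> app (unit_map x a) s"
    if "c \<in> carrier k" "s \<in> carrier S" "a \<in> carrier x" for c s a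
  proof -
    have "unit_map x (c \<odot>\<^bsub>x\<^esub> a) = mk S (\<lambda>s. c \<odot>\<^bsub>x\<^esub> app (unit_map x a) s) x"
      using that U u_closed by (intro unit_ext[of _ x] scaled_arrow) (auto simp: x.smult_closed)
    then show ?thesis using that by simp
  qed
qed

definition tensor_map :: "('k, 'u) modarrow \<Rightarrow> ('k, 'u) modarrow \<Rightarrow> ('k, 'u) modarrow" where
  "tensor_map f g = lift (Dom C f) (Dom C g) (T (Cod C f) (Cod C g)) (\<lambda>a b. p (Cod C f) (Cod C g) (app f a) (app g b))"

lemma
  assumes f: "f \<in> arrows C x x'" and g: "g \<in> arrows C y y'"
  shows tensor_map_arrow: "tensor_map f g \<in> arrows C (T x y) (T x' y')"
    and tensor_map_p: "\<lbrakk>a \<in> carrier x; b \<in> carrier y\<rbrakk> \<Longrightarrow> app (tensor_map f g) (p x y a b) = p x' y' (app f a) (app g b)"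
proof -
  note O = arrow_Obj[OF f] arrow_Obj[OF g]
  have "is_bilinear k x y (T x' y') (\<lambda>a b. p x' y' (app f a) (app g b))"
    by (rule is_bilinear_comp[OF p_bilinear[OF O(2,4)] app_linear[OF f] app_linear[OF g]])
  moreover have "tensor_map f g = lift x y (T x' y') (\<lambda>a b. p x' y' (app f a) (app g b))"
    using f g by (simp add: tensor_map_def arrows_def)
  ultimately show "tensor_map f g \<in> arrows C (T x y) (T x' y')"
    "\<lbrakk>a \<in> carrier x; b \<in> carrier y\<rbrakk> \<Longrightarrow> app (tensor_map f g) (p x y a b) = p x' y' (app f a) (app g b)"
    using O T_Obj by (simp_all add: lift_arrow lift_p)
qed

definition lunit :: "('k, 'u) module \<Rightarrow> ('k, 'u) modarrow" where
  "lunit x = lift S x x (\<lambda>s a. app (unit_map x a) s)"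

definition swap :: "('k, 'u) module \<Rightarrow> ('k, 'u) module \<Rightarrow> ('k, 'u) modarrow" where
  "swap x y = lift x y (T y x) (\<lambda>a b. p y x b a)"

text \<open>Going through the symmetry lets the right unitor inherit invertibility from
  \<open>lunit\<close> and \<open>swap\<close>.\<close>

definition runit :: "('k, 'u) module \<Rightarrow> ('k, 'u) modarrow" where
  "runit x = lunit x \<Zsemi> swap x S"

text \<open>Two successive extensions: for fixed \<open>c\<close> the map (a, b) -> a \<otimes> (b
  \<otimes> c) is extended to \<open>T x y\<close>, and the result, now bilinear in \<open>t\<close>
  and \<open>c\<close>, is extended once more.\<close>

definition assoc :: "('k, 'u) module \<Rightarrow> ('k, 'u) module \<Rightarrow> ('k, 'u) module \<Rightarrow> ('k, 'u) modarrow" where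
  "assoc x y z = lift (T x y) z (T x (T y z))
     (\<lambda>t c. app (lift x y (T x (T y z)) (\<lambda>a b. p x (T y z) a (p y z b c))) t)"

lemma
  assumes x: "x \<in> Obj C"
  shows lunit_arrow: "lunit x \<in> arrows C (T S x) x"
    and lunit_p: "a \<in> carrier x \<Longrightarrow> app (lunit x) (p S x u a) = a"
  using lift_arrow[OF unit_map_bilinear[OF x] S_Obj x x] lift_p[OF unit_map_bilinear[OF x] S_Obj x x u_closed]
    unit_map_u[OF x] by (auto simp: lunit_def)

lemma
  assumes x: "x \<in> Obj C" and y: "y \<in> Obj C"
  shows swap_arrow: "swap x y \<in> arrows C (T x y) (T y x)"
    and swap_p: "\<lbrakk>a \<in> carrier x; b \<in> carrier y\<rbrakk> \<Longrightarrow> app (swap x y) (p x y a b) = p y x b a"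
proof -
  have "is_bilinear k x y (T y x) (\<lambda>a b. p y x b a)"
    using p_bilinear[OF y x] by (auto simp: is_bilinear_def)
  then show "swap x y \<in> arrows C (T x y) (T y x)"
    "\<lbrakk>a \<in> carrier x; b \<in> carrier y\<rbrakk> \<Longrightarrow> app (swap x y) (p x y a b) = p y x b a"
    using x y T_Obj by (simp_all add: lift_arrow lift_p swap_def)
qed

lemma
  assumes x: "x \<in> Obj C"
  shows runit_arrow: "runit x \<in> arrows C (T x S) x"
    and runit_p: "a \<in> carrier x \<Longrightarrow> app (runit x) (p x S a u) = a"
  using Cmp_in[OF swap_arrow[OF x S_Obj] lunit_arrow[OF x]] x u_closed S_Obj
  by (auto simp: runit_def app_comp[OF swap_arrow[OF x S_Obj]] p_closed swap_p lunit_p)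

lemma
  assumes x: "x \<in> Obj C" and y: "y \<in> Obj C" and z: "z \<in> Obj C"
  shows assoc_arrow: "assoc x y z \<in> arrows C (T (T x y) z) (T x (T y z))"
    and assoc_p: "\<lbrakk>a \<in> carrier x; b \<in> carrier y; c \<in> carrier z\<rbrakk> \<Longrightarrow>
      app (assoc x y z) (p (T x y) z (p x y a b) c) = p x (T y z) a (p y z b c)"
proof -
  note O = T_Obj[OF x y] T_Obj[OF y z] T_Obj[OF x T_Obj[OF y z]]
  let ?R = "T x (T y z)"
  interpret R: left_module k ?R using O by (simp add: Obj_iff)
  interpret z: left_module k z using z by (simp add: Obj_iff)
  define \<phi> where "\<phi> c = lift x y ?R (\<lambda>a b. p x (T y z) a (p y z b c))" for c
  have bil: "is_bilinear k x y ?R (\<lambda>a b. p x (T y z) a (p y z b c))" if "c \<in> carrier z" for c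
    using p_bilinear[OF y z] that
    by (intro is_bilinear_comp[OF p_bilinear[OF x O(2)] is_linear_id]) (auto simp: is_bilinear_def)
  have \<phi>: "\<phi> c \<in> arrows C (T x y) ?R" if "c \<in> carrier z" for c
    unfolding \<phi>_def by (rule lift_arrow[OF bil[OF that] x y O(3)])
  have \<phi>_p: "app (\<phi> c) (p x y a b) = p x (T y z) a (p y z b c)"
    if "a \<in> carrier x" "b \<in> carrier y" "c \<in> carrier z" for a b c
    unfolding \<phi>_def by (rule lift_p[OF bil[OF that(3)] x y O(3) that(1,2)])
  \<comment> \<open>Linearity in \<open>t\<close> holds because each \<open>\<phi> c\<close> is an
    arrow. Linearity in \<open>c\<close> is an equation between arrows out of \<open>T x y\<close>,
    checked on pure tensors.\<close>
  have "is_bilinear k (T x y) z ?R (\<lambda>t c. app (\<phi> c) t)"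
  proof (rule is_bilinearI)
    show "app (\<phi> c) t \<in> carrier ?R" if "t \<in> carrier (T x y)" "c \<in> carrier z" for t c
      using app_closed[OF \<phi>] that by blast
    show "app (\<phi> c) (t \<oplus>\<^bsub>T x y\<^esub> t') = app (\<phi> c) t \<oplus>\<^bsub>?R\<^esub> app (\<phi> c) t'"
      if "t \<in> carrier (T x y)" "t' \<in> carrier (T x y)" "c \<in> carrier z" for t t' c
      using app_add[OF \<phi>] that by blast
    show "app (\<phi> c) (d \<odot>\<^bsub>T x y\<^esub> t) = d \<odot>\<^bsub>?R\<^esub> app (\<phi> c) t"
      if "d \<in> carrier k" "t \<in> carrier (T x y)" "c \<in> carrier z" for d t c
      using app_smult[OF \<phi>] that by blast
    show "app (\<phi> (c \<oplus>\<^bsub>z\<^esub> c')) t = app (\<phi> c) t \<oplus>\<^bsub>?R\<^esub> app (\<phi> c') t"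
      if t: "t \<in> carrier (T x y)" and c: "c \<in> carrier z" "c' \<in> carrier z" for t c c'
    proof -
      have "\<phi> (c \<oplus>\<^bsub>z\<^esub> c') = Pls C (\<phi> c) (\<phi> c')"
        using c by (intro p_ext[OF x y \<phi> Pls_in[OF \<phi> \<phi>]])
          (auto simp: app_Pls[OF \<phi> \<phi>] \<phi>_p p_closed[OF x y] p_closed[OF y z] bilinear_add_right[OF p_bilinear[OF y z]]
            bilinear_add_right[OF p_bilinear[OF x O(2)]])
      then show ?thesis using app_Pls[OF \<phi>[OF c(1)] \<phi>[OF c(2)] t] by simp
    qed
    show "app (\<phi> (d \<odot>\<^bsub>z\<^esub> c)) t = d \<odot>\<^bsub>?R\<^esub> app (\<phi> c) t"
      if d: "d \<in> carrier k" and t: "t \<in> carrier (T x y)" and c: "c \<in> carrier z" for d t c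
    proof -
      have "\<phi> (d \<odot>\<^bsub>z\<^esub> c) = mk (T x y) (\<lambda>t. d \<odot>\<^bsub>?R\<^esub> app (\<phi> c) t) ?R"
        using c d by (intro p_ext[OF x y \<phi> scaled_arrow[OF \<phi>]])
          (auto simp: \<phi>_p p_closed[OF x y] p_closed[OF y z] bilinear_smult_right[OF p_bilinear[OF y z]]
            bilinear_smult_right[OF p_bilinear[OF x O(2)]] z.smult_closed)
      then show ?thesis using t by simp
    qed
  qed
  then have *: "is_bilinear k (T x y) z ?R (\<lambda>t c. app (lift x y ?R (\<lambda>a b. p x (T y z) a (p y z b c))) t)"
    unfolding \<phi>_def .
  show "assoc x y z \<in> arrows C (T (T x y) z) ?R"
    unfolding assoc_def by (rule lift_arrow[OF * O(1) z O(3)])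
  show "app (assoc x y z) (p (T x y) z (p x y a b) c) = p x (T y z) a (p y z b c)"
    if "a \<in> carrier x" "b \<in> carrier y" "c \<in> carrier z"
    using lift_p[OF * O(1) z O(3) p_closed[OF x y that(1,2)] that(3)] \<phi>_p[OF that]
    by (simp add: assoc_def \<phi>_def)
qed

definition tensor_structure :: "(('k, 'u) module, ('k, 'u) modarrow) monstr" where
  "tensor_structure = \<lparr>tenO = T, tenA = tensor_map, unit = S, ass = assoc, lun = lunit, run = runit, swp = swap\<rparr>"

lemma tensor_structure_simps [simp]:
  "tenO tensor_structure = T" "tenA tensor_structure = tensor_map" "unit tensor_structure = S" "ass tensor_structure = assoc"
  "lun tensor_structure = lunit" "run tensor_structure = runit" "swp tensor_structure = swap"
  by (simp_all add: tensor_structure_def)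

lemma swap_swap:
  assumes "x \<in> Obj C" "y \<in> Obj C"
  shows "swap y x \<Zsemi> swap x y = Idt C (T x y)"
  by (rule p_ext[OF assms Cmp_in[OF swap_arrow[OF assms] swap_arrow[OF assms(2,1)]] Idt_in[OF T_Obj[OF assms]]])
    (simp add: app_comp[OF swap_arrow[OF assms]] p_closed swap_p assms)

lemma swap_iso: "\<lbrakk>x \<in> Obj C; y \<in> Obj C\<rbrakk> \<Longrightarrow> is_iso C (T x y) (T y x) (swap x y)"
  unfolding is_iso_def using swap_arrow swap_swap by blast

lemma lunit_iso:
  assumes x: "x \<in> Obj C"
  shows "is_iso C (T S x) x (lunit x)"
proof -
  \<comment> \<open>The inverse sends \<open>a\<close> to u \<otimes> a.\<close>
  define l where "l = mk x (p S x u) (T S x)"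
  have l: "l \<in> arrows C x (T S x)"
    unfolding l_def using p_bilinear[OF S_Obj x] u_closed
    by (intro mk_arrow x T_Obj S_Obj) (auto simp: is_bilinear_def)
  have "lunit x \<Zsemi> l = Idt C x"
    by (rule arrow_eqI[OF Cmp_in[OF l lunit_arrow[OF x]] Idt_in[OF x]]) (simp add: app_comp[OF l], simp add: l_def lunit_p x)
  moreover have "l \<Zsemi> lunit x = Idt C (T S x)"
    by (rule unit_tensor_ext[OF x Cmp_in[OF lunit_arrow[OF x] l] Idt_in[OF T_Obj[OF S_Obj x]]])
      (simp add: app_comp[OF lunit_arrow[OF x]] p_closed[OF S_Obj x u_closed] lunit_p x, simp add: l_def)
  ultimately show ?thesis unfolding is_iso_def using l lunit_arrow[OF x] by blast
qed

lemma iso_comp: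
  assumes "is_iso C x y f" "is_iso C y z g"
  shows "is_iso C x z (g \<Zsemi> f)"
proof -
  obtain f' where f': "f \<in> arrows C x y" "f' \<in> arrows C y x"
    "\<And>a. a \<in> carrier x \<Longrightarrow> app f' (app f a) = a" "\<And>b. b \<in> carrier y \<Longrightarrow> app f (app f' b) = b"
    using iso_inverse[OF assms(1)] by metis
  obtain g' where g': "g \<in> arrows C y z" "g' \<in> arrows C z y"
    "\<And>a. a \<in> carrier y \<Longrightarrow> app g' (app g a) = a" "\<And>b. b \<in> carrier z \<Longrightarrow> app g (app g' b) = b"
    using iso_inverse[OF assms(2)] by metis
  show ?thesis
    using f' g' by (intro iso_of_inverse[OF Cmp_in[OF f'(1) g'(1)] Cmp_in[OF g'(2) f'(2)]])
      (auto simp: app_comp[OF f'(1)] app_comp[OF g'(2)] app_closed[OF f'(1)] app_closed[OF g'(2)] app_closed[OF g'(1)] app_closed[OF f'(2)])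
qed

lemma assoc_iso:
  assumes x: "x \<in> Obj C" and y: "y \<in> Obj C" and z: "z \<in> Obj C"
  shows "is_iso C (T (T x y) z) (T x (T y z)) (assoc x y z)"
proof -
  note O = T_Obj[OF x y] T_Obj[OF y z] T_Obj[OF z x]
  note a1 = swap_arrow[OF x O(2)] and a2 = assoc_arrow[OF y z x] and a3 = swap_arrow[OF y O(3)]
    and a4 = assoc_arrow[OF z x y] and a5 = swap_arrow[OF z O(1)]
  note c2 = Cmp_in[OF a1 a2] note c3 = Cmp_in[OF c2 a3] note c4 = Cmp_in[OF c3 a4] note c5 = Cmp_in[OF c4 a5]
  \<comment> \<open>The inverse associator is composed from associators and symmetries, along x(yz)
    -> (yz)x -> y(zx) -> (zx)y -> z(xy) -> (xy)z.\<close>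
  define r where "r = swap z (T x y) \<Zsemi> (assoc z x y \<Zsemi> (swap y (T z x) \<Zsemi> (assoc y z x \<Zsemi> swap x (T y z))))"
  have r: "r \<in> arrows C (T x (T y z)) (T (T x y) z)" using c5 by (simp add: r_def)
  have r_p: "app r (p x (T y z) a (p y z b c)) = p (T x y) z (p x y a b) c"
    if "a \<in> carrier x" "b \<in> carrier y" "c \<in> carrier z" for a b c
    using that
    by (simp add: r_def app_comp[OF c4] app_comp[OF c3] app_comp[OF c2] app_comp[OF a1] p_closed x y z O swap_p assoc_p)
  note a = assoc_arrow[OF x y z]
  have "r \<Zsemi> assoc x y z = Idt C (T (T x y) z)"
    by (rule p_ext3[OF x y z Cmp_in[OF a r] Idt_in[OF T_Obj[OF O(1) z]]])
      (simp add: app_comp[OF a] r_p p_closed x y z O assoc_p)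
  moreover have "assoc x y z \<Zsemi> r = Idt C (T x (T y z))"
    by (rule p_ext3'[OF x y z Cmp_in[OF r a] Idt_in[OF T_Obj[OF x O(2)]]])
      (simp add: app_comp[OF r] r_p p_closed x y z O assoc_p)
  ultimately show ?thesis unfolding is_iso_def using a r by blast
qed

text \<open>Every axiom not already at hand compares two arrows out of a tensor product. The
  matching extensionality lemma reduces it to pure tensors, where both sides evaluate to the same
  element.\<close>

lemma symmetric_monoidal_structure: "symmetric_monoidal C tensor_structure"
proof (intro symmetric_monoidal.intro symmetric_monoidal_axioms.intro preadditive, unfold tensor_structure_simps)
  show "S \<in> Obj C" by (rule S_Obj)
  show "tensor_map (Idt C x) (Idt C y) = Idt C (T x y)" if O: "x \<in> Obj C" "y \<in> Obj C" for x y
    by (rule p_ext[OF O tensor_map_arrow[OF Idt_in[OF O(1)] Idt_in[OF O(2)]] Idt_in[OF T_Obj[OF O]]])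
      (simp add: tensor_map_p[OF Idt_in[OF O(1)] Idt_in[OF O(2)]] p_closed O)
  show "tensor_map (f' \<Zsemi> f) (g' \<Zsemi> g) = tensor_map f' g' \<Zsemi> tensor_map f g"
    if f: "f \<in> arrows C x x'" "f' \<in> arrows C x' x''" and g: "g \<in> arrows C y y'" "g' \<in> arrows C y' y''"
    for f f' g g' x x' x'' y y' y''
  proof -
    note O = arrow_Obj[OF f(1)] arrow_Obj[OF g(1)] and t = tensor_map_arrow[OF f(1) g(1)]
    show ?thesis
      by (rule p_ext[OF O(1,3) tensor_map_arrow[OF Cmp_in[OF f] Cmp_in[OF g]] Cmp_in[OF t tensor_map_arrow[OF f(2) g(2)]]])
        (simp add: app_comp[OF t] app_comp[OF f(1)] app_comp[OF g(1)] p_closed O tensor_map_p[OF Cmp_in[OF f] Cmp_in[OF g]]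
          tensor_map_p[OF f(1) g(1)] tensor_map_p[OF f(2) g(2)] app_closed[OF f(1)] app_closed[OF g(1)])
  qed
  show "assoc x' y' z' \<Zsemi> tensor_map (tensor_map f g) h = tensor_map f (tensor_map g h) \<Zsemi> assoc x y z"
    if f: "f \<in> arrows C x x'" and g: "g \<in> arrows C y y'" and h: "h \<in> arrows C z z'" for f g h x x' y y' z z'
  proof -
    note O = arrow_Obj[OF f] arrow_Obj[OF g] arrow_Obj[OF h]
    note fg = tensor_map_arrow[OF f g] and gh = tensor_map_arrow[OF g h]
    note l = tensor_map_arrow[OF fg h] and r = tensor_map_arrow[OF f gh] and a = assoc_arrow[OF O(1,3,5)]
    show ?thesis
      by (rule p_ext3[OF O(1,3,5) Cmp_in[OF l assoc_arrow[OF O(2,4,6)]] Cmp_in[OF a r]])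
        (simp add: app_comp[OF l] app_comp[OF a] p_closed T_Obj O assoc_p tensor_map_p[OF fg h] tensor_map_p[OF f g]
          tensor_map_p[OF f gh] tensor_map_p[OF g h] app_closed[OF f] app_closed[OF g] app_closed[OF h])
  qed
  show "is_iso C (T x S) x (runit x)" if "x \<in> Obj C" for x
    unfolding runit_def by (rule iso_comp[OF swap_iso[OF that S_Obj] lunit_iso[OF that]])
  show "lunit y \<Zsemi> tensor_map (Idt C S) f = f \<Zsemi> lunit x" if f: "f \<in> arrows C x y" for f x y
  proof -
    note O = arrow_Obj[OF f] and t = tensor_map_arrow[OF Idt_in[OF S_Obj] f]
    note l = lunit_arrow[OF O(1)]
    show ?thesis
      by (rule unit_tensor_ext[OF O(1) Cmp_in[OF t lunit_arrow[OF O(2)]] Cmp_in[OF l f]])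
        (simp add: app_comp[OF t] app_comp[OF l] p_closed S_Obj u_closed O lunit_p tensor_map_p[OF Idt_in[OF S_Obj] f] app_closed[OF f])
  qed
  show "runit y \<Zsemi> tensor_map f (Idt C S) = f \<Zsemi> runit x" if f: "f \<in> arrows C x y" for f x y
  proof -
    note O = arrow_Obj[OF f] and t = tensor_map_arrow[OF f Idt_in[OF S_Obj]]
    note l = runit_arrow[OF O(1)]
    show ?thesis
      by (rule tensor_unit_ext[OF O(1) Cmp_in[OF t runit_arrow[OF O(2)]] Cmp_in[OF l f]])
        (simp add: app_comp[OF t] app_comp[OF l] p_closed S_Obj u_closed O runit_p tensor_map_p[OF f Idt_in[OF S_Obj]] app_closed[OF f])
  qed
  show "swap x' y' \<Zsemi> tensor_map f g = tensor_map g f \<Zsemi> swap x y"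
    if f: "f \<in> arrows C x x'" and g: "g \<in> arrows C y y'" for f g x x' y y'
  proof -
    note O = arrow_Obj[OF f] arrow_Obj[OF g] and t = tensor_map_arrow[OF f g]
    note s = swap_arrow[OF O(1,3)]
    show ?thesis
      by (rule p_ext[OF O(1,3) Cmp_in[OF t swap_arrow[OF O(2,4)]] Cmp_in[OF s tensor_map_arrow[OF g f]]])
        (simp add: app_comp[OF t] app_comp[OF s] p_closed O swap_p tensor_map_p[OF f g] tensor_map_p[OF g f]
          app_closed[OF f] app_closed[OF g])
  qed
  show "tensor_map (Idt C w) (assoc x y z) \<Zsemi> assoc w (T x y) z \<Zsemi> tensor_map (assoc w x y) (Idt C z)
      = assoc w x (T y z) \<Zsemi> assoc (T w x) y z"
    if O: "w \<in> Obj C" "x \<in> Obj C" "y \<in> Obj C" "z \<in> Obj C" for w x y z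
  proof -
    note a = assoc_arrow[OF O(1-3)] assoc_arrow[OF O(2-4)]
    note t1 = tensor_map_arrow[OF a(1) Idt_in[OF O(4)]] and t2 = assoc_arrow[OF O(1) T_Obj[OF O(2,3)] O(4)]
      and t3 = tensor_map_arrow[OF Idt_in[OF O(1)] a(2)]
      and s1 = assoc_arrow[OF T_Obj[OF O(1,2)] O(3,4)] and s2 = assoc_arrow[OF O(1,2) T_Obj[OF O(3,4)]]
    show ?thesis
      by (rule p_ext4[OF O Cmp_in[OF Cmp_in[OF t1 t2] t3] Cmp_in[OF s1 s2]])
        (simp add: app_comp[OF Cmp_in[OF t1 t2]] app_comp[OF t1] app_comp[OF s1] p_closed T_Obj O assoc_p
          tensor_map_p[OF a(1) Idt_in[OF O(4)]] tensor_map_p[OF Idt_in[OF O(1)] a(2)])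
  qed
  show "tensor_map (Idt C x) (lunit y) \<Zsemi> assoc x S y = tensor_map (runit x) (Idt C y)"
    if O: "x \<in> Obj C" "y \<in> Obj C" for x y
  proof -
    note a = assoc_arrow[OF O(1) S_Obj O(2)] and l = lunit_arrow[OF O(2)] and r = runit_arrow[OF O(1)]
    show ?thesis
      by (rule tensor_unit_tensor_ext[OF O Cmp_in[OF a tensor_map_arrow[OF Idt_in[OF O(1)] l]] tensor_map_arrow[OF r Idt_in[OF O(2)]]])
        (simp add: app_comp[OF a] p_closed T_Obj O S_Obj u_closed assoc_p tensor_map_p[OF Idt_in[OF O(1)] l]
          tensor_map_p[OF r Idt_in[OF O(2)]] lunit_p runit_p)
  qed
  show "assoc y z x \<Zsemi> swap x (T y z) \<Zsemi> assoc x y z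
      = tensor_map (Idt C y) (swap x z) \<Zsemi> assoc y x z \<Zsemi> tensor_map (swap x y) (Idt C z)"
    if O: "x \<in> Obj C" "y \<in> Obj C" "z \<in> Obj C" for x y z
  proof -
    note a1 = assoc_arrow[OF O] and a2 = swap_arrow[OF O(1) T_Obj[OF O(2,3)]] and a3 = assoc_arrow[OF O(2,3,1)]
    note s = swap_arrow[OF O(1,2)] swap_arrow[OF O(1,3)]
    note b1 = tensor_map_arrow[OF s(1) Idt_in[OF O(3)]] and b2 = assoc_arrow[OF O(2,1,3)]
      and b3 = tensor_map_arrow[OF Idt_in[OF O(2)] s(2)]
    show ?thesis
      by (rule p_ext3[OF O Cmp_in[OF Cmp_in[OF a1 a2] a3] Cmp_in[OF Cmp_in[OF b1 b2] b3]])
        (simp add: app_comp[OF Cmp_in[OF a1 a2]] app_comp[OF a1] app_comp[OF Cmp_in[OF b1 b2]] app_comp[OF b1]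
          p_closed T_Obj O assoc_p swap_p tensor_map_p[OF s(1) Idt_in[OF O(3)]] tensor_map_p[OF Idt_in[OF O(2)] s(2)])
  qed
qed (use T_Obj tensor_map_arrow assoc_iso lunit_iso swap_iso swap_swap in auto)

section \<open>Internal homs and the tensor-hom adjunction\<close>

definition hom_module :: "('k, 'u) module \<Rightarrow> ('k, 'u) module \<Rightarrow> ('k, 'u \<Rightarrow> 'u) module" where
  "hom_module y z = \<lparr>carrier = linear_maps k y z, monoid.mult = (\<lambda>f g. f), one = (\<lambda>b \<in> carrier y. \<zero>\<^bsub>z\<^esub>),
     zero = (\<lambda>b \<in> carrier y. \<zero>\<^bsub>z\<^esub>), add = (\<lambda>f g. \<lambda>b \<in> carrier y. f b \<oplus>\<^bsub>z\<^esub> g b),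
     smult = (\<lambda>c f. \<lambda>b \<in> carrier y. c \<odot>\<^bsub>z\<^esub> f b)\<rparr>"

lemma linear_maps_restrict:
  assumes "left_module k y"
  shows "restrict f (carrier y) \<in> linear_maps k y z \<longleftrightarrow> is_linear k y z f"
  using is_linear_cong[of y "restrict f (carrier y)" f k z] assms by (simp add: linear_maps_iff)

lemma left_module_hom:
  assumes y: "left_module k y" and z: "left_module k z"
  shows "left_module k (hom_module y z)"
proof -
  interpret y: left_module k y by fact
  interpret z: left_module k z by fact
  have lin: "is_linear k y z f" "f \<in> extensional (carrier y)" if "f \<in> linear_maps k y z" for f
    using that by (auto simp: linear_maps_iff)
  have cl: "f b \<in> carrier z" if "f \<in> linear_maps k y z" "b \<in> carrier y" for f b
    using linear_closed[OF lin(1)[OF that(1)] that(2)] .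
  have sum: "is_linear k y z (\<lambda>b. f b \<oplus>\<^bsub>z\<^esub> g b)" if "f \<in> linear_maps k y z" "g \<in> linear_maps k y z" for f g
    using is_linear_sum[OF y z] lin that by blast
  have sm: "is_linear k y z (\<lambda>b. c \<odot>\<^bsub>z\<^esub> f b)" if c: "c \<in> carrier k" and f: "f \<in> linear_maps k y z" for c f
    using c cl[OF f] lin[OF f]
    by (intro is_linearI) (auto simp: z.smult_closed linear_add linear_smult z.smult_r_distr z.smult_assoc[symmetric] m_comm)
  have zr: "is_linear k y z (\<lambda>b. \<zero>\<^bsub>z\<^esub>)" by (intro is_linearI) (auto simp: z.smult_r_null)
  show ?thesis
  proof (rule left_moduleI, goal_cases)
    case 1 then show ?case by (rule ring_axioms)
  qed (auto simp: hom_module_def linear_maps_restrict[OF y] sum sm zr cl lin z.M.a_ac z.smult_l_distr z.smult_r_distr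
      z.smult_assoc z.smult_one z.smult_minus_one z.M.l_neg z.M.r_neg z.smult_closed
      intro!: restrict_ext extensionalityI[of _ "carrier y"])
qed

lemma hom_small: "\<lbrakk>small U (carrier y); small U (carrier z)\<rbrakk> \<Longrightarrow> small U (linear_maps k y z)"
  by (rule small_subset[OF small_PiE[OF universe, of "carrier y" "carrier z"]]) (auto simp: linear_maps_def)

text \<open>An arbitrary injection of the small set of linear maps into the universe;
  \<open>dec\<close> undoes it.\<close>

definition enc :: "('k, 'u) module \<Rightarrow> ('k, 'u) module \<Rightarrow> ('u \<Rightarrow> 'u) \<Rightarrow> 'u" where
  "enc y z = (SOME j. inj_on j (linear_maps k y z))"

definition dec :: "('k, 'u) module \<Rightarrow> ('k, 'u) module \<Rightarrow> 'u \<Rightarrow> 'u \<Rightarrow> 'u" where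
  "dec y z = inv_into (linear_maps k y z) (enc y z)"

definition ihom :: "('k, 'u) module \<Rightarrow> ('k, 'u) module \<Rightarrow> ('k, 'u) module" where
  "ihom y z = transported (enc y z) (hom_module y z)"

text \<open>These facts hide the coding. In particular, elements of \<open>ihom y z\<close> are
  equal as soon as they decode to the same function on \<open>y\<close>, which is how all later
  equations are checked.\<close>

lemma
  assumes y: "y \<in> Obj C" and z: "z \<in> Obj C"
  shows ihom_Obj: "ihom y z \<in> Obj C"
    and enc_closed: "is_linear k y z f \<Longrightarrow> enc y z (restrict f (carrier y)) \<in> carrier (ihom y z)"
    and dec_enc: "\<lbrakk>is_linear k y z f; b \<in> carrier y\<rbrakk> \<Longrightarrow> dec y z (enc y z (restrict f (carrier y))) b = f b"
    and dec_linear: "h \<in> carrier (ihom y z) \<Longrightarrow> is_linear k y z (dec y z h)"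
    and dec_ext: "\<lbrakk>h \<in> carrier (ihom y z); h' \<in> carrier (ihom y z);
      \<And>b. b \<in> carrier y \<Longrightarrow> dec y z h b = dec y z h' b\<rbrakk> \<Longrightarrow> h = h'"
    and dec_add: "\<lbrakk>h \<in> carrier (ihom y z); h' \<in> carrier (ihom y z); b \<in> carrier y\<rbrakk> \<Longrightarrow>
      dec y z (h \<oplus>\<^bsub>ihom y z\<^esub> h') b = dec y z h b \<oplus>\<^bsub>z\<^esub> dec y z h' b"
    and dec_smult: "\<lbrakk>c \<in> carrier k; h \<in> carrier (ihom y z); b \<in> carrier y\<rbrakk> \<Longrightarrow>
      dec y z (c \<odot>\<^bsub>ihom y z\<^esub> h) b = c \<odot>\<^bsub>z\<^esub> dec y z h b"
proof -
  have ly: "left_module k y" and lz: "left_module k z" using y z by (auto simp: Obj_iff)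
  have sm: "small U (linear_maps k y z)" using y z hom_small by (auto simp: Obj_iff)
  have inj: "inj_on (enc y z) (linear_maps k y z)"
    unfolding enc_def using someI_ex[OF small_embedding[OF sm]] .
  have car [simp]: "carrier (hom_module y z) = linear_maps k y z" by (simp add: hom_module_def)
  note tr = left_module_transported[OF left_module_hom[OF ly lz]] linear_inv_transported[OF left_module_hom[OF ly lz]]
  show "ihom y z \<in> Obj C"
    using tr(1)[of "enc y z"] inj small_image[OF sm] by (auto simp: Obj_iff ihom_def)
  show "enc y z (restrict f (carrier y)) \<in> carrier (ihom y z)" if "is_linear k y z f"
    using that ly by (simp add: ihom_def linear_maps_restrict)
  show "dec y z (enc y z (restrict f (carrier y))) b = f b" if "is_linear k y z f" "b \<in> carrier y"
    using that ly inj by (simp add: dec_def linear_maps_restrict inv_into_f_f)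
  have dec: "dec y z h \<in> linear_maps k y z" "enc y z (dec y z h) = h" if "h \<in> carrier (ihom y z)" for h
    using that by (auto simp: dec_def ihom_def inv_into_into f_inv_into_f)
  show "is_linear k y z (dec y z h)" if "h \<in> carrier (ihom y z)"
    using dec(1)[OF that] by (simp add: linear_maps_iff)
  show "h = h'" if "h \<in> carrier (ihom y z)" "h' \<in> carrier (ihom y z)"
    "\<And>b. b \<in> carrier y \<Longrightarrow> dec y z h b = dec y z h' b"
  proof -
    have "dec y z h \<in> extensional (carrier y)" "dec y z h' \<in> extensional (carrier y)"
      using dec(1) that(1,2) by (simp_all add: linear_maps_iff)
    then have "dec y z h = dec y z h'" using that(3) by (rule extensionalityI)
    then show ?thesis using dec(2) that(1,2) by metis
  qed
  have l: "is_linear k (ihom y z) (hom_module y z) (dec y z)"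
    using tr(2)[of "enc y z"] inj by (simp add: ihom_def dec_def)
  show "dec y z (h \<oplus>\<^bsub>ihom y z\<^esub> h') b = dec y z h b \<oplus>\<^bsub>z\<^esub> dec y z h' b"
    if "h \<in> carrier (ihom y z)" "h' \<in> carrier (ihom y z)" "b \<in> carrier y"
    using linear_add[OF l that(1,2)] that(3) by (simp add: hom_module_def)
  show "dec y z (c \<odot>\<^bsub>ihom y z\<^esub> h) b = c \<odot>\<^bsub>z\<^esub> dec y z h b"
    if "c \<in> carrier k" "h \<in> carrier (ihom y z)" "b \<in> carrier y"
    using linear_smult[OF l that(1,2)] that(3) by (simp add: hom_module_def)
qed

text \<open>Decoding turns linearity of the curried map into linearity of \<beta> in its first
  argument.\<close>

lemma curry_arrow:
  assumes x: "x \<in> Obj C" and y: "y \<in> Obj C" and z: "z \<in> Obj C" and \<beta>: "is_bilinear k x y z \<beta>"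
  shows "mk x (\<lambda>a. enc y z (restrict (\<beta> a) (carrier y))) (ihom y z) \<in> arrows C x (ihom y z)"
proof -
  interpret x: left_module k x using x by (simp add: Obj_iff)
  interpret h: left_module k "ihom y z" using ihom_Obj[OF y z] by (simp add: Obj_iff)
  have lin: "is_linear k y z (\<beta> a)" if "a \<in> carrier x" for a using \<beta> that by (simp add: is_bilinear_def)
  note e = enc_closed[OF y z lin] and d = dec_enc[OF y z lin]
  show ?thesis
  proof (intro mk_arrow is_linearI x ihom_Obj y z)
    show "enc y z (restrict (\<beta> (a \<oplus>\<^bsub>x\<^esub> a')) (carrier y)) =
      enc y z (restrict (\<beta> a) (carrier y)) \<oplus>\<^bsub>ihom y z\<^esub> enc y z (restrict (\<beta> a') (carrier y))"
      if "a \<in> carrier x" "a' \<in> carrier x" for a a'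
      by (rule dec_ext[OF y z]) (use that in \<open>auto simp: e d dec_add[OF y z] bilinear_add_left[OF \<beta>]\<close>)
    show "enc y z (restrict (\<beta> (c \<odot>\<^bsub>x\<^esub> a)) (carrier y)) =
      c \<odot>\<^bsub>ihom y z\<^esub> enc y z (restrict (\<beta> a) (carrier y))"
      if "c \<in> carrier k" "a \<in> carrier x" for c a
      by (rule dec_ext[OF y z]) (use that in \<open>auto simp: e d dec_smult[OF y z] bilinear_smult_left[OF \<beta>] x.smult_closed h.smult_closed\<close>)
  qed (rule e)
qed

lemma closed_structure:
  assumes y: "y \<in> Obj C"
  shows "\<exists>H \<phi>. adjunction C C (tensor_right C tensor_structure y) H \<phi>"
proof -
  \<comment> \<open>Postcomposition with \<open>g\<close>. A functor is given only the arrow, so the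
    source and target modules are recovered from its domain and codomain.\<close>
  define HA where "HA g = mk (ihom y (Dom C g)) (\<lambda>h. enc y (Cod C g) (\<lambda>b \<in> carrier y. app g (dec y (Dom C g) h b))) (ihom y (Cod C g))" for g
  define H where "H = \<lparr>FO = ihom y, FA = HA\<rparr>"
  define \<phi> :: "('k, 'u) module \<Rightarrow> ('k, 'u) module \<Rightarrow> ('k, 'u) modarrow \<Rightarrow> ('k, 'u) modarrow"
    where "\<phi> x z f = mk x (\<lambda>a. enc y z (\<lambda>b \<in> carrier y. app f (p x y a b))) (ihom y z)" for x z f
  note h = ihom_Obj[OF y] and dec_cl = linear_closed[OF dec_linear[OF y]]
  have HA_eq: "HA g = mk (ihom y z) (\<lambda>h. enc y z' (\<lambda>b \<in> carrier y. app g (dec y z h b))) (ihom y z')"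
    if "g \<in> arrows C z z'" for g z z'
    using that by (simp add: HA_def arrows_def)
  have gd: "is_linear k y z' (\<lambda>b. app g (dec y z h b))" if g: "g \<in> arrows C z z'" and "h \<in> carrier (ihom y z)" for g z z' h
    using is_linear_comp[OF dec_linear[OF y arrow_dom[OF g] that(2)] app_linear[OF g]] .
  have HA: "HA g \<in> arrows C (ihom y z) (ihom y z')" if g: "g \<in> arrows C z z'" for g z z'
  proof -
    note O = arrow_Obj[OF g]
    interpret h: left_module k "ihom y z" using h[OF O(1)] by (simp add: Obj_iff)
    have "is_bilinear k (ihom y z) y z' (\<lambda>h b. app g (dec y z h b))"
      using gd[OF g] O
      by (auto simp: is_bilinear_def app_add[OF g] app_smult[OF g] dec_add[OF y] dec_smult[OF y] dec_cl app_closed[OF g]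
          intro!: is_linearI)
    then show ?thesis using curry_arrow[OF h[OF O(1)] y O(2)] by (simp add: HA_eq[OF g])
  qed
  have dec_HA: "dec y z' (app (HA g) h) b = app g (dec y z h b)"
    if g: "g \<in> arrows C z z'" and "h \<in> carrier (ihom y z)" "b \<in> carrier y" for g z z' h b
    using that dec_enc[OF y arrow_cod[OF g] gd[OF g]] by (simp add: HA_eq[OF g])
  have fp: "is_bilinear k x y z (\<lambda>a b. app f (p x y a b))" if "x \<in> Obj C" "f \<in> arrows C (T x y) z" for x z f
    using is_bilinear_post[OF p_bilinear[OF that(1) y] app_linear[OF that(2)]] .
  have \<phi>: "\<phi> x z f \<in> arrows C x (ihom y z)" if "x \<in> Obj C" "f \<in> arrows C (T x y) z" for x z f
    unfolding \<phi>_def using curry_arrow[OF that(1) y arrow_cod[OF that(2)] fp[OF that]] .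
  have dec_\<phi>: "dec y z (app (\<phi> x z f) a) b = app f (p x y a b)"
    if "x \<in> Obj C" "f \<in> arrows C (T x y) z" "a \<in> carrier x" "b \<in> carrier y" for x z f a b
    using dec_enc[OF y arrow_cod[OF that(2)], of "\<lambda>b. app f (p x y a b)"] fp[OF that(1,2)] that
    by (simp add: \<phi>_def is_bilinear_def)
  have "adjunction C C (tensor_right C tensor_structure y) H \<phi>"
    unfolding adjunction_def
  proof (intro conjI ballI)
    interpret symmetric_monoidal C tensor_structure by (rule symmetric_monoidal_structure)
    show "is_functor C C (tensor_right C tensor_structure y)"
      using y T_Obj tensor_map_arrow Idt_in tenA_Idt tenA_Cmp[of _ _ _ _ _ "Idt C y" y y "Idt C y" y] Cmp_Idt[OF Idt_in[OF y]]
      by (auto simp: is_functor_def tensor_right_def)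
    show "is_functor C C H"
      unfolding is_functor_def H_def ftor.select_convs
    proof (intro conjI ballI)
      show "ihom y x \<in> Obj C" if "x \<in> Obj C" for x using h[OF that] .
      show "HA f \<in> arrows C (ihom y x) (ihom y z)" if "f \<in> arrows C x z" for x z f using HA[OF that] .
      show "HA (Idt C x) = Idt C (ihom y x)" if x: "x \<in> Obj C" for x
      proof (rule arrow_eqI[OF HA[OF Idt_in[OF x]] Idt_in[OF h[OF x]]])
        fix a assume a: "a \<in> carrier (ihom y x)"
        show "app (HA (Idt C x)) a = app (Idt C (ihom y x)) a"
          by (rule dec_ext[OF y x]) (use a in \<open>auto simp: dec_HA[OF Idt_in[OF x]] app_closed[OF HA[OF Idt_in[OF x]]] dec_cl x\<close>)
      qed
      show "HA (g \<Zsemi> f) = HA g \<Zsemi> HA f" if f: "f \<in> arrows C x z" and g: "g \<in> arrows C z w" for x z w f g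
      proof (rule arrow_eqI[OF HA[OF Cmp_in[OF f g]] Cmp_in[OF HA[OF f] HA[OF g]]])
        fix a assume a: "a \<in> carrier (ihom y x)"
        note O = arrow_Obj[OF f] arrow_Obj[OF g]
        show "app (HA (g \<Zsemi> f)) a = app (HA g \<Zsemi> HA f) a"
          by (rule dec_ext[OF y O(4)]) (use a in \<open>auto simp: dec_HA[OF Cmp_in[OF f g]] dec_HA[OF f] dec_HA[OF g] app_comp[OF f] app_comp[OF HA[OF f]]
              app_closed[OF HA[OF f]] app_closed[OF HA[OF g]] app_closed[OF HA[OF Cmp_in[OF f g]]] dec_cl O\<close>)
      qed
    qed
  next
    fix x z assume x: "x \<in> Obj C" and z: "z \<in> Obj C"
    show "bij_betw (\<phi> x z) (arrows C (FO (tensor_right C tensor_structure y) x) z) (arrows C x (FO H z))"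
    proof (simp add: tensor_right_def H_def bij_betw_def, intro conjI)
      show "inj_on (\<phi> x z) (arrows C (T x y) z)"
      proof (rule inj_onI)
        fix f f' assume f: "f \<in> arrows C (T x y) z" "f' \<in> arrows C (T x y) z" "\<phi> x z f = \<phi> x z f'"
        show "f = f'"
          by (rule p_ext[OF x y f(1,2)]) (metis dec_\<phi>[OF x] f)
      qed
      show "\<phi> x z ` arrows C (T x y) z = arrows C x (ihom y z)"
      proof (intro equalityI subsetI)
        fix g assume g: "g \<in> arrows C x (ihom y z)"
        \<comment> \<open>Uncurrying: the map (a, b) -> g(a)(b) is bilinear, and its extension to
          \<open>T x y\<close> is the preimage of \<open>g\<close>.\<close>
        have "is_bilinear k x y z (\<lambda>a b. dec y z (app g a) b)"
          using dec_linear[OF y z] app_closed[OF g]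
          by (auto simp: is_bilinear_def app_add[OF g] app_smult[OF g] dec_add[OF y z] dec_smult[OF y z] dec_cl[OF z]
              intro!: is_linearI)
        then obtain f where f: "f \<in> arrows C (T x y) z"
          "\<And>a b. \<lbrakk>a \<in> carrier x; b \<in> carrier y\<rbrakk> \<Longrightarrow> app f (p x y a b) = dec y z (app g a) b"
          using p_lift[OF x y z] by metis
        have "\<phi> x z f = g"
        proof (rule arrow_eqI[OF \<phi>[OF x f(1)] g])
          show "app (\<phi> x z f) a = app g a" if "a \<in> carrier x" for a
            by (rule dec_ext[OF y z]) (use that in \<open>auto simp: dec_\<phi>[OF x f(1)] f app_closed[OF g] app_closed[OF \<phi>[OF x f(1)]]\<close>)
        qed
        then show "g \<in> \<phi> x z ` arrows C (T x y) z" using f by blast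
      qed (use \<phi>[OF x] in auto)
    qed
  next
    fix x x' z z' h f g
    assume O: "x \<in> Obj C" "x' \<in> Obj C" "z \<in> Obj C" "z' \<in> Obj C" and hx: "h \<in> arrows C x' x"
      and "f \<in> arrows C (FO (tensor_right C tensor_structure y) x) z" and g: "g \<in> arrows C z z'"
    then have f: "f \<in> arrows C (T x y) z" by (simp add: tensor_right_def)
    note t = tensor_map_arrow[OF hx Idt_in[OF y]]
    note ft = Cmp_in[OF t f] note gft = Cmp_in[OF ft g]
    note r1 = Cmp_in[OF hx \<phi>[OF O(1) f]] note r = Cmp_in[OF r1 HA[OF g]]
    have "\<phi> x' z' (g \<Zsemi> f \<Zsemi> tensor_map h (Idt C y)) = HA g \<Zsemi> \<phi> x z f \<Zsemi> h"
    proof (rule arrow_eqI[OF \<phi>[OF O(2) gft] r])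
      fix a assume a: "a \<in> carrier x'"
      show "app (\<phi> x' z' (g \<Zsemi> f \<Zsemi> tensor_map h (Idt C y))) a = app (HA g \<Zsemi> \<phi> x z f \<Zsemi> h) a"
        by (rule dec_ext[OF y O(4)]) (use a in \<open>auto simp: app_closed[OF \<phi>[OF O(2) gft]] app_closed[OF HA[OF g]] dec_\<phi>[OF O(2) gft] app_comp[OF r1] app_comp[OF hx]
            dec_HA[OF g] dec_\<phi>[OF O(1) f] app_closed[OF \<phi>[OF O(1) f]] app_closed[OF hx]
            app_comp[OF ft] app_comp[OF t] p_closed[OF O(2) y] tensor_map_p[OF hx Idt_in[OF y]]\<close>)
    qed
    then show "\<phi> x' z' (g \<Zsemi> f \<Zsemi> FA (tensor_right C tensor_structure y) h) = FA H g \<Zsemi> \<phi> x z f \<Zsemi> h"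
      by (simp add: tensor_right_def H_def)
  qed
  then show ?thesis by blast
qed

lemma additive_closed_structure: "additive_closed_symmetric_monoidal C tensor_structure"
proof (intro additive_closed_symmetric_monoidal.intro closed_symmetric_monoidal.intro
    symmetric_monoidal_structure closed_symmetric_monoidal_axioms.intro closed_structure
    additive_closed_symmetric_monoidal_axioms.intro)
  show "is_additive C C (tensor_right C tensor_structure y)" if y: "y \<in> Obj C" for y
    unfolding is_additive_def
  proof (intro ballI)
    fix x z f f' assume O: "x \<in> Obj C" "z \<in> Obj C" and f: "f \<in> arrows C x z" "f' \<in> arrows C x z"
    note t = tensor_map_arrow[OF f(1) Idt_in[OF y]] tensor_map_arrow[OF f(2) Idt_in[OF y]]
      tensor_map_arrow[OF Pls_in[OF f] Idt_in[OF y]]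
    have "tensor_map (Pls C f f') (Idt C y) = Pls C (tensor_map f (Idt C y)) (tensor_map f' (Idt C y))"
      by (rule p_ext[OF O(1) y t(3) Pls_in[OF t(1,2)]])
        (simp add: app_Pls[OF t(1,2)] app_Pls[OF f] p_closed O y tensor_map_p[OF f(1) Idt_in[OF y]]
          tensor_map_p[OF f(2) Idt_in[OF y]] tensor_map_p[OF Pls_in[OF f] Idt_in[OF y]] app_closed[OF f(1)] app_closed[OF f(2)]
          bilinear_add_left[OF p_bilinear[OF O(2) y]])
    then show "FA (tensor_right C tensor_structure y) (Pls C f f') =
        Pls C (FA (tensor_right C tensor_structure y) f) (FA (tensor_right C tensor_structure y) f')"
      by (simp add: tensor_right_def)
  qed
  show "is_additive C C (tensor_left C tensor_structure y)" if y: "y \<in> Obj C" for y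
    unfolding is_additive_def
  proof (intro ballI)
    fix x z f f' assume O: "x \<in> Obj C" "z \<in> Obj C" and f: "f \<in> arrows C x z" "f' \<in> arrows C x z"
    note t = tensor_map_arrow[OF Idt_in[OF y] f(1)] tensor_map_arrow[OF Idt_in[OF y] f(2)]
      tensor_map_arrow[OF Idt_in[OF y] Pls_in[OF f]]
    have "tensor_map (Idt C y) (Pls C f f') = Pls C (tensor_map (Idt C y) f) (tensor_map (Idt C y) f')"
      by (rule p_ext[OF y O(1) t(3) Pls_in[OF t(1,2)]])
        (simp add: app_Pls[OF t(1,2)] app_Pls[OF f] p_closed O y tensor_map_p[OF Idt_in[OF y] f(1)]
          tensor_map_p[OF Idt_in[OF y] f(2)] tensor_map_p[OF Idt_in[OF y] Pls_in[OF f]] app_closed[OF f(1)] app_closed[OF f(2)]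
          bilinear_add_right[OF p_bilinear[OF y O(2)]])
    then show "FA (tensor_left C tensor_structure y) (Pls C f f') =
        Pls C (FA (tensor_left C tensor_structure y) f) (FA (tensor_left C tensor_structure y) f')"
      by (simp add: tensor_left_def)
  qed
qed

end

section \<open>Existence\<close>

locale field_modules = module_category k U + field k
  for k :: "('k, 'x) ring_scheme" and U :: "'u itself" +
  assumes universe: "universe U" and k_small: "small U (carrier k)"
begin

lemma division_ring: "division_ring k"
  by (intro division_ring.intro division_ring_axioms.intro ring_axioms) (use field_Units in auto)

text \<open>The tensor product of \<open>x\<close> and \<open>y\<close> is realised as the span of the evaluations \<open>\<beta> \<mapsto> \<beta> (a, b)\<close> in
  the space of functions on the set of bilinear forms.\<close>

definition forms :: "('k, 'u) module \<Rightarrow> ('k, 'u) module \<Rightarrow> ('u \<times> 'u \<Rightarrow> 'k) set" where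
  "forms x y = {\<beta> \<in> carrier x \<times> carrier y \<rightarrow>\<^sub>E carrier k. is_bilinear k x y (regular_module k) (\<lambda>a b. \<beta> (a, b))}"

definition pure :: "('k, 'u) module \<Rightarrow> ('k, 'u) module \<Rightarrow> 'u \<Rightarrow> 'u \<Rightarrow> ('u \<times> 'u \<Rightarrow> 'k) \<Rightarrow> 'k" where
  "pure x y a b = (\<lambda>\<beta> \<in> forms x y. \<beta> (a, b))"

text \<open>Closing the pure tensors under sums already gives a submodule: a scalar is absorbed by
  the first factor of each summand, and zero is the multiple by 0 of a pure tensor.\<close>

inductive_set span :: "('k, 'u) module \<Rightarrow> ('k, 'u) module \<Rightarrow> (('u \<times> 'u \<Rightarrow> 'k) \<Rightarrow> 'k) set"
  for x y where
  span_pure: "\<lbrakk>a \<in> carrier x; b \<in> carrier y\<rbrakk> \<Longrightarrow> pure x y a b \<in> span x y"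
| span_add: "\<lbrakk>s \<in> span x y; t \<in> span x y\<rbrakk> \<Longrightarrow> (\<lambda>\<beta> \<in> forms x y. s \<beta> \<oplus>\<^bsub>k\<^esub> t \<beta>) \<in> span x y"

definition span_module :: "('k, 'u) module \<Rightarrow> ('k, 'u) module \<Rightarrow> ('k, ('u \<times> 'u \<Rightarrow> 'k) \<Rightarrow> 'k) module" where
  "span_module x y = \<lparr>carrier = span x y, monoid.mult = (\<lambda>s t. s), one = (\<lambda>\<beta> \<in> forms x y. \<zero>\<^bsub>k\<^esub>),
     zero = (\<lambda>\<beta> \<in> forms x y. \<zero>\<^bsub>k\<^esub>), add = (\<lambda>s t. \<lambda>\<beta> \<in> forms x y. s \<beta> \<oplus>\<^bsub>k\<^esub> t \<beta>),
     smult = (\<lambda>c s. \<lambda>\<beta> \<in> forms x y. c \<otimes>\<^bsub>k\<^esub> s \<beta>)\<rparr>"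

lemma span_module_simps [simp]:
  "carrier (span_module x y) = span x y" "zero (span_module x y) = (\<lambda>\<beta> \<in> forms x y. \<zero>\<^bsub>k\<^esub>)"
  "add (span_module x y) = (\<lambda>s t. \<lambda>\<beta> \<in> forms x y. s \<beta> \<oplus>\<^bsub>k\<^esub> t \<beta>)"
  "smult (span_module x y) = (\<lambda>c s. \<lambda>\<beta> \<in> forms x y. c \<otimes>\<^bsub>k\<^esub> s \<beta>)"
  by (simp_all add: span_module_def)

lemma forms_bilinear: "\<beta> \<in> forms x y \<Longrightarrow> is_bilinear k x y (regular_module k) (\<lambda>a b. \<beta> (a, b))"
  by (simp add: forms_def)

lemma forms_closed: "\<lbrakk>\<beta> \<in> forms x y; a \<in> carrier x; b \<in> carrier y\<rbrakk> \<Longrightarrow> \<beta> (a, b) \<in> carrier k"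
  by (auto simp: forms_def)

lemma span_PiE: "s \<in> span x y \<Longrightarrow> s \<in> forms x y \<rightarrow>\<^sub>E carrier k"
  by (induction rule: span.induct) (simp_all add: PiE_iff pure_def forms_closed extensional_def)

lemma span_closed: "\<lbrakk>s \<in> span x y; \<beta> \<in> forms x y\<rbrakk> \<Longrightarrow> s \<beta> \<in> carrier k"
  using span_PiE by blast

lemma pure_simps:
  assumes x: "left_module k x" and y: "left_module k y"
  shows pure_add_left: "\<lbrakk>a \<in> carrier x; a' \<in> carrier x; b \<in> carrier y\<rbrakk> \<Longrightarrow>
      pure x y (a \<oplus>\<^bsub>x\<^esub> a') b = (\<lambda>\<beta> \<in> forms x y. pure x y a b \<beta> \<oplus>\<^bsub>k\<^esub> pure x y a' b \<beta>)"
    and pure_add_right: "\<lbrakk>a \<in> carrier x; b \<in> carrier y; b' \<in> carrier y\<rbrakk> \<Longrightarrow>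
      pure x y a (b \<oplus>\<^bsub>y\<^esub> b') = (\<lambda>\<beta> \<in> forms x y. pure x y a b \<beta> \<oplus>\<^bsub>k\<^esub> pure x y a b' \<beta>)"
    and pure_smult_left: "\<lbrakk>c \<in> carrier k; a \<in> carrier x; b \<in> carrier y\<rbrakk> \<Longrightarrow>
      pure x y (c \<odot>\<^bsub>x\<^esub> a) b = (\<lambda>\<beta> \<in> forms x y. c \<otimes>\<^bsub>k\<^esub> pure x y a b \<beta>)"
    and pure_smult_right: "\<lbrakk>c \<in> carrier k; a \<in> carrier x; b \<in> carrier y\<rbrakk> \<Longrightarrow>
      pure x y a (c \<odot>\<^bsub>y\<^esub> b) = (\<lambda>\<beta> \<in> forms x y. c \<otimes>\<^bsub>k\<^esub> pure x y a b \<beta>)"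
  using bilinear_add_left[OF forms_bilinear] bilinear_add_right[OF forms_bilinear]
    bilinear_smult_left[OF forms_bilinear] bilinear_smult_right[OF forms_bilinear]
  by (auto simp: pure_def intro!: restrict_ext)

lemma span_smult:
  assumes x: "left_module k x" and y: "left_module k y" and c: "c \<in> carrier k" and "s \<in> span x y"
  shows "(\<lambda>\<beta> \<in> forms x y. c \<otimes>\<^bsub>k\<^esub> s \<beta>) \<in> span x y"
  using assms(4)
proof (induction rule: span.induct)
  case (span_pure a b)
  then show ?case
    using left_module.smult_closed[OF x c] by (simp add: pure_smult_left[OF x y c, symmetric] span.span_pure)
next
  case (span_add s t)
  have eq: "(\<lambda>\<beta> \<in> forms x y. c \<otimes>\<^bsub>k\<^esub> (\<lambda>\<beta> \<in> forms x y. s \<beta> \<oplus>\<^bsub>k\<^esub> t \<beta>) \<beta>) =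
    (\<lambda>\<beta> \<in> forms x y. (\<lambda>\<beta> \<in> forms x y. c \<otimes>\<^bsub>k\<^esub> s \<beta>) \<beta> \<oplus>\<^bsub>k\<^esub> (\<lambda>\<beta> \<in> forms x y. c \<otimes>\<^bsub>k\<^esub> t \<beta>) \<beta>)"
    using span_add c by (intro restrict_ext) (simp add: r_distr span_closed)
  show ?case by (subst eq) (rule span.span_add[OF span_add.IH])
qed

lemma left_module_span:
  assumes x: "left_module k x" and y: "left_module k y"
  shows "left_module k (span_module x y)"
proof -
  interpret x: left_module k x by fact
  interpret y: left_module k y by fact
  have "(\<lambda>\<beta> \<in> forms x y. \<zero>\<^bsub>k\<^esub> \<otimes>\<^bsub>k\<^esub> pure x y \<zero>\<^bsub>x\<^esub> \<zero>\<^bsub>y\<^esub> \<beta>) \<in> span x y"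
    by (intro span_smult x y span_pure) auto
  then have zr: "(\<lambda>\<beta> \<in> forms x y. \<zero>\<^bsub>k\<^esub>) \<in> span x y"
    using span_closed[OF span_pure] by (simp cong: restrict_cong)
  have ext: "s \<in> extensional (forms x y)" if "s \<in> span x y" for s
    using span_PiE[OF that] by (simp add: PiE_def)
  show ?thesis
  proof (rule left_moduleI, goal_cases)
    case 1 then show ?case by (rule ring_axioms)
  qed (auto simp: zr span_add span_smult[OF x y] span_closed a_assoc l_distr r_distr m_assoc l_minus l_neg ext
      intro!: restrict_ext extensionalityI[of _ "forms x y"] a_comm)
qed

text \<open>Two exponentials: forms are functions from the product of the carriers to
  \<open>k\<close>, and elements of the span are functions from the forms to
  \<open>k\<close>.\<close>

lemma span_small:
  assumes "x \<in> Obj C" "y \<in> Obj C"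
  shows "small U (span x y)"
proof -
  have "small U (forms x y)"
    using assms small_PiE[OF universe small_Times[OF universe], of "carrier x" "carrier y" "carrier k"] k_small
    by (auto simp: Obj_iff forms_def intro: small_subset)
  then have "small U (forms x y \<rightarrow>\<^sub>E carrier k)" by (rule small_PiE[OF universe _ k_small])
  then show ?thesis by (rule small_subset) (use span_PiE in blast)
qed

text \<open>The graph of the linear extension of \<open>\<beta>\<close>. It is single-valued because the functionals
  \<open>\<theta> \<circ> \<beta>\<close> are among the bilinear forms.\<close>

inductive extension :: "('k, 'u) module \<Rightarrow> ('k, 'u) module \<Rightarrow> ('k, 'u) module \<Rightarrow> ('u \<Rightarrow> 'u \<Rightarrow> 'u) \<Rightarrow>
    (('u \<times> 'u \<Rightarrow> 'k) \<Rightarrow> 'k) \<Rightarrow> 'u \<Rightarrow> bool"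
  for x y z \<beta> where
  extension_pure: "\<lbrakk>a \<in> carrier x; b \<in> carrier y\<rbrakk> \<Longrightarrow> extension x y z \<beta> (pure x y a b) (\<beta> a b)"
| extension_add: "\<lbrakk>extension x y z \<beta> s v; extension x y z \<beta> t w\<rbrakk> \<Longrightarrow>
    extension x y z \<beta> (\<lambda>\<gamma> \<in> forms x y. s \<gamma> \<oplus>\<^bsub>k\<^esub> t \<gamma>) (v \<oplus>\<^bsub>z\<^esub> w)"

lemma span_lift:
  fixes x y z :: "('k, 'u) module"
  assumes x: "left_module k x" and y: "left_module k y" and z: "left_module k z" and \<beta>: "is_bilinear k x y z \<beta>"
  shows "\<exists>F. is_linear k (span_module x y) z F \<and> (\<forall>a \<in> carrier x. \<forall>b \<in> carrier y. F (pure x y a b) = \<beta> a b)"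
proof -
  interpret x: left_module k x by fact
  interpret z: left_module k z by fact
  let ?E = "extension x y z \<beta>"
  have E_span: "s \<in> span x y \<and> v \<in> carrier z" if "?E s v" for s v
    using that
  proof induction
    case (extension_add s v t w)
    then show ?case using span_add[of s x y t] by blast
  qed (auto intro: span_pure bilinear_closed[OF \<beta>])
  have E_total: "\<exists>v. ?E s v" if "s \<in> span x y" for s
    using that
  proof induction
    case (span_add s t)
    then show ?case using extension_add[of x y z \<beta> s _ t] by blast
  qed (blast intro: extension_pure)
  \<comment> \<open>The composite of \<theta> with \<beta> is one of the forms on which elements of
    the span are evaluated. So \<open>s\<close> alone determines the value of \<theta> at any
    \<open>v\<close> related to it.\<close>
  have E_functional: "\<theta> v = s (\<lambda>(a, b) \<in> carrier x \<times> carrier y. \<theta> (\<beta> a b))"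
    if "?E s v" and \<theta>: "is_linear k z (regular_module k) \<theta>" for s v \<theta>
  proof -
    define \<gamma> where "\<gamma> = (\<lambda>(a, b) \<in> carrier x \<times> carrier y. \<theta> (\<beta> a b))"
    have \<gamma>: "\<gamma> \<in> forms x y"
    proof -
      interpret y: left_module k y by fact
      have b: "is_bilinear k x y (regular_module k) (\<lambda>a b. \<theta> (\<beta> a b))" by (rule is_bilinear_post[OF \<beta> \<theta>])
      have "is_bilinear k x y (regular_module k) (\<lambda>a b. \<gamma> (a, b))"
        using bilinear_add_left[OF b] bilinear_add_right[OF b] bilinear_smult_left[OF b] bilinear_smult_right[OF b]
          bilinear_closed[OF b]
        by (intro is_bilinearI) (auto simp: \<gamma>_def x.smult_closed y.smult_closed)
      then show ?thesis using bilinear_closed[OF b] by (auto simp: forms_def \<gamma>_def PiE_iff)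
    qed
    from that(1) have "\<theta> v = s \<gamma>"
    proof induction
      case (extension_pure a b)
      then show ?case using \<gamma> by (simp add: pure_def) (simp add: \<gamma>_def)
    next
      case (extension_add s v t w)
      then show ?case using \<gamma> E_span linear_add[OF \<theta>] by auto
    qed
    then show ?thesis by (simp add: \<gamma>_def)
  qed
  \<comment> \<open>Two values related to the same \<open>s\<close> agree under every functional,
    and over a division ring functionals separate points.\<close>
  have E_unique: "v = w" if "?E s v" "?E s w" for s v w
    using that E_span E_functional by (intro z.functional_eqI[OF division_ring]) metis+
  have E_smult: "?E (\<lambda>\<gamma> \<in> forms x y. c \<otimes>\<^bsub>k\<^esub> s \<gamma>) (c \<odot>\<^bsub>z\<^esub> v)" if c: "c \<in> carrier k" and "?E s v" for c s v
    using that(2)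
  proof induction
    case (extension_pure a b)
    then show ?case
      using extension.extension_pure[OF x.smult_closed[OF c]]
      by (metis pure_smult_left[OF x y c] bilinear_smult_left[OF \<beta> c])
  next
    case (extension_add s v t w)
    have "(\<lambda>\<gamma> \<in> forms x y. c \<otimes>\<^bsub>k\<^esub> (\<lambda>\<gamma> \<in> forms x y. s \<gamma> \<oplus>\<^bsub>k\<^esub> t \<gamma>) \<gamma>) =
      (\<lambda>\<gamma> \<in> forms x y. (\<lambda>\<gamma> \<in> forms x y. c \<otimes>\<^bsub>k\<^esub> s \<gamma>) \<gamma> \<oplus>\<^bsub>k\<^esub> (\<lambda>\<gamma> \<in> forms x y. c \<otimes>\<^bsub>k\<^esub> t \<gamma>) \<gamma>)"
      using E_span[OF extension_add.hyps(1)] E_span[OF extension_add.hyps(2)] c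
      by (intro restrict_ext) (simp add: r_distr[OF span_closed[of s x y] span_closed[of t x y] c])
    moreover have "c \<odot>\<^bsub>z\<^esub> (v \<oplus>\<^bsub>z\<^esub> w) = c \<odot>\<^bsub>z\<^esub> v \<oplus>\<^bsub>z\<^esub> c \<odot>\<^bsub>z\<^esub> w"
      using extension_add.hyps E_span c by (simp add: z.smult_r_distr)
    ultimately show ?case using extension.extension_add[OF extension_add.IH] by (simp only:)
  qed
  define F where "F s = (THE v. ?E s v)" for s
  have F_eq: "F s = v" if "?E s v" for s v
    unfolding F_def using that E_unique by blast
  have F: "?E s (F s)" if "s \<in> span x y" for s
    using E_total[OF that] F_eq by auto
  have "is_linear k (span_module x y) z F"
  proof (rule is_linearI)
    show "F s \<in> carrier z" if "s \<in> carrier (span_module x y)" for s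
      using F E_span that by auto
    show "F (s \<oplus>\<^bsub>span_module x y\<^esub> t) = F s \<oplus>\<^bsub>z\<^esub> F t"
      if "s \<in> carrier (span_module x y)" "t \<in> carrier (span_module x y)" for s t
      using F_eq[OF extension_add[OF F F]] that by simp
    show "F (c \<odot>\<^bsub>span_module x y\<^esub> s) = c \<odot>\<^bsub>z\<^esub> F s"
      if "c \<in> carrier k" "s \<in> carrier (span_module x y)" for c s
      using F_eq[OF E_smult[OF _ F]] that by simp
  qed
  moreover have "F (pure x y a b) = \<beta> a b" if "a \<in> carrier x" "b \<in> carrier y" for a b
    using F_eq[OF extension_pure[OF that]] .
  ultimately show ?thesis by blast
qed

section \<open>The tensor product and the unit inside the universe\<close>

definition code :: "('k, 'u) module \<Rightarrow> ('k, 'u) module \<Rightarrow> (('u \<times> 'u \<Rightarrow> 'k) \<Rightarrow> 'k) \<Rightarrow> 'u" where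
  "code x y = (SOME j. inj_on j (span x y))"

definition tensor :: "('k, 'u) module \<Rightarrow> ('k, 'u) module \<Rightarrow> ('k, 'u) module" where
  "tensor x y = transported (code x y) (span_module x y)"

definition pure_tensor :: "('k, 'u) module \<Rightarrow> ('k, 'u) module \<Rightarrow> 'u \<Rightarrow> 'u \<Rightarrow> 'u" where
  "pure_tensor x y a b = code x y (pure x y a b)"

lemma
  assumes "x \<in> Obj C" "y \<in> Obj C"
  shows code_inj: "inj_on (code x y) (span x y)"
    and tensor_Obj: "tensor x y \<in> Obj C"
    and code_linear: "is_linear k (span_module x y) (tensor x y) (code x y)"
    and decode_linear: "is_linear k (tensor x y) (span_module x y) (inv_into (span x y) (code x y))"
proof -
  show inj: "inj_on (code x y) (span x y)"
    unfolding code_def using someI_ex[OF small_embedding[OF span_small[OF assms]]] .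
  have l: "left_module k (span_module x y)" using left_module_span assms by (simp add: Obj_iff)
  have inj': "inj_on (code x y) (carrier (span_module x y))" using inj by simp
  show "tensor x y \<in> Obj C"
    using left_module_transported[OF l inj'] small_image[OF span_small[OF assms]]
    by (auto simp: Obj_iff tensor_def)
  show "is_linear k (span_module x y) (tensor x y) (code x y)"
    "is_linear k (tensor x y) (span_module x y) (inv_into (span x y) (code x y))"
    using linear_transported[OF l inj'] linear_inv_transported[OF l inj'] by (simp_all add: tensor_def)
qed

text \<open>The unit is a copy of \<open>k\<close> generated by the image of 1, and the product is
  the coded span of evaluations with the linear extensions of \<open>span_lift\<close>.\<close>

lemma tensor_system_exists: "\<exists>T p S u. tensor_system k U T p S u"
proof -
  obtain j :: "'k \<Rightarrow> 'u" where j: "inj_on j (carrier k)" using small_embedding[OF k_small] by auto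
  then have j': "inj_on j (carrier (regular_module k))" by simp
  define S where "S = transported j (regular_module k)"
  define u where "u = j \<one>\<^bsub>k\<^esub>"
  have S: "S \<in> Obj C"
    using left_module_transported[OF left_module_regular j'] small_image[OF k_small] by (auto simp: Obj_iff S_def)
  have S_lin: "is_linear k (regular_module k) S j" "is_linear k S (regular_module k) (inv_into (carrier k) j)"
    using linear_transported[OF left_module_regular j'] linear_inv_transported[OF left_module_regular j']
    by (simp_all add: S_def)
  have S_gen: "s = inv_into (carrier k) j s \<odot>\<^bsub>S\<^esub> u" "inv_into (carrier k) j s \<in> carrier k" if "s \<in> carrier S" for s
  proof -
    obtain c where c: "c \<in> carrier k" "s = j c" using \<open>s \<in> carrier S\<close> by (auto simp: S_def)
    then have "inv_into (carrier k) j s = c" by (simp add: inv_into_f_f[OF j])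
    moreover have "s = c \<odot>\<^bsub>S\<^esub> u"
      using linear_smult[OF S_lin(1), of c "\<one>\<^bsub>k\<^esub>"] c by (simp add: u_def)
    ultimately show "s = inv_into (carrier k) j s \<odot>\<^bsub>S\<^esub> u" "inv_into (carrier k) j s \<in> carrier k"
      using c by simp_all
  qed
  have u: "u \<in> carrier S" by (simp add: u_def S_def)
  have "tensor_system k U tensor pure_tensor S u"
  proof
    show "tensor x y \<in> Obj C" if "x \<in> Obj C" "y \<in> Obj C" for x y using tensor_Obj[OF that] .
    show "S \<in> Obj C" "u \<in> carrier S" by fact+
    fix x y assume x: "x \<in> Obj C" and y: "y \<in> Obj C"
    note l = Obj_left_module[OF x] Obj_left_module[OF y]
    note lin = code_linear[OF x y]
    show "is_bilinear k x y (tensor x y) (pure_tensor x y)"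
    proof (rule is_bilinearI)
      show "pure_tensor x y a b \<in> carrier (tensor x y)" if "a \<in> carrier x" "b \<in> carrier y" for a b
        using linear_closed[OF lin] span_pure[OF that] by (simp add: pure_tensor_def)
    qed (use linear_add[OF lin] linear_smult[OF lin] in \<open>auto simp: pure_tensor_def span_pure
        pure_add_left[OF l] pure_add_right[OF l] pure_smult_left[OF l] pure_smult_right[OF l]\<close>)
    show "f = g" if f: "f \<in> arrows C (tensor x y) z" and g: "g \<in> arrows C (tensor x y) z"
      and eq: "\<And>a b. \<lbrakk>a \<in> carrier x; b \<in> carrier y\<rbrakk> \<Longrightarrow> app f (pure_tensor x y a b) = app g (pure_tensor x y a b)" for f g z
    proof (rule arrow_eqI[OF f g])
      fix t assume "t \<in> carrier (tensor x y)"
      then obtain s where s: "s \<in> span x y" "t = code x y s" by (auto simp: tensor_def)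
      \<comment> \<open>Here pure tensors generate by construction, so extensionality is an
        induction over sums.\<close>
      from s(1) have "app f (code x y s) = app g (code x y s)"
      proof induction
        case (span_pure a b)
        then show ?case using eq by (simp add: pure_tensor_def)
      next
        case (span_add s t)
        have "code x y (\<lambda>\<beta> \<in> forms x y. s \<beta> \<oplus>\<^bsub>k\<^esub> t \<beta>) = code x y s \<oplus>\<^bsub>tensor x y\<^esub> code x y t"
          using linear_add[OF lin, of s t] span_add.hyps by simp
        moreover have "code x y s \<in> carrier (tensor x y)" "code x y t \<in> carrier (tensor x y)"
          using linear_closed[OF lin] span_add.hyps by simp_all
        ultimately show ?case
          using app_add[OF f] app_add[OF g] span_add.IH by (simp only:)
      qed
      then show "app f t = app g t" using s by simp
    qed
    fix z \<beta> assume z: "z \<in> Obj C" and \<beta>: "is_bilinear k x y z \<beta>"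
    obtain F where F: "is_linear k (span_module x y) z F"
      "\<And>a b. \<lbrakk>a \<in> carrier x; b \<in> carrier y\<rbrakk> \<Longrightarrow> F (pure x y a b) = \<beta> a b"
      using span_lift[OF l Obj_left_module[OF z] \<beta>] by auto
    define f where "f = mk (tensor x y) (\<lambda>t. F (inv_into (span x y) (code x y) t)) z"
    have f: "f \<in> arrows C (tensor x y) z"
      unfolding f_def by (intro mk_arrow tensor_Obj x y z is_linear_comp[OF decode_linear[OF x y] F(1)])
    have "app f (pure_tensor x y a b) = \<beta> a b" if "a \<in> carrier x" "b \<in> carrier y" for a b
      using that F(2) span_pure[OF that] linear_closed[OF lin]
      by (simp add: f_def pure_tensor_def inv_into_f_f[OF code_inj[OF x y]])
    with f show "\<exists>f \<in> arrows C (tensor x y) z. \<forall>a \<in> carrier x. \<forall>b \<in> carrier y. app f (pure_tensor x y a b) = \<beta> a b"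
      by blast
  next
    fix f g z assume f: "f \<in> arrows C S z" and g: "g \<in> arrows C S z" and eq: "app f u = app g u"
    show "f = g"
    proof (rule arrow_eqI[OF f g])
      fix s assume "s \<in> carrier S"
      then show "app f s = app g s" using S_gen app_smult[OF f _ u] app_smult[OF g _ u] eq by metis
    qed
  next
    fix z c assume z: "z \<in> Obj C" and c: "c \<in> carrier z"
    interpret z: left_module k z using z by (simp add: Obj_iff)
    have "mk S (\<lambda>s. inv_into (carrier k) j s \<odot>\<^bsub>z\<^esub> c) z \<in> arrows C S z"
      using S_gen(2) c linear_add[OF S_lin(2)] linear_smult[OF S_lin(2)]
      by (intro mk_arrow S z is_linearI) (auto simp: z.smult_closed z.smult_l_distr z.smult_assoc)
    moreover have "app (mk S (\<lambda>s. inv_into (carrier k) j s \<odot>\<^bsub>z\<^esub> c) z) u = c"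
      using u c by (simp add: inv_into_f_f[OF j] z.smult_one) (simp add: u_def inv_into_f_f[OF j] z.smult_one)
    ultimately show "\<exists>f \<in> arrows C S z. app f u = c" by blast
  qed
  then show ?thesis by blast
qed

lemma additive_closed_structure_exists: "\<exists>M. additive_closed_symmetric_monoidal C M"
proof -
  obtain T p S u where ts: "tensor_system k U T p S u" using tensor_system_exists by blast
  then interpret tensor_system k U T p S u .
  interpret commutative_tensor_system k U T p S u
    by (intro commutative_tensor_system.intro ts is_cring commutative_tensor_system_axioms.intro universe)
  show ?thesis using additive_closed_structure by blast
qed

end

theorem theorem3p3:
  fixes k :: "('k, 'x) ring_scheme"
  assumes "division_ring k"
    and "universe TYPE('u)"
    and "small TYPE('u) (carrier k)"
  shows "(\<not> field k \<longrightarrow>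
            \<not> (\<exists>M. additive_closed_symmetric_monoidal (Mod k TYPE('u)) M)) \<and>
         (field k \<longrightarrow>
            (\<exists>M. additive_closed_symmetric_monoidal (Mod k TYPE('u)) M) \<and>
            (\<forall>M N. additive_closed_symmetric_monoidal (Mod k TYPE('u)) M \<longrightarrow>
                   additive_closed_symmetric_monoidal (Mod k TYPE('u)) N \<longrightarrow>
                   symmetric_monoidally_equivalent (Mod k TYPE('u)) M N))"
proof -
  interpret division_ring k by fact
  have mm: "monoidal_modules k TYPE('u) M" if "additive_closed_symmetric_monoidal (Mod k TYPE('u)) M"
    for M :: "(('k, 'u) module, ('k, 'u) modarrow) monstr"
    by (intro monoidal_modules.intro module_category.intro monoidal_modules_axioms.intro
        ring_axioms division_ring_axioms assms that)
  have "field k" if "additive_closed_symmetric_monoidal (Mod k TYPE('u)) M"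
    for M :: "(('k, 'u) module, ('k, 'u) modarrow) monstr"
    using monoidal_modules.field[OF mm[OF that]] .
  moreover have "\<exists>M :: (('k, 'u) module, ('k, 'u) modarrow) monstr. additive_closed_symmetric_monoidal (Mod k TYPE('u)) M"
    if "field k"
    by (rule field_modules.additive_closed_structure_exists)
      (intro field_modules.intro module_category.intro field_modules_axioms.intro ring_axioms that assms)
  moreover have "symmetric_monoidally_equivalent (Mod k TYPE('u)) M N"
    if "additive_closed_symmetric_monoidal (Mod k TYPE('u)) M" "additive_closed_symmetric_monoidal (Mod k TYPE('u)) N"
    for M N :: "(('k, 'u) module, ('k, 'u) modarrow) monstr"
  proof -
    \<comment> \<open>Each structure is put into standard form with a generator of its own unit; the
      comparison of standard forms then matches the generators.\<close>
    have "\<exists>p u. standard_monoidal k TYPE('u) M p u" if "additive_closed_symmetric_monoidal (Mod k TYPE('u)) M"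
      for M :: "(('k, 'u) module, ('k, 'u) modarrow) monstr"
    proof -
      interpret monoidal_modules k "TYPE('u)" M by (rule mm[OF that])
      obtain u \<theta> where "u \<in> carrier S" "is_linear k S (regular_module k) \<theta>" "\<theta> u = \<one>\<^bsub>k\<^esub>"
        "\<And>s. s \<in> carrier S \<Longrightarrow> \<theta> s \<odot>\<^bsub>S\<^esub> u = s"
        using unit_line by auto
      then have "monoidal_modules_basis k TYPE('u) M u \<theta>"
        by (intro monoidal_modules_basis.intro monoidal_modules_axioms monoidal_modules_basis_axioms.intro)
      from monoidal_modules_basis.standard_monoidal[OF this] show ?thesis by (intro exI)
    qed
    from this[OF that(1)] this[OF that(2)] show ?thesis
      by (elim exE) (rule standard_monoidal_equivalent)
  qed
  ultimately show ?thesis by blast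
qed

end
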